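(* Assume that for some constants $C_0>0$ and $\alpha>0$, $\mu(B(x,r))\le C_0r^\alpha$ for all $x\in E$, $r>0$, where $B(x,r):=\{y\in E:d(y,x)<r\}$; that every $d$-bounded closed subset of $E$ is compact; and that $X$ satisfies one of the following sets of assumptions: (i) (symmetry) $\int_E P_tf\,g\,d\mu=\int_E f\,P_tg\,d\mu$ for all $t>0$ and all bounded Borel $f,g$; moreover $(E,d)$ is a locally compact separable metric space, $\mu$ is a positive Radon measure with full support, $X$ is a Hunt process, and the associated Dirichlet form $(\mathcal E,\mathcal F)$ of $X$ is regular on $L^2(E,\mu)$; (ii) (duality) there is another Borel right process $\widehat X$ on $E$, with transition function $(\widehat P_t)_{t\ge0}$ such that $\widehat P_t(x,\cdot)$ is absolutely continuous with respect to $\mu$ for every $t>0$, $x\in E$, and $\int_E P_tf\,g\,d\mu=\int_E f\,\widehat P_tg\,d\mu$ for all $t>0$ and all bounded Borel $f,g$; moreover $(E,d)$ is a locally compact separable metric space, $\mu$ is a Radon measure, and for $\lambda>0$ ($\lambda\ge0$ if $X$ is transient) and $f\in C_c(E)$, $y\mapsto\int_E u_\lambda(x,y)f(x)\,\mu(dx)$ is continuous on $E$; (iii) (sector condition) for each $t\ge0$ the restriction of $P_t$ to bounded Borel functions in $L^2(E,\mu)$ extends uniquely to a contraction on $L^2(E,\mu)$, and, with $\mathcal Lf=\lim_{t\to0}(P_tf-f)/t$ the generator, whose domain $\mathcal D(\mathcal L)$ is the set of $f$ for which the limit exists strongly in $L^2(E,\mu)$, there is a finite $K>0$ such that the form $\mathcal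 E(f,g):=(f,-\mathcal Lg)_\mu$ satisfies $|\mathcal E_1(f,g)|\le K\mathcal E_1(f,f)^{1/2}\mathcal E_1(g,g)^{1/2}$ for $f,g\in\mathcal D(\mathcal L)$, where $\mathcal E_1(f,g)=\mathcal E(f,g)+(f,g)_\mu$; moreover the associated semi-Dirichlet form $(\mathcal E,\mathcal F)$ of $X$ is regular. If the transition density function of $X$ satisfies, for some $\beta>1$, $C_2>0$, $T>0$ and some constants $c,C>0$ (with the same $\alpha$), $$\frac{c}{t^{\alpha/\beta}}\exp\left\{-C_2\left(\frac{d(y,z)}{t^{1/\beta}}\right)^{\beta/(\beta-1)}\right\}\le p(t,y,z)\le\frac{C}{t^{\alpha/\beta}}\exp\left\{-C_2\left(\frac{d(y,z)}{t^{1/\beta}}\right)^{\beta/(\beta-1)}\right\},\qquad 0<t\le T,\ y,z\in E,$$ then for any $x\in E$ and $B\in\mathscr B^n(E)$, $$\lim_{t\downarrow0}\frac{-t^{1/(\beta-1)}\cdot\log\mathbb P^x[\sigma_B\le t]}{C_2}=\widetilde d(x,B)^{\beta/(\beta-1)}.$$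
   Context: $(E,d)$ is a separable metric space whose induced topology is Lusin; $\mu$ is a $\sigma$-finite Borel measure on $E$ with full support; $X=(\Omega,\mathscr F,\mathscr F_t,X_t,\theta_t,\mathbb P^x)$ is a Borel right process on $E$ with transition function $(P_t)_{t\ge0}$ such that $P_t(x,\cdot)$ is absolutely continuous with respect to $\mu$ for every $t>0$, $x\in E$. Under this absolute continuity there is a nonnegative Borel function $p(t,x,y)$ on $(0,\infty)\times E\times E$, the transition density function, with $P_tf(x)=\int_E p(t,x,y)f(y)\,\mu(dy)$ for all bounded Borel $f$. For $\lambda\ge0$, $u_\lambda(x,y):=\int_0^\infty e^{-\lambda t}p(t,x,y)\,dt$. $X$ is transient if there is a strictly positive universally measurable $h$ with $\int_E u_0(x,y)h(y)\mu(dy)<\infty$ for all $x\in E$. A set is $d$-bounded if it is contained in some ball $\{y:d(y,o)<r\}$. In the symmetric case (where $p(t,x,y)=p(t,y,x)$ for all $t,x,y$), the associated Dirichlet form is $\mathcal F=\{f\in L^2(E,\mu):\lim_{t\downarrow0}\frac1t(f-P_tf,f)_\mu<\infty\}$, $\mathcal E(f,g)=\lim_{t\downarrow0}\frac1t(f-P_tf,g)_\mu$. In the duality case, $\widehat P_t$ has transition density $\widehat p(t,x,y)=p(t,y,x)$. In the sector condition case, the associated semi-Dirichlet form is $(\mathcal E,\mathcal F)$ with $\mathcal F$ the completion of $\mathcal D(\mathcal L)$ in the norm $\mathcal E_1(f,f)^{1/2}$. A Dirichlet or semi-Dirichlet form $(\mathcal E,\mathcal F)$ is regular if $(E,d)$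 is a locally compact separable metric space, $\mu$ is Radon, and $\mathcal F\cap C_c(E)$ is dense in $\mathcal F$ with respect to the $\mathcal E_1$-norm $\mathcal E_1(f,f)^{1/2}$, $\mathcal E_1(f,g)=\mathcal E(f,g)+(f,g)_\mu$, and dense in $C_c(E)$ with respect to the uniform norm. Nearly Borel sets $\mathscr B^n(E)$: $B\subset E$ such that for each probability measure $\nu$ on $E$ there are Borel $B_1\subset B\subset B_2$ with $\mathbb P^\nu(X_t\in B_2\setminus B_1\text{ for some }t\ge0)=0$. $\sigma_B:=\inf\{t>0:X_t\in B\}$, $\inf\emptyset=\infty$. $\mathscr N:=\{N\in\mathscr B^n(E):\mathbb P^y[\sigma_N<\infty]=0\ \forall y\in E\}$ (polar sets); $d(x,B):=\inf\{d(x,y):y\in B\}$ (with $d(x,\emptyset)=\infty$); $\widetilde d(x,B):=\sup_{N\in\mathscr N}d(x,B\setminus N)\in[0,\infty]$. Convention $\log0=-\infty$. *)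

theory Defs
  imports "HOL-Probability.Probability"
begin

section \<open>State space and reference measure\<close>

text \<open>Every compact metrizable space embeds into the Hilbert cube, so homeomorphic to a Borel
  subset of a compact metric space means homeomorphic to a Borel subset of the Hilbert cube.\<close>

definition lusin :: "'e::topological_space set \<Rightarrow> bool" where
  "lusin S \<longleftrightarrow> (\<exists>B :: (nat \<Rightarrow> real) set.
     B \<in> sets borel \<and> B \<subseteq> {f. \<forall>n. f n \<in> {0..1}} \<and> S homeomorphic B)"

definition full_support :: "'e::topological_space measure \<Rightarrow> bool" where
  "full_support \<mu> \<longleftrightarrow> (\<forall>U. open U \<longrightarrow> U \<noteq> {} \<longrightarrow> 0 < emeasure \<mu> U)"

definition radon_measure :: "'e::topological_space measure \<Rightarrow> bool" where
  "radon_measure \<mu> \<longleftrightarrow> sets \<mu> = sets borel \<and>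
     (\<forall>K. compact K \<longrightarrow> emeasure \<mu> K < \<infinity>) \<and>
     (\<forall>B\<in>sets borel. emeasure \<mu> B = (SUP K\<in>{K. compact K \<and> K \<subseteq> B}. emeasure \<mu> K))"

definition prob_on :: "'e::topological_space measure \<Rightarrow> bool" where
  "prob_on \<nu> \<longleftrightarrow> prob_space \<nu> \<and> sets \<nu> = sets borel"

text \<open>The universally measurable sets.\<close>

definition universal_borel :: "'e::topological_space measure" where
  "universal_borel = sigma UNIV (\<Inter>\<nu>\<in>Collect prob_on. sets (completion \<nu>))"

section \<open>Right processes\<close>

text \<open>The cemetery is \<^term>\<open>None\<close>. Time runs through \<open>[0, \<infinity>]\<close>; at time \<open>\<infinity>\<close> the path sits in the
  cemetery. Only the measurable structure of \<open>events\<close> and \<open>filt t\<close> is used.\<close>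

record ('w, 'e) process =
  events :: "'w measure"
  filt :: "ennreal \<Rightarrow> 'w measure"
  traj :: "ennreal \<Rightarrow> 'w \<Rightarrow> 'e option"
  time_shift :: "ennreal \<Rightarrow> 'w \<Rightarrow> 'w"
  law :: "'e \<Rightarrow> 'w measure"

definition cemetery_borel :: "'e::topological_space option measure" where
  "cemetery_borel = sigma UNIV (insert {None} ((\<lambda>B. Some ` B) ` sets borel))"

text \<open>The law \<open>\<integral> P\<^sup>x \<nu>(dx)\<close>. The completion is needed because \<open>x \<mapsto> P\<^sup>x(A)\<close> is only required to be
  universally measurable for a general event \<open>A\<close>.\<close>

definition law_init :: "('w, 'e::topological_space) process \<Rightarrow> 'e measure \<Rightarrow> 'w measure" where
  "law_init X \<nu> = completion \<nu> \<bind> law X"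

text \<open>\<open>P\<^sub>t(x, B) = P\<^sup>x(X\<^sub>t \<in> B)\<close> for Borel \<open>B \<subseteq> E\<close>, a subprobability on \<open>E\<close>.\<close>

definition transition :: "('w, 'e::topological_space) process \<Rightarrow> ennreal \<Rightarrow> 'e \<Rightarrow> 'e measure" where
  "transition X t x =
     distr (restrict_space (law X x) {\<omega>. traj X t \<omega> \<noteq> None}) borel (\<lambda>\<omega>. the (traj X t \<omega>))"

definition strong_markov :: "('w, 'e::topological_space) process \<Rightarrow> bool" where
  "strong_markov X \<longleftrightarrow> (\<forall>\<nu> T. prob_on \<nu> \<longrightarrow> stopping_time (filt X) T \<longrightarrow>
     (\<forall>s. \<forall>A\<in>sets (filtration.pre_sigma (space (events X)) (filt X) T). \<forall>B\<in>sets borel.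
        emeasure (law_init X \<nu>) {\<omega>\<in>A. traj X (T \<omega> + s) \<omega> \<in> Some ` B} =
        (\<integral>\<^sup>+\<omega>\<in>A. (case traj X (T \<omega>) \<omega> of None \<Rightarrow> 0 | Some y \<Rightarrow> emeasure (transition X s y) B)
           \<partial>law_init X \<nu>)))"

text \<open>Convergence to a point of \<open>E\<close> is the same in the one-point compactification as when the
  cemetery is an isolated point, and a path that has reached the cemetery stays there; hence right
  continuity does not depend on which of these two topologies is put on \<open>E \<union> {\<partial>}\<close>.\<close>

definition borel_right_process :: "('w, 'e::topological_space) process \<Rightarrow> bool" where
  "borel_right_process X \<longleftrightarrow>
     filtration (space (events X)) (filt X) \<and>
     (\<forall>t. sets (filt X t) \<subseteq> sets (events X)) \<and>
     (\<forall>t<\<infinity>. sets (filt X t) = (\<Inter>s\<in>{t<..}. sets (filt X s))) \<and>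
     (\<forall>t. traj X t \<in> filt X t \<rightarrow>\<^sub>M cemetery_borel) \<and>
     law X \<in> universal_borel \<rightarrow>\<^sub>M prob_algebra (events X) \<and>
     (\<forall>t. \<forall>B\<in>sets borel. (\<lambda>x. emeasure (transition X t x) B) \<in> borel_measurable borel) \<and>
     (\<forall>x. AE \<omega> in law X x. traj X 0 \<omega> = Some x) \<and>
     (\<forall>\<omega>\<in>space (events X).
        traj X \<infinity> \<omega> = None \<and>
        (\<forall>s t. s \<le> t \<longrightarrow> traj X s \<omega> = None \<longrightarrow> traj X t \<omega> = None) \<and>
        (\<forall>t<\<infinity>. limitin (Alexandroff_compactification euclidean)
                   (\<lambda>s. traj X s \<omega>) (traj X t \<omega>) (at_right t)) \<and>
        (\<forall>s<\<infinity>. time_shift X s \<omega> \<in> space (events X) \<and>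
                (\<forall>t. traj X t (time_shift X s \<omega>) = traj X (t + s) \<omega>))) \<and>
     strong_markov X"

definition hunt_process :: "('w, 'e::topological_space) process \<Rightarrow> bool" where
  "hunt_process X \<longleftrightarrow> borel_right_process X \<and>
     (\<forall>\<omega>\<in>space (events X). \<forall>t. 0 < t \<longrightarrow> t < \<infinity> \<longrightarrow>
        (\<exists>y. limitin (Alexandroff_compactification euclidean) (\<lambda>s. traj X s \<omega>) y (at_left t))) \<and>
     (\<forall>\<nu> T. prob_on \<nu> \<longrightarrow> (\<forall>n. stopping_time (filt X) (T n)) \<longrightarrow>
        (\<forall>\<omega>\<in>space (events X). incseq (\<lambda>n::nat. T n \<omega>)) \<longrightarrow>
        (AE \<omega> in law_init X \<nu>. (SUP n. T n \<omega>) < \<infinity> \<longrightarrow>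
           limitin (Alexandroff_compactification euclidean)
             (\<lambda>n. traj X (T n \<omega>) \<omega>) (traj X (SUP n. T n \<omega>) \<omega>) sequentially))"

definition abs_cont_transition :: "'e::topological_space measure \<Rightarrow> ('w, 'e) process \<Rightarrow> bool" where
  "abs_cont_transition \<mu> X \<longleftrightarrow>
     (\<forall>t>0. \<forall>x. absolutely_continuous \<mu> (transition X (ennreal t) x))"

definition transition_density ::
  "'e::topological_space measure \<Rightarrow> ('w, 'e) process \<Rightarrow> (real \<Rightarrow> 'e \<Rightarrow> 'e \<Rightarrow> real) \<Rightarrow> bool" where
  "transition_density \<mu> X p \<longleftrightarrow>
     (\<lambda>(t, x, y). p t x y)
       \<in> borel_measurable (restrict_space borel {0<..} \<Otimes>\<^sub>M borel \<Otimes>\<^sub>M borel) \<and>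
     (\<forall>t>0. \<forall>x y. 0 \<le> p t x y) \<and>
     (\<forall>t>0. \<forall>x. transition X (ennreal t) x = density \<mu> (\<lambda>y. ennreal (p t x y)))"

definition resolvent_density ::
  "(real \<Rightarrow> 'e \<Rightarrow> 'e \<Rightarrow> real) \<Rightarrow> real \<Rightarrow> 'e \<Rightarrow> 'e \<Rightarrow> ennreal" where
  "resolvent_density p l x y = (\<integral>\<^sup>+t\<in>{0<..}. ennreal (exp (- l * t) * p t x y) \<partial>lborel)"

definition transient ::
  "'e::topological_space measure \<Rightarrow> (real \<Rightarrow> 'e \<Rightarrow> 'e \<Rightarrow> real) \<Rightarrow> bool" where
  "transient \<mu> p \<longleftrightarrow> (\<exists>h :: 'e \<Rightarrow> real. h \<in> borel_measurable universal_borel \<and> (\<forall>x. 0 < h x) \<and>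
     (\<forall>x. (\<integral>\<^sup>+y. resolvent_density p 0 x y * ennreal (h y) \<partial>completion \<mu>) < \<infinity>))"

section \<open>Hitting times\<close>

definition hitting_time :: "('w, 'e) process \<Rightarrow> 'e set \<Rightarrow> 'w \<Rightarrow> ennreal" where
  "hitting_time X B \<omega> = Inf {t. 0 < t \<and> traj X t \<omega> \<in> Some ` B}"

text \<open>An \<open>AE\<close> statement asserts that the exceptional set is contained in a null set, so no
  measurability of that set has to be presupposed.\<close>

definition nearly_borel :: "('w, 'e::topological_space) process \<Rightarrow> 'e set set" where
  "nearly_borel X = {B. \<forall>\<nu>. prob_on \<nu> \<longrightarrow> (\<exists>B1\<in>sets borel. \<exists>B2\<in>sets borel. B1 \<subseteq> B \<and> B \<subseteq> B2 \<and>
     (AE \<omega> in law_init X \<nu>. \<not> (\<exists>t. traj X t \<omega> \<in> Some ` (B2 - B1))))}"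

definition polar_sets :: "('w, 'e::topological_space) process \<Rightarrow> 'e set set" where
  "polar_sets X = {N \<in> nearly_borel X. \<forall>y. AE \<omega> in law X y. \<not> hitting_time X N \<omega> < \<infinity>}"

text \<open>\<open>P\<^sup>x[\<sigma>\<^sub>B \<le> t]\<close>; for nearly Borel \<open>B\<close> the event belongs to the \<open>P\<^sup>x\<close>-completion only.\<close>

definition hitting_prob :: "('w, 'e) process \<Rightarrow> 'e set \<Rightarrow> 'e \<Rightarrow> ennreal \<Rightarrow> real" where
  "hitting_prob X B x t =
     measure (completion (law X x)) {\<omega>\<in>space (events X). hitting_time X B \<omega> \<le> t}"

definition dist_set :: "'e::metric_space \<Rightarrow> 'e set \<Rightarrow> ennreal" where
  "dist_set x B = (INF y\<in>B. ennreal (dist x y))"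

definition dist_mod_polar :: "('w, 'e::metric_space) process \<Rightarrow> 'e \<Rightarrow> 'e set \<Rightarrow> ennreal" where
  "dist_mod_polar X x B = (SUP N\<in>polar_sets X. dist_set x (B - N))"

definition elog :: "real \<Rightarrow> ereal" where
  "elog a = (if a = 0 then - \<infinity> else ereal (ln a))"

text \<open>\<open>a\<^sup>\<gamma>\<close> for \<open>a \<in> [0, \<infinity>]\<close> and \<open>\<gamma> > 0\<close>.\<close>

definition epowr :: "ennreal \<Rightarrow> real \<Rightarrow> ereal" where
  "epowr a \<gamma> = (if a = \<infinity> then \<infinity> else ereal (enn2real a powr \<gamma>))"

section \<open>Forms on \<open>L\<^sup>2\<close>\<close>

text \<open>Elements of \<open>L\<^sup>2\<close> are represented by functions; all notions below are invariant under
  modification on null sets.\<close>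

definition L2 :: "'e measure \<Rightarrow> ('e \<Rightarrow> real) set" where
  "L2 \<mu> = {f \<in> borel_measurable \<mu>. integrable \<mu> (\<lambda>x. (f x)\<^sup>2)}"

definition L2_inner :: "'e measure \<Rightarrow> ('e \<Rightarrow> real) \<Rightarrow> ('e \<Rightarrow> real) \<Rightarrow> real" where
  "L2_inner \<mu> f g = (\<integral>x. f x * g x \<partial>\<mu>)"

definition L2_norm :: "'e measure \<Rightarrow> ('e \<Rightarrow> real) \<Rightarrow> real" where
  "L2_norm \<mu> f = sqrt (L2_inner \<mu> f f)"

definition Cc :: "('e::topological_space \<Rightarrow> real) set" where
  "Cc = {f. continuous_on UNIV f \<and> compact (closure {x. f x \<noteq> 0})}"

definition form1 ::
  "'e measure \<Rightarrow> (('e \<Rightarrow> real) \<Rightarrow> ('e \<Rightarrow> real) \<Rightarrow> real) \<Rightarrow> ('e \<Rightarrow> real) \<Rightarrow> ('e \<Rightarrow> real) \<Rightarrow> real" where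
  "form1 \<mu> \<E> f g = \<E> f g + L2_inner \<mu> f g"

definition regular_form ::
  "'e::topological_space measure \<Rightarrow> (('e \<Rightarrow> real) \<Rightarrow> ('e \<Rightarrow> real) \<Rightarrow> real) \<Rightarrow> ('e \<Rightarrow> real) set \<Rightarrow> bool"
where
  "regular_form \<mu> \<E> F \<longleftrightarrow> locally compact (UNIV :: 'e set) \<and> radon_measure \<mu> \<and>
     (\<forall>f\<in>F. \<forall>e>0. \<exists>g\<in>F \<inter> Cc. sqrt (form1 \<mu> \<E> (\<lambda>x. f x - g x) (\<lambda>x. f x - g x)) < e) \<and>
     (\<forall>f\<in>Cc. \<forall>e>0. \<exists>g\<in>F \<inter> Cc. \<forall>x. \<bar>f x - g x\<bar> < e)"

definition semigroup_op ::
  "('w, 'e::topological_space) process \<Rightarrow> real \<Rightarrow> ('e \<Rightarrow> real) \<Rightarrow> 'e \<Rightarrow> real" where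
  "semigroup_op X t f x = (\<integral>y. f y \<partial>transition X (ennreal t) x)"

definition dirichlet_quotient ::
  "'e::topological_space measure \<Rightarrow> ('w, 'e) process \<Rightarrow> ('e \<Rightarrow> real) \<Rightarrow> ('e \<Rightarrow> real) \<Rightarrow> real \<Rightarrow> real"
where
  "dirichlet_quotient \<mu> X f g t = 1 / t * L2_inner \<mu> (\<lambda>x. f x - semigroup_op X t f x) g"

text \<open>For \<open>f = g\<close> the quotient is monotone in \<open>t\<close>, so its limit exists in \<open>[0, \<infinity>]\<close> and finiteness
  means convergence in the reals.\<close>

definition dirichlet_domain ::
  "'e::topological_space measure \<Rightarrow> ('w, 'e) process \<Rightarrow> ('e \<Rightarrow> real) set" where
  "dirichlet_domain \<mu> X = {f \<in> L2 \<mu>. \<exists>l. (dirichlet_quotient \<mu> X f f \<longlongrightarrow> l) (at_right 0)}"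

definition dirichlet_form ::
  "'e::topological_space measure \<Rightarrow> ('w, 'e) process \<Rightarrow> ('e \<Rightarrow> real) \<Rightarrow> ('e \<Rightarrow> real) \<Rightarrow> real" where
  "dirichlet_form \<mu> X f g = Lim (at_right 0) (dirichlet_quotient \<mu> X f g)"

definition L2_contraction :: "'e measure \<Rightarrow> (('e \<Rightarrow> real) \<Rightarrow> 'e \<Rightarrow> real) \<Rightarrow> bool" where
  "L2_contraction \<mu> S \<longleftrightarrow>
     (\<forall>f\<in>L2 \<mu>. S f \<in> L2 \<mu> \<and> L2_norm \<mu> (S f) \<le> L2_norm \<mu> f) \<and>
     (\<forall>f\<in>L2 \<mu>. \<forall>g\<in>L2 \<mu>. (AE x in \<mu>. f x = g x) \<longrightarrow> (AE x in \<mu>. S f x = S g x)) \<and>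
     (\<forall>f\<in>L2 \<mu>. \<forall>g\<in>L2 \<mu>. \<forall>a b. AE x in \<mu>. S (\<lambda>y. a * f y + b * g y) x = a * S f x + b * S g x)"

definition contraction_extension ::
  "'e::topological_space measure \<Rightarrow> ('w, 'e) process \<Rightarrow> real \<Rightarrow> (('e \<Rightarrow> real) \<Rightarrow> 'e \<Rightarrow> real) \<Rightarrow> bool"
where
  "contraction_extension \<mu> X t S \<longleftrightarrow> L2_contraction \<mu> S \<and>
     (\<forall>f\<in>L2 \<mu>. f \<in> borel_measurable borel \<longrightarrow> bounded (range f) \<longrightarrow>
        (AE x in \<mu>. S f x = semigroup_op X t f x))"

definition unique_contraction_extension ::
  "'e::topological_space measure \<Rightarrow> ('w, 'e) process \<Rightarrow> real \<Rightarrow> (('e \<Rightarrow> real) \<Rightarrow> 'e \<Rightarrow> real) \<Rightarrow> bool"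
where
  "unique_contraction_extension \<mu> X t S \<longleftrightarrow> contraction_extension \<mu> X t S \<and>
     (\<forall>S'. contraction_extension \<mu> X t S' \<longrightarrow> (\<forall>f\<in>L2 \<mu>. AE x in \<mu>. S' f x = S f x))"

definition is_generator ::
  "'e measure \<Rightarrow> (real \<Rightarrow> ('e \<Rightarrow> real) \<Rightarrow> 'e \<Rightarrow> real) \<Rightarrow> ('e \<Rightarrow> real) \<Rightarrow> ('e \<Rightarrow> real) \<Rightarrow> bool" where
  "is_generator \<mu> S f h \<longleftrightarrow> f \<in> L2 \<mu> \<and> h \<in> L2 \<mu> \<and>
     ((\<lambda>t. L2_norm \<mu> (\<lambda>x. (S t f x - f x) / t - h x)) \<longlongrightarrow> 0) (at_right 0)"

definition generator_domain ::
  "'e measure \<Rightarrow> (real \<Rightarrow> ('e \<Rightarrow> real) \<Rightarrow> 'e \<Rightarrow> real) \<Rightarrow> ('e \<Rightarrow> real) set" where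
  "generator_domain \<mu> S = {f. \<exists>h. is_generator \<mu> S f h}"

definition generator ::
  "'e measure \<Rightarrow> (real \<Rightarrow> ('e \<Rightarrow> real) \<Rightarrow> 'e \<Rightarrow> real) \<Rightarrow> ('e \<Rightarrow> real) \<Rightarrow> 'e \<Rightarrow> real" where
  "generator \<mu> S f = (SOME h. is_generator \<mu> S f h)"

definition generator_form ::
  "'e measure \<Rightarrow> (real \<Rightarrow> ('e \<Rightarrow> real) \<Rightarrow> 'e \<Rightarrow> real) \<Rightarrow> ('e \<Rightarrow> real) \<Rightarrow> ('e \<Rightarrow> real) \<Rightarrow> real" where
  "generator_form \<mu> S f g = L2_inner \<mu> f (\<lambda>x. - generator \<mu> S g x)"

definition sector_condition ::
  "'e measure \<Rightarrow> (real \<Rightarrow> ('e \<Rightarrow> real) \<Rightarrow> 'e \<Rightarrow> real) \<Rightarrow> bool" where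
  "sector_condition \<mu> S \<longleftrightarrow> (\<exists>K>0. \<forall>f\<in>generator_domain \<mu> S. \<forall>g\<in>generator_domain \<mu> S.
     \<bar>form1 \<mu> (generator_form \<mu> S) f g\<bar>
       \<le> K * sqrt (form1 \<mu> (generator_form \<mu> S) f f) * sqrt (form1 \<mu> (generator_form \<mu> S) g g))"

text \<open>The completion of the generator domain in the norm \<open>sqrt (form1 f f)\<close> is realized inside \<open>L\<^sup>2\<close>: under
  the sector condition the form is closable, so a sequence that is Cauchy in this norm is determined by its
  \<open>L\<^sup>2\<close>-limit, and the form extends by continuity.\<close>

definition form_approx ::
  "'e measure \<Rightarrow> (real \<Rightarrow> ('e \<Rightarrow> real) \<Rightarrow> 'e \<Rightarrow> real) \<Rightarrow> (nat \<Rightarrow> 'e \<Rightarrow> real) \<Rightarrow> ('e \<Rightarrow> real) \<Rightarrow> bool"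
where
  "form_approx \<mu> S h f \<longleftrightarrow> (\<forall>n. h n \<in> generator_domain \<mu> S) \<and> f \<in> L2 \<mu> \<and>
     (\<forall>e>0. \<exists>N. \<forall>m\<ge>N. \<forall>n\<ge>N. sqrt (form1 \<mu> (generator_form \<mu> S)
        (\<lambda>x. h m x - h n x) (\<lambda>x. h m x - h n x)) < e) \<and>
     (\<lambda>n. L2_norm \<mu> (\<lambda>x. h n x - f x)) \<longlonglongrightarrow> 0"

definition semi_dirichlet_domain ::
  "'e measure \<Rightarrow> (real \<Rightarrow> ('e \<Rightarrow> real) \<Rightarrow> 'e \<Rightarrow> real) \<Rightarrow> ('e \<Rightarrow> real) set" where
  "semi_dirichlet_domain \<mu> S = {f. \<exists>h. form_approx \<mu> S h f}"

definition semi_dirichlet_form ::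
  "'e measure \<Rightarrow> (real \<Rightarrow> ('e \<Rightarrow> real) \<Rightarrow> 'e \<Rightarrow> real) \<Rightarrow> ('e \<Rightarrow> real) \<Rightarrow> ('e \<Rightarrow> real) \<Rightarrow> real" where
  "semi_dirichlet_form \<mu> S f g = (THE l. \<forall>h k. form_approx \<mu> S h f \<longrightarrow> form_approx \<mu> S k g \<longrightarrow>
     (\<lambda>n. generator_form \<mu> S (h n) (k n)) \<longlonglongrightarrow> l)"

section \<open>The three sets of assumptions\<close>

text \<open>For a general bounded \<open>f\<close> the two sides need not exist when \<open>\<mu>\<close> is infinite; the identity is
  required for nonnegative bounded Borel functions, with values in \<open>[0, \<infinity>]\<close>. By linearity it then
  holds for signed functions as soon as the integrals converge absolutely.\<close>

definition in_duality ::
  "'e::topological_space measure \<Rightarrow> ('w, 'e) process \<Rightarrow> ('v, 'e) process \<Rightarrow> bool" where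
  "in_duality \<mu> X Y \<longleftrightarrow> (\<forall>t>0. \<forall>f g :: 'e \<Rightarrow> real.
     f \<in> borel_measurable borel \<longrightarrow> g \<in> borel_measurable borel \<longrightarrow>
     (\<forall>x. 0 \<le> f x) \<longrightarrow> (\<forall>x. 0 \<le> g x) \<longrightarrow> bounded (range f) \<longrightarrow> bounded (range g) \<longrightarrow>
     (\<integral>\<^sup>+x. (\<integral>\<^sup>+y. ennreal (f y) \<partial>transition X (ennreal t) x) * ennreal (g x) \<partial>\<mu>) =
     (\<integral>\<^sup>+x. ennreal (f x) * (\<integral>\<^sup>+y. ennreal (g y) \<partial>transition Y (ennreal t) x) \<partial>\<mu>))"

text \<open>The transition density is the one chosen to be symmetric in its space variables.\<close>

definition symmetry_assumption ::
  "'e::metric_space measure \<Rightarrow> ('w, 'e) process \<Rightarrow> (real \<Rightarrow> 'e \<Rightarrow> 'e \<Rightarrow> real) \<Rightarrow> bool" where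
  "symmetry_assumption \<mu> X p \<longleftrightarrow> in_duality \<mu> X X \<and> (\<forall>t>0. \<forall>x y. p t x y = p t y x) \<and>
     locally compact (UNIV :: 'e set) \<and> radon_measure \<mu> \<and> full_support \<mu> \<and> hunt_process X \<and>
     regular_form \<mu> (dirichlet_form \<mu> X) (dirichlet_domain \<mu> X)"

text \<open>The density of the dual process is \<open>p(t,y,x)\<close>, so the function required to be continuous is
  the potential of \<open>f\<close> under the dual process; being a continuous function, it is finite.\<close>

definition duality_assumption ::
  "'e::metric_space measure \<Rightarrow> ('w, 'e) process \<Rightarrow> ('v, 'e) process
     \<Rightarrow> (real \<Rightarrow> 'e \<Rightarrow> 'e \<Rightarrow> real) \<Rightarrow> bool" where
  "duality_assumption \<mu> X Y p \<longleftrightarrow>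
     borel_right_process Y \<and> abs_cont_transition \<mu> Y \<and> in_duality \<mu> X Y \<and>
     transition_density \<mu> Y (\<lambda>t x y. p t y x) \<and>
     locally compact (UNIV :: 'e set) \<and> radon_measure \<mu> \<and>
     (\<forall>l. (0 < l \<or> (l = 0 \<and> transient \<mu> p)) \<longrightarrow> (\<forall>f\<in>Cc.
        (\<forall>y. (\<integral>\<^sup>+x. resolvent_density p l x y * ennreal \<bar>f x\<bar> \<partial>\<mu>) < \<infinity>) \<and>
        continuous_on UNIV (\<lambda>y. \<integral>x. enn2real (resolvent_density p l x y) * f x \<partial>\<mu>)))"

definition sector_assumption ::
  "'e::metric_space measure \<Rightarrow> ('w, 'e) process \<Rightarrow> bool" where
  "sector_assumption \<mu> X \<longleftrightarrow> (\<exists>S. (\<forall>t\<ge>0. unique_contraction_extension \<mu> X t (S t)) \<and>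
     sector_condition \<mu> S \<and>
     regular_form \<mu> (semi_dirichlet_form \<mu> S) (semi_dirichlet_domain \<mu> S))"

end

theory Submission
  imports Defs "HOL-Real_Asymp.Real_Asymp"
begin

text \<open>
  Upper bound on the hitting probability: outside a polar set, reaching \<open>B\<close> before time \<open>t\<close> forces the path to
  leave a ball around \<open>x\<close>. Chapman-Kolmogorov and the two-sided bounds give \<open>P\<^sub>s(y, E) \<ge> \<kappa> > 0\<close> uniformly for
  small \<open>s\<close>, so a path that has left the ball is still outside a slightly smaller one at time \<open>t\<close> with
  probability bounded below, and the exit probability is controlled by the tail of \<open>p t\<close>. That tail in turn is
  estimated by comparing \<open>p t\<close> with \<open>p t'\<close> for a larger time \<open>t'\<close>.

  Lower bound: the part \<open>A\<close> of \<open>B\<close> in a ball of radius slightly larger than the distance modulo polar sets is not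
  polar. With \<open>D\<^sub>s\<close> the first hitting time of \<open>A\<close> after \<open>s\<close> and \<open>V s y = E\<^sup>y[exp (- D\<^sub>s)]\<close>, one has
  \<open>P\<^sup>x(A is hit in (s, t]) \<ge> V s x - V t x\<close>, and the right-hand side is a telescoping sum over a time grid of mesh
  \<open>h\<close> of integrals of \<open>G h z = E\<^sup>z[exp (- D\<^sub>0) - exp (- D\<^sub>h)]\<close> against \<open>p\<close>. It remains to bound the \<open>G h\<close>-mass
  of a ball around \<open>A\<close> below by a multiple of \<open>h\<close>. If this failed along some sequence of meshes, the upper bound on \<open>p\<close>
  would make \<open>V\<close> constant in time, hence zero, and \<open>A\<close> would be polar.

  Hitting events of Borel sets are measurable only after completion; this rests on the measurable projection
  theorem, a consequence of Choquet's capacitability argument.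
\<close>

section \<open>Measurable projection\<close>

text \<open>A set may be null for \<mu> and still be hit, so the lower bound on \<open>p\<close>
  cannot simply be integrated over \<open>B\<close>; the measure with density \<open>G h\<close>
  plays the role of an equilibrium measure of \<open>A\<close> at scale \<open>h\<close>. Its mass
  near \<open>A\<close> is only known to be of order \<open>h\<close> at least, but a window of
  length \<eta> t has \<eta> t / h grid steps, so the mesh cancels and any small \<open>h\<close>
  will do. Windows ((1 - \<eta>) t, t] keep all kernel times comparable with \<open>t\<close>. In
  both directions the losses are of two kinds: factors in the exponent that are close to 1 for small
  \<eta>, and powers of \<open>t\<close> in front, which \<open>t powr \<delta>\<close> suppresses
  after taking logarithms. Nothing else survives because both bounds on \<open>p\<close> carry the
  same \<open>C2\<close>. The other obstacle is measurability: laws are only universally measurable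
  in the starting point. Path functionals are replaced by versions on the sigma-algebra of the
  coordinates, and absolute continuity turns a statement for almost every starting point into one
  for every starting point after a positive time.\<close>

inductive_set paving :: "'a measure \<Rightarrow> (real \<times> 'a) set set" for M :: "'a measure" where
  rect: "compact K \<Longrightarrow> F \<in> sets M \<Longrightarrow> K \<times> F \<in> paving M"
| union: "R \<in> paving M \<Longrightarrow> R' \<in> paving M \<Longrightarrow> R \<union> R' \<in> paving M"

lemma paving_empty: "{} \<in> paving M"
  using paving.rect[of "{}" "{}" M] by simp

lemma paving_Int: "R \<in> paving M \<Longrightarrow> R' \<in> paving M \<Longrightarrow> R \<inter> R' \<in> paving M"
proof (induction R rule: paving.induct)
  case (rect K F)
  from rect(3) show ?case
  proof (induction R' rule: paving.induct)
    case (rect K' F')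
    have "K \<times> F \<inter> K' \<times> F' = (K \<inter> K') \<times> (F \<inter> F')" by auto
    with rect \<open>compact K\<close> \<open>F \<in> sets M\<close> show ?case
      by (auto intro!: paving.rect compact_Int)
  qed (auto simp: Int_Un_distrib intro: paving.union)
qed (auto simp: Int_Un_distrib2 intro: paving.union)

lemma paving_Union: "finite \<R> \<Longrightarrow> \<R> \<subseteq> paving M \<Longrightarrow> \<Union>\<R> \<in> paving M"
  by (induction \<R> rule: finite_induct) (auto intro: paving_empty paving.union)

lemma paving_Inter_atMost: "(\<And>n. Q n \<in> paving M) \<Longrightarrow> (\<Inter>n\<le>k::nat. Q n) \<in> paving M"
  by (induction k) (auto simp: atMost_Suc intro: paving_Int)

lemma paving_section_compact: "R \<in> paving M \<Longrightarrow> compact {s. (s, \<omega>) \<in> R}"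
proof (induction R rule: paving.induct)
  case (rect K F)
  then show ?case by (cases "\<omega> \<in> F") auto
next
  case (union R R')
  then show ?case by (auto dest: compact_Un simp: Collect_disj_eq)
qed

lemma paving_proj: "R \<in> paving M \<Longrightarrow> snd ` R \<in> sets M"
  by (induction R rule: paving.induct) (auto simp: image_Un)

text \<open>Cantor's intersection theorem applied to the time sections, which are compact for
  members of the paving. This continuity from above is what the capacitability argument asks of the
  projection.\<close>

lemma paving_proj_Inter:
  assumes R: "\<And>k. R k \<in> paving M" and dec: "decseq R"
  shows "snd ` (\<Inter>k. R k) = (\<Inter>k. snd ` R k)"
proof (intro antisym subsetI)
  fix \<omega> assume *: "\<omega> \<in> (\<Inter>k. snd ` R k)"
  have "\<Inter>(range (\<lambda>k. {s. (s, \<omega>) \<in> R k})) \<noteq> {}"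
  proof (rule compact_nest)
    show "{s. (s, \<omega>) \<in> R k} \<noteq> {}" for k
      using * by force
    show "m \<le> n \<Longrightarrow> {s. (s, \<omega>) \<in> R n} \<subseteq> {s. (s, \<omega>) \<in> R m}" for m n
      using decseqD[OF dec, of m n] by auto
  qed (rule paving_section_compact[OF R])
  then show "\<omega> \<in> snd ` (\<Inter>k. R k)" by force
qed auto

text \<open>The generality of local constancy (instead of dependence of \<open>Q n\<close> on the first \<open>n\<close> values only) makes
  the closure of Souslin sets under countable unions and intersections a matter of recoding indices.\<close>

definition scheme :: "'a measure \<Rightarrow> (nat \<Rightarrow> (nat \<Rightarrow> nat) \<Rightarrow> (real \<times> 'a) set) \<Rightarrow> bool" where
  "scheme M Q \<longleftrightarrow> (\<forall>n \<sigma>. Q n \<sigma> \<in> paving M \<and> (\<exists>m. \<forall>\<tau>. (\<forall>i<m. \<tau> i = \<sigma> i) \<longrightarrow> Q n \<tau> = Q n \<sigma>))"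

definition souslin :: "'a measure \<Rightarrow> (real \<times> 'a) set \<Rightarrow> bool" where
  "souslin M S \<longleftrightarrow> (\<exists>Q. scheme M Q \<and> S = {z. \<exists>\<sigma>. \<forall>n. z \<in> Q n \<sigma>})"

lemma souslin_paving: "R \<in> paving M \<Longrightarrow> souslin M R"
  unfolding souslin_def scheme_def by (rule exI[of _ "\<lambda>_ _. R"]) auto

text \<open>The first entry of the sequence selects the member of the family, the remaining entries
  drive the scheme of that member.\<close>

lemma souslin_UN:
  assumes "\<And>i::nat. souslin M (S i)"
  shows "souslin M (\<Union>i. S i)"
proof -
  from assms obtain Q where Q: "\<And>i. scheme M (Q i)" "\<And>i. S i = {z. \<exists>\<sigma>. \<forall>n. z \<in> Q i n \<sigma>}"
    unfolding souslin_def by metis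
  define Q' where "Q' n \<sigma> = Q (\<sigma> 0) n (\<lambda>j. \<sigma> (Suc j))" for n \<sigma>
  have "\<exists>m. \<forall>\<tau>. (\<forall>i<m. \<tau> i = \<sigma> i) \<longrightarrow> Q' n \<tau> = Q' n \<sigma>" for n \<sigma>
  proof -
    obtain m where m: "\<And>\<tau>. (\<forall>i<m. \<tau> i = \<sigma> (Suc i)) \<Longrightarrow> Q (\<sigma> 0) n \<tau> = Q (\<sigma> 0) n (\<lambda>j. \<sigma> (Suc j))"
      using Q(1) unfolding scheme_def by metis
    show ?thesis
    proof (intro exI[of _ "Suc m"] allI impI)
      fix \<tau> :: "nat \<Rightarrow> nat" assume "\<forall>i<Suc m. \<tau> i = \<sigma> i"
      then have "\<tau> 0 = \<sigma> 0" "Q (\<sigma> 0) n (\<lambda>j. \<tau> (Suc j)) = Q (\<sigma> 0) n (\<lambda>j. \<sigma> (Suc j))"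
        by (auto intro!: m)
      then show "Q' n \<tau> = Q' n \<sigma>" by (simp add: Q'_def)
    qed
  qed
  then have "scheme M Q'"
    using Q(1) unfolding scheme_def Q'_def by blast
  moreover have "(\<Union>i. S i) = {z. \<exists>\<sigma>. \<forall>n. z \<in> Q' n \<sigma>}"
  proof (intro set_eqI iffI)
    fix z assume "z \<in> (\<Union>i. S i)"
    then obtain i \<sigma> where "\<forall>n. z \<in> Q i n \<sigma>" using Q(2) by auto
    then have "\<forall>n. z \<in> Q' n (case_nat i \<sigma>)" by (simp add: Q'_def)
    then show "z \<in> {z. \<exists>\<sigma>. \<forall>n. z \<in> Q' n \<sigma>}" by blast
  qed (auto simp: Q'_def Q(2))
  ultimately show ?thesis unfolding souslin_def by blast
qed

text \<open>One sequence codes a sequence for each member by the pairing function: column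
  \<open>i\<close> drives the \<open>i\<close>-th scheme. Local constancy survives because finitely
  many entries of a column sit at finitely many places of the coding sequence.\<close>

lemma souslin_INT:
  assumes "\<And>i::nat. souslin M (S i)"
  shows "souslin M (\<Inter>i. S i)"
proof -
  from assms obtain Q where Q: "\<And>i. scheme M (Q i)" "\<And>i. S i = {z. \<exists>\<sigma>. \<forall>n. z \<in> Q i n \<sigma>}"
    unfolding souslin_def by metis
  define c where "c i \<sigma> = (\<lambda>j. \<sigma> (prod_encode (i, j)))" for i and \<sigma> :: "nat \<Rightarrow> nat"
  define Q' where "Q' k \<sigma> = Q (fst (prod_decode k)) (snd (prod_decode k)) (c (fst (prod_decode k)) \<sigma>)" for k \<sigma>
  have "\<exists>m. \<forall>\<tau>. (\<forall>i<m. \<tau> i = \<sigma> i) \<longrightarrow> Q' k \<tau> = Q' k \<sigma>" for k \<sigma>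
  proof -
    obtain i n where k: "prod_decode k = (i, n)" by force
    obtain m where m: "\<And>\<tau>. (\<forall>j<m. \<tau> j = c i \<sigma> j) \<Longrightarrow> Q i n \<tau> = Q i n (c i \<sigma>)"
      using Q(1) unfolding scheme_def by metis
    obtain m' where m': "\<And>j. j < m \<Longrightarrow> prod_encode (i, j) < m'"
      using finite_nat_set_iff_bounded[of "(\<lambda>j. prod_encode (i, j)) ` {..<m}"] by auto
    show ?thesis
    proof (intro exI[of _ m'] allI impI)
      fix \<tau> :: "nat \<Rightarrow> nat" assume "\<forall>i<m'. \<tau> i = \<sigma> i"
      then have "Q i n (c i \<tau>) = Q i n (c i \<sigma>)"
        using m' by (intro m) (auto simp: c_def)
      then show "Q' k \<tau> = Q' k \<sigma>" by (simp add: Q'_def k)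
    qed
  qed
  then have "scheme M Q'"
    using Q(1) unfolding scheme_def Q'_def by blast
  moreover have "(\<Inter>i. S i) = {z. \<exists>\<sigma>. \<forall>n. z \<in> Q' n \<sigma>}"
  proof (intro set_eqI iffI)
    fix z assume "z \<in> (\<Inter>i. S i)"
    then have "\<forall>i. \<exists>\<sigma>. \<forall>n. z \<in> Q i n \<sigma>" using Q(2) by auto
    then obtain s where s: "\<And>i n. z \<in> Q i n (s i)" by metis
    define \<sigma> where "\<sigma> k = s (fst (prod_decode k)) (snd (prod_decode k))" for k
    have "c i \<sigma> = s i" for i by (auto simp: c_def \<sigma>_def)
    then have "\<forall>n. z \<in> Q' n \<sigma>" using s by (simp add: Q'_def)
    then show "z \<in> {z. \<exists>\<sigma>. \<forall>n. z \<in> Q' n \<sigma>}" by blast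
  next
    fix z assume "z \<in> {z. \<exists>\<sigma>. \<forall>n. z \<in> Q' n \<sigma>}"
    then obtain \<sigma> where s: "\<And>n. z \<in> Q' n \<sigma>" by auto
    have "z \<in> Q i n (c i \<sigma>)" for i n
      using s[of "prod_encode (i, n)"] by (simp add: Q'_def)
    then show "z \<in> (\<Inter>i. S i)" using Q(2) by auto
  qed
  ultimately show ?thesis unfolding souslin_def by blast
qed

lemma souslin_Un:
  assumes "souslin M S" "souslin M S'"
  shows "souslin M (S \<union> S')"
proof -
  have "S \<union> S' = (\<Union>i::nat. if i = 0 then S else S')"
    by (auto split: if_splits)
  moreover have "souslin M (\<Union>i::nat. if i = 0 then S else S')"
    using assms by (intro souslin_UN) auto
  ultimately show ?thesis by metis
qed

lemma souslin_Int:
  assumes "souslin M S" "souslin M S'"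
  shows "souslin M (S \<inter> S')"
proof -
  have "S \<inter> S' = (\<Inter>i::nat. if i = 0 then S else S')"
    by (auto split: if_splits)
  moreover have "souslin M (\<Inter>i::nat. if i = 0 then S else S')"
    using assms by (intro souslin_INT) auto
  ultimately show ?thesis by metis
qed

text \<open>Souslin sets need not be closed under complements. Asking this of a set together with
  its complement gives a sigma-algebra, so that only generators remain to be checked.\<close>

definition bisouslin :: "'a measure \<Rightarrow> (real \<times> 'a) set \<Rightarrow> bool" where
  "bisouslin M S \<longleftrightarrow> S \<subseteq> UNIV \<times> space M \<and> souslin M S \<and> souslin M (UNIV \<times> space M - S)"

lemma bisouslin_compl: "bisouslin M S \<Longrightarrow> bisouslin M (UNIV \<times> space M - S)"
  unfolding bisouslin_def by (auto simp: double_diff)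

lemma bisouslin_UN: "(\<And>i::nat. bisouslin M (S i)) \<Longrightarrow> bisouslin M (\<Union>i. S i)"
proof -
  assume *: "\<And>i::nat. bisouslin M (S i)"
  have "UNIV \<times> space M - (\<Union>i. S i) = (\<Inter>i. UNIV \<times> space M - S i)" by auto
  moreover have "souslin M (\<Union>i. S i)"
    using * by (intro souslin_UN) (simp add: bisouslin_def)
  moreover have "souslin M (\<Inter>i. UNIV \<times> space M - S i)"
    using * by (intro souslin_INT) (simp add: bisouslin_def)
  ultimately show ?thesis
    using * unfolding bisouslin_def by auto
qed

lemma bisouslin_Int: "bisouslin M S \<Longrightarrow> bisouslin M S' \<Longrightarrow> bisouslin M (S \<inter> S')"
  unfolding bisouslin_def by (auto simp: Diff_Int intro: souslin_Int souslin_Un)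

lemma souslin_UNIV_times: "F \<in> sets M \<Longrightarrow> souslin M (UNIV \<times> F)"
proof -
  assume F: "F \<in> sets M"
  have "UNIV \<times> F = (\<Union>n::nat. {- real n .. real n} \<times> F)"
  proof (intro set_eqI iffI)
    fix z :: "real \<times> 'a" assume "z \<in> UNIV \<times> F"
    moreover obtain n :: nat where "\<bar>fst z\<bar> \<le> real n" using real_arch_simple by blast
    ultimately show "z \<in> (\<Union>n::nat. {- real n .. real n} \<times> F)"
      by (cases z) (auto simp: abs_le_iff intro!: exI[of _ n])
  qed auto
  moreover have "souslin M (\<Union>n::nat. {- real n .. real n} \<times> F)"
    using F by (intro souslin_UN souslin_paving paving.rect) auto
  ultimately show ?thesis by simp
qed

lemma bisouslin_UNIV_times: "F \<in> sets M \<Longrightarrow> bisouslin M (UNIV \<times> F)"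
proof -
  assume F: "F \<in> sets M"
  have "UNIV \<times> space M - UNIV \<times> F = UNIV \<times> (space M - F)" for F by auto
  with F show ?thesis
    unfolding bisouslin_def using sets.sets_into_space[OF F] by (auto intro!: souslin_UNIV_times)
qed

text \<open>Half-lines generate the Borel sets of the reals, and both a closed half-line and its
  complement are countable unions of compact intervals.\<close>

lemma bisouslin_times_space: "b \<in> sets borel \<Longrightarrow> bisouslin M (b \<times> space M)"
proof -
  assume "b \<in> sets borel"
  then have "b \<in> sigma_sets UNIV (range (\<lambda>a::real. {..a}))"
    by (metis borel_eq_atMost sets_measure_of subset_UNIV Pow_UNIV)
  then show ?thesis
  proof induction
    case (Basic b)
    then obtain a where b: "b = {..a}" by auto
    have 1: "{..a} \<times> space M = (\<Union>n::nat. {a - real n .. a} \<times> space M)"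
    proof (intro set_eqI iffI)
      fix z assume "z \<in> {..a} \<times> space M"
      moreover obtain n :: nat where "a - fst z \<le> real n" using real_arch_simple by blast
      ultimately show "z \<in> (\<Union>n::nat. {a - real n .. a} \<times> space M)"
        by (cases z) (auto intro!: exI[of _ n])
    qed auto
    have 2: "UNIV \<times> space M - {..a} \<times> space M
      = (\<Union>n::nat. {a + 1 / Suc n .. a + Suc n} \<times> space M)"
    proof (intro set_eqI iffI)
      fix z assume "z \<in> UNIV \<times> space M - {..a} \<times> space M"
      then obtain s w where z: "z = (s, w)" "s > a" "w \<in> space M" by (cases z) auto
      obtain n :: nat where n: "1 / (s - a) \<le> real n" using real_arch_simple by blast
      obtain k :: nat where k: "s - a \<le> real k" using real_arch_simple by blast
      let ?m = "max n k"
      have "1 / (s - a) \<le> real (Suc ?m)" using n by (simp add: max_def split: if_splits)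
      then have "1 / real (Suc ?m) \<le> s - a" using z(2)
        by (metis diff_gt_0_iff_gt divide_inverse_commute inverse_eq_divide inverse_inverse_eq le_imp_inverse_le
            mult_1 zero_less_divide_1_iff)
      moreover have "s - a \<le> real (Suc ?m)" using k by (simp add: max_def split: if_splits)
      ultimately show "z \<in> (\<Union>n::nat. {a + 1 / Suc n .. a + Suc n} \<times> space M)"
        using z by (auto intro!: exI[of _ ?m])
    next
      fix z assume "z \<in> (\<Union>n::nat. {a + 1 / Suc n .. a + Suc n} \<times> space M)"
      then obtain n :: nat where "z \<in> {a + 1 / Suc n .. a + Suc n} \<times> space M" by blast
      then have z: "a + 1 / Suc n \<le> fst z" "snd z \<in> space M" by auto
      have "0 < 1 / real (Suc n)" by simp
      with z have "a < fst z" by linarith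
      then show "z \<in> UNIV \<times> space M - {..a} \<times> space M"
        using z by (cases z) auto
    qed
    show ?case
      unfolding bisouslin_def b 2 unfolding 1
      by (intro conjI souslin_UN souslin_paving paving.rect) auto
  next
    case Empty
    then show ?case
      using bisouslin_UNIV_times[of "{}" M] by simp
  next
    case (Compl b)
    have "UNIV \<times> space M - b \<times> space M = (UNIV - b) \<times> space M" by auto
    with bisouslin_compl[OF Compl(2)] show ?case by simp
  next
    case (Union b)
    have "(\<Union>i. b i) \<times> space M = (\<Union>i. b i \<times> space M)" by auto
    with bisouslin_UN[OF Union(2)] show ?case by simp
  qed
qed

lemma souslin_sets:
  assumes "S \<in> sets (borel \<Otimes>\<^sub>M M)"
  shows "souslin M S"
proof -
  have "S \<in> sigma_sets (UNIV \<times> space M) {a \<times> b |a b. a \<in> sets borel \<and> b \<in> sets M}"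
    using assms by (simp add: sets_pair_measure)
  then have "bisouslin M S"
  proof induction
    case (Basic S)
    then obtain a b where S: "S = a \<times> b" "a \<in> sets borel" "b \<in> sets M" by auto
    have "a \<times> b = (a \<times> space M) \<inter> (UNIV \<times> b)" using sets.sets_into_space[OF S(3)] by auto
    then show ?case
      using S by (auto intro: bisouslin_Int bisouslin_times_space bisouslin_UNIV_times)
  next
    case Empty
    then show ?case using bisouslin_UNIV_times[of "{}" M] by simp
  qed (auto intro: bisouslin_compl bisouslin_UN)
  then show ?thesis by (simp add: bisouslin_def)
qed

section \<open>Compact sets of sequences and capacitability\<close>

definition bounded_seqs :: "(nat \<Rightarrow> nat) \<Rightarrow> (nat \<Rightarrow> nat) set" where
  "bounded_seqs b = {\<sigma>. \<forall>i. \<sigma> i \<le> b i}"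

lemma compact_bounded_seqs: "compact (bounded_seqs b)"
proof -
  have "bounded_seqs b = (PiE UNIV (\<lambda>i. {..b i}))"
    by (auto simp: bounded_seqs_def PiE_def Pi_def)
  moreover have "compactin (product_topology (\<lambda>i::nat. euclidean :: nat topology) UNIV) (PiE UNIV (\<lambda>i. {..b i}))"
    by (subst compactin_PiE) (auto intro: finite_imp_compact)
  ultimately show ?thesis
    by (metis compactin_euclidean_iff euclidean_product_topology)
qed

lemma open_cylinder: "open {\<tau> :: nat \<Rightarrow> nat. \<forall>i<m. \<tau> i = \<sigma> i}"
proof -
  have "{\<tau>. \<forall>i<m. \<tau> i = \<sigma> i} = (\<Inter>i\<in>{..<m}. (\<lambda>\<tau>. \<tau> i) -` {\<sigma> i})" by auto
  also have "open \<dots>"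
    by (intro open_INT ballI open_vimage continuous_on_product_coordinates
        discrete_topology_class.open_discrete) auto
  finally show ?thesis .
qed

text \<open>Finitely many cylinders on which \<open>Q n\<close> is constant cover the compact set
  \<open>bounded_seqs b\<close>; so there are finitely many values and one common modulus
  \<open>m\<close>. In the second claim \<tau> itself may leave
  \<open>bounded_seqs b\<close>.\<close>

lemma scheme_finite:
  assumes "scheme M Q"
  shows "finite (Q n ` bounded_seqs b)" "\<exists>m. \<forall>\<sigma>\<in>bounded_seqs b. \<forall>\<tau>. (\<forall>i<m. \<tau> i = \<sigma> i) \<longrightarrow> Q n \<tau> = Q n \<sigma>"
proof -
  obtain m where m: "\<And>\<sigma> \<tau>. (\<forall>i<m \<sigma>. \<tau> i = \<sigma> i) \<Longrightarrow> Q n \<tau> = Q n \<sigma>"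
    using assms unfolding scheme_def by metis
  let ?C = "\<lambda>\<sigma>. {\<tau>. \<forall>i<m \<sigma>. \<tau> i = \<sigma> i}"
  obtain D where D: "D \<subseteq> bounded_seqs b" "finite D" "bounded_seqs b \<subseteq> (\<Union>\<sigma>\<in>D. ?C \<sigma>)"
  proof (rule compactE_image[OF compact_bounded_seqs[of b], of "bounded_seqs b" ?C])
    show "open (?C \<sigma>)" for \<sigma> by (rule open_cylinder)
  qed auto
  have "Q n ` bounded_seqs b \<subseteq> Q n ` D"
  proof
    fix q assume "q \<in> Q n ` bounded_seqs b"
    then obtain \<tau> where t: "\<tau> \<in> bounded_seqs b" "q = Q n \<tau>" by auto
    then obtain \<sigma> where "\<sigma> \<in> D" "\<tau> \<in> ?C \<sigma>" using D(3) by blast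
    then show "q \<in> Q n ` D" using m[of \<sigma> \<tau>] t by auto
  qed
  then show "finite (Q n ` bounded_seqs b)"
    using D(2) finite_subset by blast
  show "\<exists>m. \<forall>\<sigma>\<in>bounded_seqs b. \<forall>\<tau>. (\<forall>i<m. \<tau> i = \<sigma> i) \<longrightarrow> Q n \<tau> = Q n \<sigma>"
  proof (intro exI ballI allI impI)
    fix \<sigma> \<tau> assume s: "\<sigma> \<in> bounded_seqs b" and t: "\<forall>i<Max (m ` D). \<tau> i = \<sigma> i"
    then obtain \<rho> where r: "\<rho> \<in> D" "\<sigma> \<in> ?C \<rho>" using D(3) by blast
    have "m \<rho> \<le> Max (m ` D)" using r(1) D(2) by auto
    then have "\<tau> \<in> ?C \<rho>" using t r(2) by auto
    then show "Q n \<tau> = Q n \<sigma>" using r(2) m[of \<rho> \<tau>] m[of \<rho> \<sigma>] by simp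
  qed
qed

text \<open>Choquet's capacitability argument for the set function \<open>S \<mapsto> P\<^sup>*(snd ` S)\<close>.\<close>

lemma souslin_inner_approx:
  assumes M: "finite_measure M" and S: "souslin M S" "S \<subseteq> UNIV \<times> space M"
    and a: "a < outer_measure_of M (snd ` S)"
  shows "\<exists>D\<in>sets M. D \<subseteq> snd ` S \<and> a \<le> emeasure M D"
proof -
  interpret finite_measure M by fact
  obtain Q where Q: "scheme M Q" "S = {z. \<exists>\<sigma>. \<forall>n. z \<in> Q n \<sigma>}"
    using S unfolding souslin_def by auto
  define A where "A k b = {z. \<exists>\<sigma>. (\<forall>i<k. \<sigma> i \<le> b i) \<and> (\<forall>n. z \<in> Q n \<sigma>)}" for k and b :: "nat \<Rightarrow> nat"
  have A_sub: "snd ` A k b \<subseteq> space M" for k b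
    using S(2) unfolding A_def Q(2) by fastforce
  \<comment> \<open>Outer measure is continuous along increasing sequences of arbitrary sets, so
    some finite bound \<open>v\<close> on coordinate \<open>k\<close> keeps it above
    \<open>a\<close>.\<close>
  have step: "\<exists>v. a < outer_measure_of M (snd ` A (Suc k) (b(k := v)))"
    if "a < outer_measure_of M (snd ` A k b)" for k b
  proof -
    have "A k b = (\<Union>v. A (Suc k) (b(k := v)))"
    proof (intro set_eqI iffI)
      fix z assume "z \<in> A k b"
      then obtain \<sigma> where "\<forall>i<k. \<sigma> i \<le> b i" "\<forall>n. z \<in> Q n \<sigma>" by (auto simp: A_def)
      then have "z \<in> A (Suc k) (b(k := \<sigma> k))" by (auto simp: A_def less_Suc_eq intro!: exI[of _ \<sigma>])
      then show "z \<in> (\<Union>v. A (Suc k) (b(k := v)))" by blast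
    next
      fix z assume "z \<in> (\<Union>v. A (Suc k) (b(k := v)))"
      then obtain v \<sigma> where "\<forall>i<Suc k. \<sigma> i \<le> (b(k := v)) i" "\<forall>n. z \<in> Q n \<sigma>" by (auto simp: A_def)
      moreover from this(1) have "\<sigma> i \<le> b i" if "i < k" for i
        using that less_SucI[OF that] by (metis fun_upd_other less_irrefl)
      ultimately show "z \<in> A k b"
        unfolding A_def mem_Collect_eq by (intro exI[of _ \<sigma>]) simp
    qed
    then have "outer_measure_of M (snd ` A k b) = outer_measure_of M (\<Union>v. snd ` A (Suc k) (b(k := v)))"
      by (simp add: image_UN)
    also have "\<dots> = (SUP v. outer_measure_of M (snd ` A (Suc k) (b(k := v))))"
    proof (rule SUP_outer_measure_of_incseq[symmetric])
      show "incseq (\<lambda>v. snd ` A (Suc k) (b(k := v)))"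
      proof (intro incseq_SucI image_mono subsetI)
        fix v z assume "z \<in> A (Suc k) (b(k := v))"
        then obtain \<sigma> where "\<forall>i<Suc k. \<sigma> i \<le> (b(k := v)) i" "\<forall>n. z \<in> Q n \<sigma>" by (auto simp: A_def)
        then show "z \<in> A (Suc k) (b(k := Suc v))"
          unfolding A_def mem_Collect_eq
          by (intro exI[of _ \<sigma>] conjI allI impI) (fastforce intro: le_SucI split: if_splits, simp)
      qed
    qed (rule A_sub)
    finally show ?thesis using that by (auto simp: less_SUP_iff)
  qed
  obtain f where f: "\<And>k b. a < outer_measure_of M (snd ` A k b) \<Longrightarrow>
      a < outer_measure_of M (snd ` A (Suc k) (b(k := f k b)))"
    using step by metis
  define bs where "bs = rec_nat (\<lambda>_. 0) (\<lambda>k b. b(k := f k b))"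
  have bs0: "bs 0 = (\<lambda>_. 0)" and bsS: "bs (Suc k) = (bs k)(k := f k (bs k))" for k
    by (simp_all add: bs_def)
  define b where "b k = f k (bs k)" for k
  have bs_eq: "i < k \<Longrightarrow> bs k i = b i" for i k
    by (induction k) (auto simp: bsS b_def less_Suc_eq)
  have A_cong: "A k b = A k b'" if "\<And>i. i < k \<Longrightarrow> b i = b' i" for k b b'
    using that by (auto simp: A_def)
  have "a < outer_measure_of M (snd ` A k (bs k))" for k
  proof (induction k)
    case 0
    have "A 0 (bs 0) = S" by (auto simp: A_def Q(2))
    with a show ?case by simp
  next
    case (Suc k)
    show ?case unfolding bsS by (rule f[OF Suc])
  qed
  then have bA: "a < outer_measure_of M (snd ` A k b)" for k
    by (metis A_cong bs_eq)
  \<comment> \<open>\<open>R k\<close> tests only the indices up to \<open>k\<close>, on which the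
    scheme takes finitely many values over \<open>bounded_seqs b\<close>; this keeps
    \<open>R k\<close> in the paving although the union may be uncountable.\<close>
  define R where "R k = (\<Union>\<sigma>\<in>bounded_seqs b. \<Inter>n\<le>k. Q n \<sigma>)" for k
  have RS: "(\<Inter>k. R k) \<subseteq> S"
  proof
    fix z assume z: "z \<in> (\<Inter>k. R k)"
    have cl: "closed {\<sigma>. z \<in> Q n \<sigma>}" for n
    proof -
      have "open {\<sigma>. z \<notin> Q n \<sigma>}"
      proof (subst open_subopen, intro ballI)
        fix \<sigma> assume *: "\<sigma> \<in> {\<sigma>. z \<notin> Q n \<sigma>}"
        obtain m where m: "\<And>\<tau>. (\<forall>i<m. \<tau> i = \<sigma> i) \<Longrightarrow> Q n \<tau> = Q n \<sigma>"
          using Q(1) unfolding scheme_def by metis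
        have "{\<tau>. \<forall>i<m. \<tau> i = \<sigma> i} \<subseteq> {\<sigma>. z \<notin> Q n \<sigma>}"
        proof
          fix \<tau> assume "\<tau> \<in> {\<tau>. \<forall>i<m. \<tau> i = \<sigma> i}"
          then have "Q n \<tau> = Q n \<sigma>" by (intro m) simp
          with * show "\<tau> \<in> {\<sigma>. z \<notin> Q n \<sigma>}" by simp
        qed
        moreover have "\<sigma> \<in> {\<tau>. \<forall>i<m. \<tau> i = \<sigma> i}" by simp
        ultimately show "\<exists>T. open T \<and> \<sigma> \<in> T \<and> T \<subseteq> {\<sigma>. z \<notin> Q n \<sigma>}"
          using open_cylinder[of m \<sigma>] by blast
      qed
      then show ?thesis by (simp add: closed_def Collect_neg_eq)
    qed
    \<comment> \<open>Each \<open>R k\<close> may be witnessed by a different sequence; compactness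
      supplies one sequence that is valid for all indices.\<close>
    have "bounded_seqs b \<inter> (\<Inter>n\<in>UNIV. {\<sigma>. z \<in> Q n \<sigma>}) \<noteq> {}"
    proof (rule compact_imp_fip_image[OF compact_bounded_seqs cl])
      fix I :: "nat set" assume "finite I"
      then obtain k where k: "I \<subseteq> {..k}" by (metis finite_nat_iff_bounded_le)
      have "z \<in> R k" using z by blast
      then obtain \<sigma> where "\<sigma> \<in> bounded_seqs b" "\<forall>n\<le>k. z \<in> Q n \<sigma>"
        unfolding R_def by auto
      then have "\<sigma> \<in> bounded_seqs b \<inter> (\<Inter>n\<in>I. {\<sigma>. z \<in> Q n \<sigma>})"
        using k by auto
      then show "bounded_seqs b \<inter> (\<Inter>n\<in>I. {\<sigma>. z \<in> Q n \<sigma>}) \<noteq> {}" by blast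
    qed
    then obtain \<sigma> where "\<forall>n. z \<in> Q n \<sigma>" by blast
    then show "z \<in> S" unfolding Q(2) by blast
  qed
  have Rp: "R k \<in> paving M" for k
  proof -
    have "finite ((\<lambda>\<sigma>. restrict (\<lambda>n. Q n \<sigma>) {..k}) ` bounded_seqs b)"
      by (rule finite_subset[of _ "PiE {..k} (\<lambda>n. Q n ` bounded_seqs b)"])
         (auto intro!: finite_PiE scheme_finite(1)[OF Q(1)])
    then have "finite ((\<lambda>g. \<Inter>n\<le>k. g n) ` (\<lambda>\<sigma>. restrict (\<lambda>n. Q n \<sigma>) {..k}) ` bounded_seqs b)"
      by (rule finite_imageI)
    then have fin: "finite ((\<lambda>\<sigma>. \<Inter>n\<le>k. Q n \<sigma>) ` bounded_seqs b)"
      by (simp add: image_image)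
    have "Q n \<sigma> \<in> paving M" for n \<sigma>
      using Q(1) unfolding scheme_def by blast
    then show ?thesis
      unfolding R_def by (intro paving_Union fin) (auto intro: paving_Inter_atMost)
  qed
  have dec: "decseq R"
    unfolding R_def by (intro decseq_SucI UN_mono INF_superset_mono) auto
  have big: "a \<le> emeasure M (snd ` R k)" for k
  proof -
    obtain m where m: "\<And>n \<sigma> \<tau>. \<sigma> \<in> bounded_seqs b \<Longrightarrow> (\<forall>i<m n. \<tau> i = \<sigma> i) \<Longrightarrow> Q n \<tau> = Q n \<sigma>"
      using scheme_finite(2)[OF Q(1)] by metis
    define j where "j = Max (m ` {..k})"
    have j: "m n \<le> j" if "n \<le> k" for n using that by (auto simp: j_def)
    have "A j b \<subseteq> R k"
    proof
      fix z assume "z \<in> A j b"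
      then obtain \<sigma> where s: "\<forall>i<j. \<sigma> i \<le> b i" "\<And>n. z \<in> Q n \<sigma>"
        unfolding A_def by blast
      \<comment> \<open>Beyond the first \<open>j\<close> entries \<sigma> need not respect
        \<open>b\<close>. Replacing them by 0 makes the sequence bounded and, by the choice of
        \<open>j\<close>, does not change \<open>Q n\<close> for \<open>n \<le> k\<close>.\<close>
      define \<tau> where "\<tau> i = (if i < j then \<sigma> i else 0)" for i
      have "\<tau> \<in> bounded_seqs b" using s(1) by (auto simp: \<tau>_def bounded_seqs_def)
      moreover have "z \<in> Q n \<tau>" if "n \<le> k" for n
      proof -
        have "Q n \<sigma> = Q n \<tau>"
          using j[OF that] by (intro m[OF \<open>\<tau> \<in> bounded_seqs b\<close>]) (simp add: \<tau>_def)
        with s(2)[of n] show ?thesis by simp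
      qed
      ultimately show "z \<in> R k" unfolding R_def by blast
    qed
    then have "outer_measure_of M (snd ` A j b) \<le> outer_measure_of M (snd ` R k)"
      by (intro outer_measure_of_mono image_mono)
    with bA[of j] show ?thesis
      by (simp add: paving_proj[OF Rp])
  qed
  have "a \<le> (INF k. emeasure M (snd ` R k))"
    by (intro INF_greatest big)
  also have "\<dots> = emeasure M (\<Inter>k. snd ` R k)"
  proof (rule INF_emeasure_decseq)
    show "decseq (\<lambda>k. snd ` R k)"
      using dec unfolding decseq_def by (simp add: image_mono)
  qed (use paving_proj[OF Rp] in auto)
  also have "(\<Inter>k. snd ` R k) = snd ` (\<Inter>k. R k)"
    by (rule paving_proj_Inter[OF Rp dec, symmetric])
  finally have "a \<le> emeasure M (snd ` (\<Inter>k. R k))" .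
  moreover have "snd ` (\<Inter>k. R k) \<in> sets M"
    unfolding paving_proj_Inter[OF Rp dec] by (intro sets.countable_INT) (use paving_proj[OF Rp] in auto)
  moreover have "snd ` (\<Inter>k. R k) \<subseteq> snd ` S"
    by (rule image_mono[OF RS])
  ultimately show ?thesis by blast
qed

text \<open>By inner approximation, countably many measurable subsets of the projection exhaust the
  measure of a measurable hull \<open>E\<close>. The projection lies between their union and
  \<open>E\<close>, which differ by a null set.\<close>

theorem measurable_projection:
  fixes S :: "(real \<times> 'a) set"
  assumes M: "finite_measure M" and S: "S \<in> sets (borel \<Otimes>\<^sub>M M)"
  shows "snd ` S \<in> sets (completion M)"
proof -
  interpret finite_measure M by fact
  have Ssub: "S \<subseteq> UNIV \<times> space M" using sets.sets_into_space[OF S] by (simp add: space_pair_measure)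
  have sub: "snd ` S \<subseteq> space M" using Ssub by auto
  obtain E where E: "E \<in> sets M" "snd ` S \<subseteq> E" "outer_measure_of M (snd ` S) = emeasure M E"
    using outer_measure_of_attain[OF sub] by auto
  let ?\<D> = "{D\<in>sets M. D \<subseteq> snd ` S}"
  have sup: "emeasure M E \<le> (SUP D\<in>?\<D>. emeasure M D)"
  proof (rule dense_le)
    fix a assume "a < emeasure M E"
    then obtain D where "D \<in> ?\<D>" "a \<le> emeasure M D"
      using souslin_inner_approx[OF M souslin_sets[OF S] Ssub, of a] E(3) by auto
    then show "a \<le> (SUP D\<in>?\<D>. emeasure M D)" by (auto intro: SUP_upper2)
  qed
  have "?\<D> \<noteq> {}" by auto
  then obtain g where g: "range g \<subseteq> emeasure M ` ?\<D>" "(SUP D\<in>?\<D>. emeasure M D) = (SUP i::nat. g i)"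
    using ennreal_SUP_countable_SUP[of ?\<D> "emeasure M"] by blast
  then have "\<forall>i. \<exists>D\<in>?\<D>. g i = emeasure M D" by blast
  then obtain D where D: "\<And>i. D i \<in> ?\<D>" "\<And>i. g i = emeasure M (D i)" by metis
  define D' where "D' = (\<Union>i. D i)"
  have D': "D' \<in> sets M" "D' \<subseteq> snd ` S" using D(1) by (auto simp: D'_def)
  have "emeasure M E \<le> emeasure M D'"
    unfolding D'_def by (rule order.trans[OF sup]) (use D in \<open>auto simp: g intro!: SUP_least emeasure_mono\<close>)
  then have "emeasure M (E - D') = 0"
    using E(1,2) D' by (subst emeasure_Diff) (auto simp: diff_eq_0_iff_ennreal less_top[symmetric])
  then have "E - D' \<in> null_sets M" using E D' by auto
  then show ?thesis
    using D' E(2) by (intro sets_completionI[of _ D' "snd ` S - D'" "E - D'"]) auto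
qed

section \<open>The simple Markov property on path space\<close>

definition visits :: "('w, 'e) process \<Rightarrow> 'e set \<Rightarrow> real \<Rightarrow> 'w \<Rightarrow> bool" where
  "visits X A s \<omega> \<longleftrightarrow> traj X (ennreal s) \<omega> \<in> Some ` A"

text \<open>On this sub-sigma-algebra of \<open>events X\<close> the laws turn out to depend Borel
  measurably on the starting point and the shifts are measurable. For \<open>events X\<close> only
  universal measurability of the laws is given, and nothing is said about the shifts.\<close>

definition path_events :: "('w, 'e::topological_space) process \<Rightarrow> 'w measure" where
  "path_events X = sigma (space (events X))
     {{\<omega>\<in>space (events X). visits X A s \<omega>} |A s. A \<in> sets borel \<and> 0 \<le> s}"

definition lift_fn :: "('w, 'e) process \<Rightarrow> ('e \<Rightarrow> ennreal) \<Rightarrow> real \<Rightarrow> 'w \<Rightarrow> ennreal" where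
  "lift_fn X g s \<omega> = (case traj X (ennreal s) \<omega> of None \<Rightarrow> 0 | Some z \<Rightarrow> g z)"

abbreviation alive :: "('w, 'e) process \<Rightarrow> real \<Rightarrow> 'w \<Rightarrow> bool" where
  "alive X \<equiv> visits X UNIV"

abbreviation kern :: "('w, 'e::topological_space) process \<Rightarrow> real \<Rightarrow> 'e \<Rightarrow> 'e measure" where
  "kern X s \<equiv> transition X (ennreal s)"

lemma visits_mono: "visits X A s \<omega> \<Longrightarrow> A \<subseteq> B \<Longrightarrow> visits X B s \<omega>"
  by (auto simp: visits_def)

lemma visits_Int: "visits X (A \<inter> B) s \<omega> \<longleftrightarrow> visits X A s \<omega> \<and> visits X B s \<omega>"
  by (auto simp: visits_def)

lemma visits_Diff: "visits X (A - B) s \<omega> \<longleftrightarrow> visits X A s \<omega> \<and> \<not> visits X B s \<omega>"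
  by (auto simp: visits_def)

lemma visits_UN: "visits X (\<Union>i\<in>I. A i) s \<omega> \<longleftrightarrow> (\<exists>i\<in>I. visits X (A i) s \<omega>)"
  by (auto simp: visits_def)

lemma visits_empty [simp]: "\<not> visits X {} s \<omega>"
  by (auto simp: visits_def)

lemma visits_singleton: "visits X {y} s \<omega> \<longleftrightarrow> traj X (ennreal s) \<omega> = Some y"
  by (auto simp: visits_def)

lemma lift_fn_indicator: "lift_fn X (indicator A) s \<omega> = indicator {\<omega>. visits X A s \<omega>} \<omega>"
  by (auto simp: lift_fn_def visits_def indicator_def split: option.split)

lemma lift_fn_mult: "lift_fn X (\<lambda>z. f z * g z) s \<omega> = lift_fn X f s \<omega> * lift_fn X g s \<omega>"
  by (auto simp: lift_fn_def split: option.split)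

lemma space_path_events: "space (path_events X) = space (events X)"
  unfolding path_events_def by (subst space_measure_of) auto

lemma visits_path_events:
  "A \<in> sets borel \<Longrightarrow> 0 \<le> s \<Longrightarrow> {\<omega>\<in>space (events X). visits X A s \<omega>} \<in> sets (path_events X)"
  unfolding path_events_def by (subst sets_measure_of) auto

lemma lift_fn_level: "v < lift_fn X g s \<omega> \<longleftrightarrow> visits X {z. v < g z} s \<omega>"
  by (auto simp: lift_fn_def visits_def split: option.split)

section \<open>Laws, kernels and shifts of a right process\<close>

locale right_process =
  fixes X :: "('w, 'e::{metric_space, second_countable_topology}) process"
  assumes rp: "borel_right_process X"
begin

abbreviation "\<Omega> \<equiv> space (events X)"

lemma filtr: "filtration \<Omega> (filt X)"
  using rp by (simp add: borel_right_process_def)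

lemma space_filt [simp]: "space (filt X t) = \<Omega>"
  using filtr by (simp add: filtration_def)

lemma filt_mono: "s \<le> t \<Longrightarrow> sets (filt X s) \<subseteq> sets (filt X t)"
  using filtr by (simp add: filtration_def)

lemma filt_events: "sets (filt X t) \<subseteq> sets (events X)"
  using rp by (auto simp: borel_right_process_def)

lemma visits_filt:
  assumes "A \<in> sets borel" "s \<le> t"
  shows "{\<omega>\<in>\<Omega>. visits X A s \<omega>} \<in> sets (filt X (ennreal t))"
proof -
  have "traj X (ennreal s) \<in> filt X (ennreal s) \<rightarrow>\<^sub>M cemetery_borel"
    using rp by (simp add: borel_right_process_def)
  moreover have "Some ` A \<in> sets cemetery_borel"
    using assms unfolding cemetery_borel_def by (subst sets_measure_of) auto
  ultimately have "traj X (ennreal s) -` (Some ` A) \<inter> space (filt X (ennreal s)) \<in> sets (filt X (ennreal s))"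
    by (rule measurable_sets)
  also have "traj X (ennreal s) -` (Some ` A) \<inter> space (filt X (ennreal s)) = {\<omega>\<in>\<Omega>. visits X A s \<omega>}"
    by (auto simp: visits_def)
  finally show ?thesis
    using filt_mono[of "ennreal s" "ennreal t"] assms(2) by (auto simp: ennreal_leI)
qed

lemma visits_events: "A \<in> sets borel \<Longrightarrow> {\<omega>\<in>\<Omega>. visits X A s \<omega>} \<in> sets (events X)"
  using visits_filt[of A s s] filt_events by auto

lemma path_events_sub: "sets (path_events X) \<subseteq> sets (events X)"
  unfolding path_events_def by (subst sets_measure_of) (auto intro!: sets.sigma_sets_subset visits_events)

lemma law_measurable: "law X \<in> universal_borel \<rightarrow>\<^sub>M prob_algebra (events X)"
  using rp by (simp add: borel_right_process_def)

lemma law_space: "law X y \<in> space (prob_algebra (events X))"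
proof -
  have "y \<in> space universal_borel"
    unfolding universal_borel_def by simp
  then show ?thesis by (rule measurable_space[OF law_measurable])
qed

lemma prob_space_law: "prob_space (law X y)" and sets_law [simp]: "sets (law X y) = sets (events X)"
  using law_space[of y] by (auto simp: space_prob_algebra)

lemma space_law [simp]: "space (law X y) = \<Omega>"
  using sets_law by (rule sets_eq_imp_space_eq)

lemma law_init_measurable:
  assumes "prob_on \<nu>"
  shows "law X \<in> completion \<nu> \<rightarrow>\<^sub>M subprob_algebra (events X)"
proof -
  have sp: "space \<nu> = UNIV"
    using assms sets_eq_imp_space_eq[of \<nu> borel] by (auto simp: prob_on_def)
  have "sets universal_borel \<subseteq> sets (completion \<nu>)"
  proof -
    have "sets universal_borel = sigma_sets UNIV (\<Inter>\<nu>\<in>Collect prob_on. sets (completion \<nu>))"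
      unfolding universal_borel_def by (rule sets_measure_of) auto
    also have "\<dots> \<subseteq> sets (completion \<nu>)"
      using sp assms sets.sigma_sets_subset[of "(\<Inter>\<nu>\<in>Collect prob_on. sets (completion \<nu>))" "completion \<nu>"]
      by auto
    finally show ?thesis .
  qed
  moreover have "space universal_borel = space (completion \<nu>)"
    by (simp add: universal_borel_def sp)
  ultimately show ?thesis
    using measurable_prob_algebraD[OF law_measurable] measurable_mono[of "subprob_algebra (events X)" "subprob_algebra (events X)" universal_borel "completion \<nu>"]
    by auto
qed

lemma emeasure_law_init:
  assumes "prob_on \<nu>" "A \<in> sets (events X)"
  shows "emeasure (law_init X \<nu>) A = (\<integral>\<^sup>+y. emeasure (law X y) A \<partial>\<nu>)"
proof -
  have "space \<nu> \<noteq> {}"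
    using assms sets_eq_imp_space_eq[of \<nu> borel] by (auto simp: prob_on_def)
  then show ?thesis
    unfolding law_init_def
    by (subst emeasure_bind[OF _ law_init_measurable[OF assms(1)] assms(2)]) (simp_all add: nn_integral_completion)
qed

lemma sets_law_init: "prob_on \<nu> \<Longrightarrow> sets (law_init X \<nu>) = sets (events X)"
  unfolding law_init_def
  using sets_eq_imp_space_eq[of \<nu> borel] by (intro sets_bind) (auto simp: prob_on_def)

lemma prob_on_return: "prob_on (return borel (y::'e))"
  by (simp add: prob_on_def prob_space_return)

lemma law_init_return: "law_init X (return borel y) = law X y"
proof (rule measure_eqI)
  show "sets (law_init X (return borel y)) = sets (law X y)"
    by (simp add: sets_law_init prob_on_return)
  fix A assume "A \<in> sets (law_init X (return borel y))"
  then have A: "A \<in> sets (events X)" by (simp add: sets_law_init prob_on_return)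
  have "AE z in return borel y. z = y"
    by (subst AE_return) auto
  then have "(\<integral>\<^sup>+z. emeasure (law X z) A \<partial>return borel y) = (\<integral>\<^sup>+z. emeasure (law X y) A \<partial>return borel y)"
    by (intro nn_integral_cong_AE) auto
  then show "emeasure (law_init X (return borel y)) A = emeasure (law X y) A"
    by (simp add: emeasure_law_init[OF prob_on_return A] prob_space.emeasure_space_1[OF prob_space_return])
qed

lemma sets_kern [simp]: "sets (kern X s y) = sets borel" and space_kern [simp]: "space (kern X s y) = UNIV"
  by (simp_all add: transition_def)

lemma alive_events: "{\<omega>\<in>\<Omega>. alive X s \<omega>} \<in> sets (events X)"
  by (rule visits_events) simp

lemma pos_measurable:
  "(\<lambda>\<omega>. the (traj X (ennreal s) \<omega>)) \<in> restrict_space (law X y) {\<omega>. traj X (ennreal s) \<omega> \<noteq> None} \<rightarrow>\<^sub>M borel"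
proof (rule measurableI)
  let ?R = "restrict_space (law X y) {\<omega>. traj X (ennreal s) \<omega> \<noteq> None}"
  fix A :: "'e set" assume "A \<in> sets borel"
  have "(\<lambda>\<omega>. the (traj X (ennreal s) \<omega>)) -` A \<inter> space ?R
    = {\<omega>. traj X (ennreal s) \<omega> \<noteq> None} \<inter> {\<omega>\<in>\<Omega>. visits X A s \<omega>}"
    by (auto simp: space_restrict_space visits_def image_iff)
  also have "\<dots> \<in> sets ?R"
    using visits_events[OF \<open>A \<in> sets borel\<close>, of s] unfolding sets_restrict_space by simp
  finally show "(\<lambda>\<omega>. the (traj X (ennreal s) \<omega>)) -` A \<inter> space ?R \<in> sets ?R" .
qed auto

lemma alive_sets: "{\<omega>. traj X (ennreal s) \<omega> \<noteq> None} \<inter> space (law X y) \<in> sets (law X y)"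
proof -
  have "{\<omega>. traj X (ennreal s) \<omega> \<noteq> None} \<inter> space (law X y) = {\<omega>\<in>\<Omega>. alive X s \<omega>}"
    by (auto simp: visits_def)
  then show ?thesis using alive_events by simp
qed

lemma emeasure_kern:
  assumes "A \<in> sets borel"
  shows "emeasure (kern X s y) A = emeasure (law X y) {\<omega>\<in>\<Omega>. visits X A s \<omega>}"
proof -
  have eq: "(\<lambda>\<omega>. the (traj X (ennreal s) \<omega>)) -` A \<inter> space (restrict_space (law X y) {\<omega>. traj X (ennreal s) \<omega> \<noteq> None})
    = {\<omega>\<in>\<Omega>. visits X A s \<omega>}"
    by (auto simp: space_restrict_space visits_def image_iff)
  show ?thesis
    unfolding transition_def
    by (subst emeasure_distr[OF pos_measurable assms], subst eq,
        subst emeasure_restrict_space[OF alive_sets]) (auto simp: visits_def)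
qed

lemma nn_integral_kern:
  assumes g: "g \<in> borel_measurable borel"
  shows "(\<integral>\<^sup>+z. g z \<partial>kern X s y) = (\<integral>\<^sup>+\<omega>. lift_fn X g s \<omega> \<partial>law X y)"
proof -
  have "(\<integral>\<^sup>+z. g z \<partial>kern X s y)
    = (\<integral>\<^sup>+\<omega>. g (the (traj X (ennreal s) \<omega>)) * indicator {\<omega>. traj X (ennreal s) \<omega> \<noteq> None} \<omega> \<partial>law X y)"
    unfolding transition_def
    by (subst nn_integral_distr[OF pos_measurable], simp add: g)
      (subst nn_integral_restrict_space[OF alive_sets], simp)
  also have "\<dots> = (\<integral>\<^sup>+\<omega>. lift_fn X g s \<omega> \<partial>law X y)"
    by (intro nn_integral_cong) (auto simp: lift_fn_def split: option.split)
  finally show ?thesis .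
qed

lemma subprob_kern: "subprob_space (kern X s y)"
proof (rule subprob_spaceI)
  interpret prob_space "law X y" by (rule prob_space_law)
  show "emeasure (kern X s y) (space (kern X s y)) \<le> 1"
    using emeasure_space[of "law X y" "{\<omega>\<in>\<Omega>. alive X s \<omega>}"] emeasure_space_1 by (simp add: emeasure_kern)
qed simp

lemma kern_measurable: "kern X s \<in> borel \<rightarrow>\<^sub>M subprob_algebra borel"
proof (rule measurable_subprob_algebra)
  show "(\<lambda>a. emeasure (kern X s a) A) \<in> borel_measurable borel" if "A \<in> sets borel" for A
    using rp that by (simp add: borel_right_process_def)
qed (simp_all add: subprob_kern)

lemma nn_integral_kern_measurable:
  assumes "g \<in> borel_measurable borel"
  shows "(\<lambda>z. \<integral>\<^sup>+w. g w \<partial>kern X s z) \<in> borel_measurable borel"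
  using assms by (intro nn_integral_measurable_subprob_algebra2[OF _ kern_measurable]) simp

lemma dies: "\<omega> \<in> \<Omega> \<Longrightarrow> alive X t \<omega> \<Longrightarrow> s \<le> t \<Longrightarrow> alive X s \<omega>"
proof -
  assume *: "\<omega> \<in> \<Omega>" "alive X t \<omega>" "s \<le> t"
  have "\<forall>s t. s \<le> t \<longrightarrow> traj X s \<omega> = None \<longrightarrow> traj X t \<omega> = None"
    using rp * by (auto simp: borel_right_process_def)
  then have "traj X (ennreal s) \<omega> = None \<longrightarrow> traj X (ennreal t) \<omega> = None"
    using *(3) ennreal_leI by blast
  with *(2) show ?thesis by (cases "traj X (ennreal s) \<omega>") (auto simp: visits_def)
qed

abbreviation shift :: "real \<Rightarrow> 'w \<Rightarrow> 'w" where "shift s \<equiv> time_shift X (ennreal s)"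

lemma shift_space: "\<omega> \<in> \<Omega> \<Longrightarrow> shift s \<omega> \<in> \<Omega>"
  using rp by (simp add: borel_right_process_def)

lemma visits_shift:
  "\<omega> \<in> \<Omega> \<Longrightarrow> 0 \<le> s \<Longrightarrow> 0 \<le> t \<Longrightarrow> visits X A t (shift s \<omega>) \<longleftrightarrow> visits X A (s + t) \<omega>"
proof -
  assume *: "\<omega> \<in> \<Omega>" "0 \<le> s" "0 \<le> t"
  then have "traj X (ennreal t) (shift s \<omega>) = traj X (ennreal t + ennreal s) \<omega>"
    using rp by (simp add: borel_right_process_def)
  with * show ?thesis
    by (simp add: visits_def add.commute flip: ennreal_plus)
qed

lemma shift_measurable: "0 \<le> s \<Longrightarrow> shift s \<in> path_events X \<rightarrow>\<^sub>M path_events X"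
proof -
  assume s: "0 \<le> s"
  show ?thesis
    unfolding path_events_def[of X]
  proof (rule measurable_sigma_sets[OF sets_measure_of])
    fix B assume "B \<in> {{\<omega> \<in> \<Omega>. visits X A t \<omega>} |A t. A \<in> sets borel \<and> 0 \<le> t}"
    then obtain A t where B: "B = {\<omega> \<in> \<Omega>. visits X A t \<omega>}" "A \<in> sets borel" "0 \<le> t" by auto
    have "shift s -` B \<inter> \<Omega> = {\<omega>\<in>\<Omega>. visits X A (s + t) \<omega>}"
      using visits_shift s B shift_space by auto
    then show "shift s -` B \<inter> space (sigma \<Omega> {{\<omega> \<in> \<Omega>. visits X A t \<omega>} |A t. A \<in> sets borel \<and> 0 \<le> t})
        \<in> sets (sigma \<Omega> {{\<omega> \<in> \<Omega>. visits X A t \<omega>} |A t. A \<in> sets borel \<and> 0 \<le> t})"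
      using visits_path_events[of A "s + t" X] B s space_path_events[of X] by (simp add: path_events_def)
  qed (use space_path_events[of X, unfolded path_events_def] in \<open>auto simp: shift_space\<close>)
qed

text \<open>The simple Markov property is the strong one at a constant time.\<close>

lemma markov_set:
  assumes A: "A \<in> sets (filt X (ennreal s))" and B: "B \<in> sets borel" and st: "0 \<le> s" "0 \<le> u"
  shows "emeasure (law X y) {\<omega>\<in>A. visits X B (s + u) \<omega>}
    = (\<integral>\<^sup>+\<omega>. lift_fn X (\<lambda>z. emeasure (kern X u z) B) s \<omega> * indicator A \<omega> \<partial>law X y)"
proof -
  interpret filtration \<Omega> "filt X" by (rule filtr)
  have sm: "strong_markov X" using rp by (simp add: borel_right_process_def)
  have "A \<in> sets (pre_sigma (\<lambda>_. ennreal s))"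
  proof (rule sets_pre_sigmaI[OF stopping_time_const])
    show "{\<omega> \<in> A. ennreal s \<le> t} \<in> sets (filt X t)" for t
      using A filt_mono[of "ennreal s" t] by (cases "ennreal s \<le> t") auto
  qed
  then have "emeasure (law_init X (return borel y)) {\<omega>\<in>A. traj X (ennreal s + ennreal u) \<omega> \<in> Some ` B} =
        (\<integral>\<^sup>+\<omega>\<in>A. (case traj X (ennreal s) \<omega> of None \<Rightarrow> 0 | Some y \<Rightarrow> emeasure (transition X (ennreal u) y) B)
           \<partial>law_init X (return borel y))"
    using sm prob_on_return stopping_time_const B unfolding strong_markov_def by blast
  then show ?thesis
    using st by (simp add: law_init_return lift_fn_def visits_def flip: ennreal_plus)
qed

text \<open>With \<open>?\<rho> s\<close> the distribution of the position of the living path at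
  time \<open>s\<close> on the event \<open>A\<close>, \<open>markov_set\<close> says that
  \<open>?\<rho> (s + u)\<close> equals \<open>?\<rho> s \<bind> kern X u\<close>. The claim
  integrates \<open>g\<close> against both.\<close>

lemma markov_fn:
  assumes A: "A \<in> sets (filt X (ennreal s))" and g: "g \<in> borel_measurable borel" and st: "0 \<le> s" "0 \<le> u"
  shows "(\<integral>\<^sup>+\<omega>. lift_fn X g (s + u) \<omega> * indicator A \<omega> \<partial>law X y)
    = (\<integral>\<^sup>+\<omega>. lift_fn X (\<lambda>z. \<integral>\<^sup>+w. g w \<partial>kern X u z) s \<omega> * indicator A \<omega> \<partial>law X y)"
proof -
  let ?R = "\<lambda>s. restrict_space (law X y) {\<omega>. traj X (ennreal s) \<omega> \<noteq> None}"
  let ?\<rho> = "\<lambda>s. distr (density (?R s) (indicator A)) borel (\<lambda>\<omega>. the (traj X (ennreal s) \<omega>))"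
  have A': "A \<in> sets (law X y)" using A filt_events by auto
  have [measurable]: "indicator A \<in> borel_measurable (law X y)" using A' by (rule borel_measurable_indicator)
  have \<rho>: "(\<integral>\<^sup>+z. g z \<partial>?\<rho> s) = (\<integral>\<^sup>+\<omega>. lift_fn X g s \<omega> * indicator A \<omega> \<partial>law X y)"
    if g: "g \<in> borel_measurable borel" for g s
  proof -
    have 1: "(\<lambda>\<omega>. the (traj X (ennreal s) \<omega>)) \<in> density (?R s) (indicator A) \<rightarrow>\<^sub>M borel"
      using pos_measurable[of s y] by simp
    have 2: "indicator A \<in> borel_measurable (?R s)"
      by (intro measurable_restrict_space1) simp
    have 3: "(\<lambda>\<omega>. g (the (traj X (ennreal s) \<omega>))) \<in> borel_measurable (?R s)"
      using measurable_compose[OF pos_measurable g] .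
    have "(\<integral>\<^sup>+z. g z \<partial>?\<rho> s) = (\<integral>\<^sup>+\<omega>. g (the (traj X (ennreal s) \<omega>)) \<partial>density (?R s) (indicator A))"
      using g by (subst nn_integral_distr[OF 1]) simp_all
    also have "\<dots> = (\<integral>\<^sup>+\<omega>. indicator A \<omega> * g (the (traj X (ennreal s) \<omega>)) \<partial>?R s)"
      by (rule nn_integral_density[OF 2 3])
    also have "\<dots> = (\<integral>\<^sup>+\<omega>. lift_fn X g s \<omega> * indicator A \<omega> \<partial>law X y)"
      by (subst nn_integral_restrict_space[OF alive_sets])
        (auto simp: lift_fn_def indicator_def split: option.split intro!: nn_integral_cong)
    finally show ?thesis .
  qed
  have K: "kern X u \<in> ?\<rho> s \<rightarrow>\<^sub>M subprob_algebra borel"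
    using kern_measurable by simp
  have "?\<rho> (s + u) = ?\<rho> s \<bind> kern X u"
  proof (rule measure_eqI)
    show "sets (?\<rho> (s + u)) = sets (?\<rho> s \<bind> kern X u)"
      by (subst sets_bind[where N=borel]) auto
    fix B assume "B \<in> sets (?\<rho> (s + u))"
    then have B: "B \<in> sets borel" by simp
    then have em: "(\<lambda>z. emeasure (kern X u z) B) \<in> borel_measurable borel"
      using rp by (simp add: borel_right_process_def)
    have "emeasure (?\<rho> (s + u)) B = (\<integral>\<^sup>+z. indicator B z \<partial>?\<rho> (s + u))"
      using B by (subst nn_integral_indicator) auto
    also have "\<dots> = (\<integral>\<^sup>+\<omega>. lift_fn X (indicator B) (s + u) \<omega> * indicator A \<omega> \<partial>law X y)"
      using B by (intro \<rho>) auto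
    also have "\<dots> = (\<integral>\<^sup>+\<omega>. indicator {\<omega>\<in>A. visits X B (s + u) \<omega>} \<omega> \<partial>law X y)"
      by (intro nn_integral_cong) (auto simp: lift_fn_indicator indicator_def)
    also have "\<dots> = emeasure (law X y) {\<omega>\<in>A. visits X B (s + u) \<omega>}"
    proof (rule nn_integral_indicator)
      have "{\<omega>\<in>A. visits X B (s + u) \<omega>} = A \<inter> {\<omega>\<in>\<Omega>. visits X B (s + u) \<omega>}"
        using sets.sets_into_space[OF A] by auto
      then show "{\<omega>\<in>A. visits X B (s + u) \<omega>} \<in> sets (law X y)"
        using A' visits_events[OF B, of "s + u"] by auto
    qed
    also have "\<dots> = (\<integral>\<^sup>+\<omega>. lift_fn X (\<lambda>z. emeasure (kern X u z) B) s \<omega> * indicator A \<omega> \<partial>law X y)"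
      by (rule markov_set[OF A B st])
    also have "\<dots> = (\<integral>\<^sup>+z. emeasure (kern X u z) B \<partial>?\<rho> s)"
      by (rule \<rho>[symmetric, OF em])
    also have "\<dots> = emeasure (?\<rho> s \<bind> kern X u) B"
      by (rule emeasure_bind[symmetric, OF _ K B]) simp
    finally show "emeasure (?\<rho> (s + u)) B = emeasure (?\<rho> s \<bind> kern X u) B" .
  qed
  then have "(\<integral>\<^sup>+z. g z \<partial>?\<rho> (s + u)) = (\<integral>\<^sup>+z. \<integral>\<^sup>+w. g w \<partial>kern X u z \<partial>?\<rho> s)"
    using nn_integral_bind[OF g K] by simp
  then show ?thesis
    by (subst (asm) (1 2) \<rho>) (use g nn_integral_kern_measurable[OF g] in auto)
qed

end

text \<open>The list contains time increments, so that the one-step kernel can be iterated along it.\<close>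

fun cyl :: "('w, 'e) process \<Rightarrow> (real \<times> 'e set) list \<Rightarrow> real \<Rightarrow> 'w \<Rightarrow> bool" where
  "cyl X [] s \<omega> \<longleftrightarrow> True"
| "cyl X ((u, B) # l) s \<omega> \<longleftrightarrow> visits X B (s + u) \<omega> \<and> cyl X l (s + u) \<omega>"

fun cyl_prob :: "('w, 'e::topological_space) process \<Rightarrow> (real \<times> 'e set) list \<Rightarrow> 'e \<Rightarrow> ennreal" where
  "cyl_prob X [] y = 1"
| "cyl_prob X ((u, B) # l) y = (\<integral>\<^sup>+z. indicator B z * cyl_prob X l z \<partial>kern X u y)"

definition cyl_ok :: "(real \<times> 'e::topological_space set) list \<Rightarrow> bool" where
  "cyl_ok l \<longleftrightarrow> (\<forall>(u, B)\<in>set l. 0 \<le> u \<and> B \<in> sets borel)"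

lemma cyl_ok_simps [simp]: "cyl_ok []" "cyl_ok ((u, B) # l) \<longleftrightarrow> 0 \<le> u \<and> B \<in> sets borel \<and> cyl_ok l"
  by (auto simp: cyl_ok_def)

context right_process
begin

lemma cyl_prob_measurable: "cyl_ok l \<Longrightarrow> cyl_prob X l \<in> borel_measurable borel"
proof (induction l)
  case (Cons p l)
  obtain u B where p: "p = (u, B)" by force
  have "(\<lambda>z. indicator B z * cyl_prob X l z) \<in> borel_measurable borel"
    using Cons by (auto simp: p)
  then show ?case
    unfolding p cyl_prob.simps by (rule nn_integral_kern_measurable)
next
  case Nil
  have "cyl_prob X [] = (\<lambda>_. 1)" by auto
  then show ?case by simp
qed

text \<open>In the induction the first visit is absorbed into \<open>A\<close>, which is then known
  at time \<open>s + u\<close>; this is why \<open>A\<close> is arbitrary. \<open>markov_fn\<close>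
  carries the integral back to time \<open>s\<close>. The conjunct \<open>alive X s\<close> matters
  for the empty list, since \<open>lift_fn\<close> vanishes on dead paths.\<close>

lemma emeasure_cyl:
  assumes "cyl_ok l" "A \<in> sets (filt X (ennreal s))" "0 \<le> s"
  shows "emeasure (law X y) {\<omega>\<in>A. alive X s \<omega> \<and> cyl X l s \<omega>}
    = (\<integral>\<^sup>+\<omega>. lift_fn X (cyl_prob X l) s \<omega> * indicator A \<omega> \<partial>law X y)"
  using assms
proof (induction l arbitrary: s A)
  case Nil
  have A: "A \<subseteq> \<Omega>" "A \<in> sets (events X)"
    using sets.sets_into_space[OF Nil(2)] filt_events Nil(2) by auto
  have "{\<omega>\<in>A. alive X s \<omega>} = A \<inter> {\<omega>\<in>\<Omega>. alive X s \<omega>}" using A by auto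
  then have "{\<omega>\<in>A. alive X s \<omega>} \<in> sets (law X y)"
    using A(2) alive_events by simp
  then have "emeasure (law X y) {\<omega>\<in>A. alive X s \<omega>} = (\<integral>\<^sup>+\<omega>. indicator {\<omega>\<in>A. alive X s \<omega>} \<omega> \<partial>law X y)"
    by simp
  also have "\<dots> = (\<integral>\<^sup>+\<omega>. lift_fn X (cyl_prob X []) s \<omega> * indicator A \<omega> \<partial>law X y)"
    by (intro nn_integral_cong) (auto simp: lift_fn_def visits_def indicator_def split: option.split)
  finally show ?case by (simp only: cyl.simps simp_thms)
next
  case (Cons p l)
  obtain u B where p: "p = (u, B)" by force
  have u: "0 \<le> u" and B: "B \<in> sets borel" and l: "cyl_ok l" using Cons.prems(1) by (auto simp: p)
  have A: "A \<subseteq> \<Omega>" using sets.sets_into_space[OF Cons.prems(2)] by simp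
  define A' where "A' = A \<inter> {\<omega>\<in>\<Omega>. visits X B (s + u) \<omega>}"
  have A': "A' \<in> sets (filt X (ennreal (s + u)))"
    unfolding A'_def using Cons.prems(2,3) u B filt_mono[of "ennreal s" "ennreal (s + u)"]
    by (intro sets.Int visits_filt) (auto simp: ennreal_leI)
  have "{\<omega>\<in>A. alive X s \<omega> \<and> cyl X (p # l) s \<omega>} = {\<omega>\<in>A'. alive X (s + u) \<omega> \<and> cyl X l (s + u) \<omega>}"
    using A u dies[of _ "s + u" s] visits_mono[of X B "s + u" _ UNIV] by (auto simp: A'_def p)
  then have "emeasure (law X y) {\<omega>\<in>A. alive X s \<omega> \<and> cyl X (p # l) s \<omega>}
    = (\<integral>\<^sup>+\<omega>. lift_fn X (cyl_prob X l) (s + u) \<omega> * indicator A' \<omega> \<partial>law X y)"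
    using Cons.IH[OF l A'] Cons.prems(3) u by simp
  also have "\<dots> = (\<integral>\<^sup>+\<omega>. lift_fn X (\<lambda>z. indicator B z * cyl_prob X l z) (s + u) \<omega> * indicator A \<omega> \<partial>law X y)"
    using A by (intro nn_integral_cong)
      (auto simp: lift_fn_mult lift_fn_indicator A'_def split: split_indicator)
  also have "\<dots> = (\<integral>\<^sup>+\<omega>. lift_fn X (\<lambda>z. \<integral>\<^sup>+w. indicator B w * cyl_prob X l w \<partial>kern X u z) s \<omega> * indicator A \<omega> \<partial>law X y)"
    using Cons.prems u B cyl_prob_measurable[OF l] by (intro markov_fn) auto
  finally show ?case by (simp add: p)
qed

lemma cyl_shift: "\<omega> \<in> \<Omega> \<Longrightarrow> 0 \<le> s \<Longrightarrow> 0 \<le> t \<Longrightarrow> cyl_ok l \<Longrightarrow> cyl X l t (shift s \<omega>) \<longleftrightarrow> cyl X l (s + t) \<omega>"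
proof (induction l arbitrary: t)
  case (Cons p l)
  then show ?case by (cases p) (auto simp: visits_shift add.assoc)
qed simp

lemma start: "AE \<omega> in law X y. visits X {y} 0 \<omega>"
  using rp by (simp add: borel_right_process_def visits_singleton)

lemma emeasure_cyl_0:
  assumes "cyl_ok l"
  shows "emeasure (law X y) {\<omega>\<in>\<Omega>. cyl X l 0 \<omega>} = cyl_prob X l y"
proof -
  have sets: "{\<omega>\<in>\<Omega>. cyl X l s \<omega>} \<in> sets (events X)" if "cyl_ok l" for s l
    using that
  proof (induction l arbitrary: s)
    case (Cons p l)
    obtain u B where p: "p = (u, B)" by force
    have "{\<omega>\<in>\<Omega>. cyl X (p # l) s \<omega>} = {\<omega>\<in>\<Omega>. visits X B (s + u) \<omega>} \<inter> {\<omega>\<in>\<Omega>. cyl X l (s + u) \<omega>}"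
      by (auto simp: p)
    then show ?case using Cons visits_events by (auto simp: p)
  qed simp
  have al: "AE \<omega> in law X y. alive X 0 \<omega>"
    using start[of y] by (auto elim!: eventually_mono intro: visits_mono)
  have "emeasure (law X y) {\<omega>\<in>\<Omega>. cyl X l 0 \<omega>} = emeasure (law X y) {\<omega>\<in>\<Omega>. alive X 0 \<omega> \<and> cyl X l 0 \<omega>}"
  proof (rule emeasure_eq_AE)
    have "{\<omega>\<in>\<Omega>. alive X 0 \<omega> \<and> cyl X l 0 \<omega>} = {\<omega>\<in>\<Omega>. alive X 0 \<omega>} \<inter> {\<omega>\<in>\<Omega>. cyl X l 0 \<omega>}" by auto
    then show "{\<omega>\<in>\<Omega>. alive X 0 \<omega> \<and> cyl X l 0 \<omega>} \<in> sets (law X y)"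
      using sets[OF assms, of 0] alive_events[of 0] by simp
  qed (use sets[OF assms, of 0] al in auto)
  also have "\<dots> = (\<integral>\<^sup>+\<omega>. lift_fn X (cyl_prob X l) 0 \<omega> * indicator \<Omega> \<omega> \<partial>law X y)"
    using assms sets.top[of "filt X (ennreal 0)"] by (intro emeasure_cyl) auto
  also have "\<dots> = (\<integral>\<^sup>+\<omega>. cyl_prob X l y \<partial>law X y)"
    using start[of y] by (intro nn_integral_cong_AE) (auto simp: lift_fn_def visits_singleton)
  also have "\<dots> = cyl_prob X l y"
    using prob_space_law by (simp add: prob_space.emeasure_space_1 space_law[symmetric] del: space_law)
  finally show ?thesis .
qed

text \<open>Induction on the sorted times: the least one becomes the base point for the rest, and
  its distance from the old base point is the increment.\<close>

lemma cylinder_increments: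
  assumes "finite J" "J \<subseteq> {a..}" "\<And>t. B t \<in> sets borel"
  shows "\<exists>l. cyl_ok l \<and> (\<forall>s \<omega>. (\<forall>t\<in>J. visits X (B t) (s + t) \<omega>) \<longleftrightarrow> cyl X l (s + a) \<omega>)"
  using assms(1,2)
proof (induction J arbitrary: a rule: finite_linorder_min_induct)
  case empty
  show ?case by (rule exI[of _ "[]"]) simp
next
  case (insert b J)
  have "J \<subseteq> {b..}" using insert.hyps by auto
  then obtain l where l: "cyl_ok l" "\<And>s \<omega>. (\<forall>t\<in>J. visits X (B t) (s + t) \<omega>) \<longleftrightarrow> cyl X l (s + b) \<omega>"
    using insert.IH by blast
  have "cyl_ok ((b - a, B b) # l)"
    using insert.prems l(1) assms(3) by auto
  moreover have "(\<forall>t\<in>insert b J. visits X (B t) (s + t) \<omega>) \<longleftrightarrow> cyl X ((b - a, B b) # l) (s + a) \<omega>" for s \<omega>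
    by (simp add: l(2))
  ultimately show ?case by blast
qed

section \<open>From cylinders to the sigma-algebra generated by the coordinates\<close>

definition cylinders :: "'w set set" where
  "cylinders = {{\<omega>\<in>\<Omega>. \<forall>t\<in>J. visits X (B t) t \<omega>} |J B. finite J \<and> J \<subseteq> {0..} \<and> (\<forall>t. B t \<in> sets borel)}"

lemma sets_path_events: "sets (path_events X) = sigma_sets \<Omega> cylinders"
proof
  show "sets (path_events X) \<subseteq> sigma_sets \<Omega> cylinders"
    unfolding path_events_def
  proof (subst sets_measure_of, blast, rule sigma_sets_mono, rule subsetI)
    fix C assume "C \<in> {{\<omega>\<in>\<Omega>. visits X A s \<omega>} |A s. A \<in> sets borel \<and> 0 \<le> s}"
    then obtain A s where "C = {\<omega>\<in>\<Omega>. visits X A s \<omega>}" "A \<in> sets borel" "0 \<le> s" by auto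
    then have "C \<in> cylinders"
      unfolding cylinders_def by (auto intro!: exI[of _ "{s}"] exI[of _ "\<lambda>_. A"])
    then show "C \<in> sigma_sets \<Omega> cylinders" by auto
  qed
  have "cylinders \<subseteq> sets (path_events X)"
  proof
    fix C assume "C \<in> cylinders"
    then obtain J B where C: "C = {\<omega>\<in>\<Omega>. \<forall>t\<in>J. visits X (B t) t \<omega>}" "finite J" "J \<subseteq> {0..}"
      "\<And>t. B t \<in> sets borel"
      unfolding cylinders_def by auto
    have "C = \<Omega> \<inter> (\<Inter>t\<in>J. {\<omega>\<in>\<Omega>. visits X (B t) t \<omega>})" using C(1) by auto
    also have "\<dots> \<in> sets (path_events X)"
      using C(2-4) visits_path_events[of _ _ X] sets.top[of "path_events X"] space_path_events[of X]
      by (cases "J = {}") (auto intro!: sets.Int sets.finite_INT)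
    finally show "C \<in> sets (path_events X)" .
  qed
  then show "sigma_sets \<Omega> cylinders \<subseteq> sets (path_events X)"
    using sets.sigma_sets_subset[of cylinders "path_events X"] by (simp add: space_path_events)
qed

lemma Int_stable_cylinders: "Int_stable cylinders"
proof (rule Int_stableI)
  fix C C' assume "C \<in> cylinders" "C' \<in> cylinders"
  then obtain J B J' B' where C: "C = {\<omega>\<in>\<Omega>. \<forall>t\<in>J. visits X (B t) t \<omega>}" "finite J" "J \<subseteq> {0..}"
      "\<And>t. B t \<in> sets borel" and C': "C' = {\<omega>\<in>\<Omega>. \<forall>t\<in>J'. visits X (B' t) t \<omega>}" "finite J'" "J' \<subseteq> {0..}"
      "\<And>t. B' t \<in> sets borel"
    unfolding cylinders_def by auto
  let ?B = "\<lambda>t. (if t \<in> J then B t else UNIV) \<inter> (if t \<in> J' then B' t else UNIV)"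
  have "C \<inter> C' = {\<omega>\<in>\<Omega>. \<forall>t\<in>J \<union> J'. visits X (?B t) t \<omega>}"
    unfolding C C' by (auto simp: visits_Int split: if_splits intro: visits_mono)
  moreover have "?B t \<in> sets borel" for t using C(4) C'(4) by auto
  ultimately show "C \<inter> C' \<in> cylinders"
    unfolding cylinders_def using C(2,3) C'(2,3)
    by (intro CollectI exI[of _ "J \<union> J'"] exI[of _ ?B]) auto
qed

lemma shift_vimage_events:
  assumes "\<Gamma> \<in> sets (path_events X)" "0 \<le> s"
  shows "{\<omega>\<in>\<Omega>. alive X s \<omega> \<and> shift s \<omega> \<in> \<Gamma>} \<in> sets (path_events X)"
proof -
  have "{\<omega>\<in>\<Omega>. alive X s \<omega> \<and> shift s \<omega> \<in> \<Gamma>} = {\<omega>\<in>\<Omega>. alive X s \<omega>} \<inter> (shift s -` \<Gamma> \<inter> space (path_events X))"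
    by (auto simp: space_path_events)
  then show ?thesis
    using measurable_sets[OF shift_measurable[OF assms(2)] assms(1)] visits_path_events[of UNIV s X] assms(2) by auto
qed

text \<open>Dynkin's argument from cylinders. Measurability and the Markov identity are proved
  together because the integrals in the complement and union steps need the former. Complements are
  taken within the paths alive at time \<open>s\<close>, as \<open>kern X s y\<close> may have mass
  below 1.\<close>

lemma markov_path_aux:
  assumes "\<Gamma> \<in> sets (path_events X)"
  shows "(\<lambda>y. emeasure (law X y) \<Gamma>) \<in> borel_measurable borel \<and>
    (\<forall>y. \<forall>s\<ge>0. emeasure (law X y) {\<omega>\<in>\<Omega>. alive X s \<omega> \<and> shift s \<omega> \<in> \<Gamma>}
      = (\<integral>\<^sup>+z. emeasure (law X z) \<Gamma> \<partial>kern X s y))"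
proof -
  have ev: "\<Gamma> \<in> sets (events X)" if "\<Gamma> \<in> sigma_sets \<Omega> cylinders" for \<Gamma>
    using that path_events_sub by (auto simp: sets_path_events)
  have sh: "{\<omega>\<in>\<Omega>. alive X s \<omega> \<and> shift s \<omega> \<in> \<Gamma>} \<in> sets (events X)" if "\<Gamma> \<in> sigma_sets \<Omega> cylinders" "0 \<le> s" for \<Gamma> s
    using shift_vimage_events[of \<Gamma> s] that path_events_sub by (auto simp: sets_path_events)
  have sub: "cylinders \<subseteq> Pow \<Omega>" by (auto simp: cylinders_def)
  have "\<Gamma> \<in> sigma_sets \<Omega> cylinders" using assms by (simp add: sets_path_events)
  with Int_stable_cylinders sub show ?thesis
  proof (induction rule: sigma_sets_induct_disjoint)
    case (basic C)
    then obtain J B where C: "C = {\<omega>\<in>\<Omega>. \<forall>t\<in>J. visits X (B t) t \<omega>}" "finite J" "J \<subseteq> {0..}"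
      "\<And>t. B t \<in> sets borel"
      unfolding cylinders_def by auto
    obtain l where l: "cyl_ok l" "\<And>s \<omega>. (\<forall>t\<in>J. visits X (B t) (s + t) \<omega>) \<longleftrightarrow> cyl X l (s + 0) \<omega>"
      using cylinder_increments[OF C(2,3), of B] C(4) by metis
    have C_eq: "C = {\<omega>\<in>\<Omega>. cyl X l 0 \<omega>}"
      using l(2)[of 0] by (simp add: C(1))
    have law_C: "emeasure (law X y) C = cyl_prob X l y" for y
      unfolding C_eq by (rule emeasure_cyl_0[OF l(1)])
    have "emeasure (law X y) {\<omega>\<in>\<Omega>. alive X s \<omega> \<and> shift s \<omega> \<in> C} = (\<integral>\<^sup>+z. emeasure (law X z) C \<partial>kern X s y)"
      if s: "0 \<le> s" for s y
    proof -
      have "{\<omega>\<in>\<Omega>. alive X s \<omega> \<and> shift s \<omega> \<in> C} = {\<omega>\<in>\<Omega>. alive X s \<omega> \<and> cyl X l s \<omega>}"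
        using cyl_shift[OF _ s order_refl l(1)] shift_space by (auto simp: C_eq)
      then have "emeasure (law X y) {\<omega>\<in>\<Omega>. alive X s \<omega> \<and> shift s \<omega> \<in> C}
          = (\<integral>\<^sup>+\<omega>. lift_fn X (cyl_prob X l) s \<omega> * indicator \<Omega> \<omega> \<partial>law X y)"
        using emeasure_cyl[OF l(1) _ s, of \<Omega>] sets.top[of "filt X (ennreal s)"] by simp
      also have "\<dots> = (\<integral>\<^sup>+\<omega>. lift_fn X (cyl_prob X l) s \<omega> \<partial>law X y)"
        by (intro nn_integral_cong) simp
      also have "\<dots> = (\<integral>\<^sup>+z. cyl_prob X l z \<partial>kern X s y)"
        by (rule nn_integral_kern[symmetric, OF cyl_prob_measurable[OF l(1)]])
      finally show ?thesis by (simp add: law_C)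
    qed
    then show ?case
      using cyl_prob_measurable[OF l(1)] by (auto simp: law_C[abs_def])
  next
    case empty
    then show ?case by simp
  next
    case (compl \<Gamma>)
    have fin: "emeasure (law X y) A \<noteq> \<infinity>" for y A
      using prob_space_law[of y] by (simp add: finite_measure.emeasure_finite prob_space_def)
    have eq: "emeasure (law X y) (\<Omega> - \<Gamma>) = 1 - emeasure (law X y) \<Gamma>" for y
      using emeasure_compl[of \<Gamma> "law X y"] ev[OF compl(1)] fin prob_space.emeasure_space_1[OF prob_space_law[of y]] by simp
    have "emeasure (law X y) {\<omega>\<in>\<Omega>. alive X s \<omega> \<and> shift s \<omega> \<in> \<Omega> - \<Gamma>}
        = (\<integral>\<^sup>+z. emeasure (law X z) (\<Omega> - \<Gamma>) \<partial>kern X s y)" if s: "0 \<le> s" for s y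
    proof -
      interpret K: subprob_space "kern X s y" by (rule subprob_kern)
      have "{\<omega>\<in>\<Omega>. alive X s \<omega> \<and> shift s \<omega> \<in> \<Omega> - \<Gamma>} = {\<omega>\<in>\<Omega>. alive X s \<omega>} - {\<omega>\<in>\<Omega>. alive X s \<omega> \<and> shift s \<omega> \<in> \<Gamma>}"
        using shift_space by auto
      then have "emeasure (law X y) {\<omega>\<in>\<Omega>. alive X s \<omega> \<and> shift s \<omega> \<in> \<Omega> - \<Gamma>}
        = emeasure (law X y) {\<omega>\<in>\<Omega>. alive X s \<omega>} - emeasure (law X y) {\<omega>\<in>\<Omega>. alive X s \<omega> \<and> shift s \<omega> \<in> \<Gamma>}"
        using fin alive_events sh[OF compl(1) s] by (subst emeasure_Diff[symmetric]) auto
      also have "\<dots> = (\<integral>\<^sup>+z. 1 \<partial>kern X s y) - (\<integral>\<^sup>+z. emeasure (law X z) \<Gamma> \<partial>kern X s y)"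
        using compl(2) s by (simp add: emeasure_kern)
      also have "\<dots> = (\<integral>\<^sup>+z. 1 - emeasure (law X z) \<Gamma> \<partial>kern X s y)"
      proof (rule nn_integral_diff[symmetric])
        show "(\<lambda>z. emeasure (law X z) \<Gamma>) \<in> borel_measurable (kern X s y)"
          using compl(2) by (simp cong: measurable_cong_sets)
        have le: "emeasure (law X z) \<Gamma> \<le> 1" for z
          using emeasure_space[of "law X z" \<Gamma>] prob_space.emeasure_space_1[OF prob_space_law[of z]] by simp
        then show "AE z in kern X s y. emeasure (law X z) \<Gamma> \<le> 1" by simp
        have "(\<integral>\<^sup>+z. emeasure (law X z) \<Gamma> \<partial>kern X s y) \<le> (\<integral>\<^sup>+z. 1 \<partial>kern X s y)"
          using le by (intro nn_integral_mono) simp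
        then show "(\<integral>\<^sup>+z. emeasure (law X z) \<Gamma> \<partial>kern X s y) \<noteq> \<infinity>"
          using K.emeasure_finite[of UNIV] by (auto simp: top_unique)
      qed simp
      finally show ?thesis by (simp only: eq)
    qed
    moreover have "(\<lambda>y. 1 - emeasure (law X y) \<Gamma>) \<in> borel_measurable borel"
      using compl(2) by (intro borel_measurable_minus_ennreal) auto
    ultimately show ?case unfolding eq[symmetric] by blast
  next
    case (union \<Gamma>)
    have 1: "emeasure (law X y) (\<Union>i. \<Gamma> i) = (\<Sum>i. emeasure (law X y) (\<Gamma> i))" for y
      using union(1,2) ev by (intro suminf_emeasure[symmetric]) auto
    have "emeasure (law X y) {\<omega>\<in>\<Omega>. alive X s \<omega> \<and> shift s \<omega> \<in> (\<Union>i. \<Gamma> i)}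
        = (\<integral>\<^sup>+z. emeasure (law X z) (\<Union>i. \<Gamma> i) \<partial>kern X s y)" if s: "0 \<le> s" for s y
    proof -
      have "{\<omega>\<in>\<Omega>. alive X s \<omega> \<and> shift s \<omega> \<in> (\<Union>i. \<Gamma> i)} = (\<Union>i. {\<omega>\<in>\<Omega>. alive X s \<omega> \<and> shift s \<omega> \<in> \<Gamma> i})"
        by auto
      moreover have "disjoint_family (\<lambda>i. {\<omega>\<in>\<Omega>. alive X s \<omega> \<and> shift s \<omega> \<in> \<Gamma> i})"
        using union(1) unfolding disjoint_family_on_def by blast
      ultimately have "emeasure (law X y) {\<omega>\<in>\<Omega>. alive X s \<omega> \<and> shift s \<omega> \<in> (\<Union>i. \<Gamma> i)}
        = (\<Sum>i. emeasure (law X y) {\<omega>\<in>\<Omega>. alive X s \<omega> \<and> shift s \<omega> \<in> \<Gamma> i})"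
        using sh union(2) s by (simp add: suminf_emeasure[symmetric] image_subset_iff)
      also have "\<dots> = (\<Sum>i. \<integral>\<^sup>+z. emeasure (law X z) (\<Gamma> i) \<partial>kern X s y)"
        using union(3) s by simp
      also have "\<dots> = (\<integral>\<^sup>+z. (\<Sum>i. emeasure (law X z) (\<Gamma> i)) \<partial>kern X s y)"
        using union(3) by (intro nn_integral_suminf[symmetric]) (simp cong: measurable_cong_sets)
      finally show ?thesis by (simp only: 1)
    qed
    moreover have "(\<lambda>y. \<Sum>i. emeasure (law X y) (\<Gamma> i)) \<in> borel_measurable borel"
    proof -
      have [measurable]: "(\<lambda>y. emeasure (law X y) (\<Gamma> i)) \<in> borel_measurable borel" for i
        using union(3) by blast
      show ?thesis by measurable
    qed
    ultimately show ?case unfolding 1[symmetric] by blast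
  qed
qed

lemmas law_path_measurable = markov_path_aux[THEN conjunct1]
  and markov_path = markov_path_aux[THEN conjunct2, rule_format]

text \<open>Restricted to \<open>path_events X\<close> the law becomes a Borel kernel, so it can be
  composed with \<open>kern X s y\<close> and with initial distributions by \<open>bind\<close>
  without a completion.\<close>

definition path_law :: "'e \<Rightarrow> 'w measure" where
  "path_law y = distr (law X y) (path_events X) (\<lambda>\<omega>. \<omega>)"

lemma id_path_measurable: "(\<lambda>\<omega>. \<omega>) \<in> law X y \<rightarrow>\<^sub>M path_events X"
  using path_events_sub sets.sets_into_space
  by (intro measurableI) (auto simp: space_path_events)

lemma sets_path_law [simp]: "sets (path_law y) = sets (path_events X)"
  and space_path_law [simp]: "space (path_law y) = \<Omega>"
  by (simp_all add: path_law_def space_path_events)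

lemma emeasure_path_law: "\<Gamma> \<in> sets (path_events X) \<Longrightarrow> emeasure (path_law y) \<Gamma> = emeasure (law X y) \<Gamma>"
  using sets.sets_into_space[of \<Gamma> "path_events X"] space_path_events[of X]
  by (simp add: path_law_def emeasure_distr[OF id_path_measurable] Int_absorb2)

lemma prob_space_path_law: "prob_space (path_law y)"
  unfolding path_law_def by (rule prob_space.prob_space_distr[OF prob_space_law id_path_measurable])

lemma path_law_measurable: "path_law \<in> borel \<rightarrow>\<^sub>M prob_algebra (path_events X)"
proof (rule measurable_prob_algebraI[OF prob_space_path_law], rule measurable_subprob_algebra)
  show "subprob_space (path_law a)" for a
    by (rule prob_space_imp_subprob_space[OF prob_space_path_law])
qed (simp_all add: emeasure_path_law law_path_measurable)

lemma nn_integral_path_law: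
  "\<Phi> \<in> borel_measurable (path_events X) \<Longrightarrow> (\<integral>\<^sup>+\<omega>. \<Phi> \<omega> \<partial>path_law y) = (\<integral>\<^sup>+\<omega>. \<Phi> \<omega> \<partial>law X y)"
  unfolding path_law_def by (subst nn_integral_distr[OF id_path_measurable]) auto

lemma nn_integral_path_law_measurable:
  "\<Phi> \<in> borel_measurable (path_events X) \<Longrightarrow> (\<lambda>y. \<integral>\<^sup>+\<omega>. \<Phi> \<omega> \<partial>path_law y) \<in> borel_measurable borel"
  by (intro nn_integral_measurable_subprob_algebra2[OF _ measurable_prob_algebraD[OF path_law_measurable]]) simp

text \<open>The image under the shift of the part of \<open>path_law y\<close> alive at
  \<open>s\<close> and the measure \<open>kern X s y \<bind> path_law\<close> agree on events by
  \<open>markov_path\<close>, hence integrate \<Phi> alike.\<close>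

theorem markov_functional:
  assumes \<Phi>: "\<Phi> \<in> borel_measurable (path_events X)" and s: "0 \<le> s"
  shows "(\<integral>\<^sup>+\<omega>. \<Phi> (shift s \<omega>) * indicator {\<omega>. alive X s \<omega>} \<omega> \<partial>path_law y)
    = (\<integral>\<^sup>+z. (\<integral>\<^sup>+\<omega>. \<Phi> \<omega> \<partial>path_law z) \<partial>kern X s y)"
proof -
  have al: "{\<omega>\<in>\<Omega>. alive X s \<omega>} \<in> sets (path_events X)"
    using s by (intro visits_path_events) auto
  let ?D = "density (path_law y) (indicator {\<omega>\<in>\<Omega>. alive X s \<omega>})"
  have ind: "indicator {\<omega>\<in>\<Omega>. alive X s \<omega>} \<in> borel_measurable (path_law y)"
    by (rule borel_measurable_indicator) (simp add: al)
  have sh: "shift s \<in> ?D \<rightarrow>\<^sub>M path_events X"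
    using shift_measurable[OF s] by (simp cong: measurable_cong_sets)
  have shy: "shift s \<in> path_law y \<rightarrow>\<^sub>M path_events X"
    using shift_measurable[OF s] by (simp cong: measurable_cong_sets)
  have K: "path_law \<in> kern X s y \<rightarrow>\<^sub>M subprob_algebra (path_events X)"
    using measurable_prob_algebraD[OF path_law_measurable] by (simp cong: measurable_cong_sets)
  have "distr ?D (path_events X) (shift s) = kern X s y \<bind> path_law"
  proof (rule measure_eqI)
    show "sets (distr ?D (path_events X) (shift s)) = sets (kern X s y \<bind> path_law)"
      by (subst sets_bind[where N="path_events X"]) auto
    fix \<Gamma> assume "\<Gamma> \<in> sets (distr ?D (path_events X) (shift s))"
    then have \<Gamma>: "\<Gamma> \<in> sets (path_events X)" by simp
    have v: "shift s -` \<Gamma> \<inter> \<Omega> \<in> sets (path_law y)"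
      using measurable_sets[OF shift_measurable[OF s] \<Gamma>] by (simp add: space_path_events)
    have "emeasure (distr ?D (path_events X) (shift s)) \<Gamma> = emeasure ?D (shift s -` \<Gamma> \<inter> \<Omega>)"
      by (subst emeasure_distr[OF sh \<Gamma>]) simp
    also have "\<dots> = (\<integral>\<^sup>+\<omega>. indicator {\<omega>\<in>\<Omega>. alive X s \<omega>} \<omega> * indicator (shift s -` \<Gamma> \<inter> \<Omega>) \<omega> \<partial>path_law y)"
      by (rule emeasure_density[OF ind v])
    also have "\<dots> = (\<integral>\<^sup>+\<omega>. indicator {\<omega>\<in>\<Omega>. alive X s \<omega> \<and> shift s \<omega> \<in> \<Gamma>} \<omega> \<partial>path_law y)"
      by (intro nn_integral_cong) (auto simp: indicator_def)
    also have "\<dots> = emeasure (law X y) {\<omega>\<in>\<Omega>. alive X s \<omega> \<and> shift s \<omega> \<in> \<Gamma>}"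
      using shift_vimage_events[OF \<Gamma> s] by (simp add: emeasure_path_law)
    also have "\<dots> = emeasure (kern X s y \<bind> path_law) \<Gamma>"
      using markov_path[OF \<Gamma> s] by (subst emeasure_bind[OF _ K \<Gamma>]) (simp_all add: emeasure_path_law \<Gamma>)
    finally show "emeasure (distr ?D (path_events X) (shift s)) \<Gamma> = emeasure (kern X s y \<bind> path_law) \<Gamma>" .
  qed
  then have "(\<integral>\<^sup>+\<omega>. \<Phi> \<omega> \<partial>distr ?D (path_events X) (shift s)) = (\<integral>\<^sup>+z. (\<integral>\<^sup>+\<omega>. \<Phi> \<omega> \<partial>path_law z) \<partial>kern X s y)"
    using nn_integral_bind[OF \<Phi> K] by simp
  moreover have "(\<integral>\<^sup>+\<omega>. \<Phi> \<omega> \<partial>distr ?D (path_events X) (shift s))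
    = (\<integral>\<^sup>+\<omega>. \<Phi> (shift s \<omega>) * indicator {\<omega>. alive X s \<omega>} \<omega> \<partial>path_law y)"
  proof -
    have "(\<integral>\<^sup>+\<omega>. \<Phi> \<omega> \<partial>distr ?D (path_events X) (shift s)) = (\<integral>\<^sup>+\<omega>. \<Phi> (shift s \<omega>) \<partial>?D)"
      using \<Phi> by (intro nn_integral_distr[OF sh]) simp
    also have "\<dots> = (\<integral>\<^sup>+\<omega>. indicator {\<omega>\<in>\<Omega>. alive X s \<omega>} \<omega> * \<Phi> (shift s \<omega>) \<partial>path_law y)"
      by (rule nn_integral_density[OF ind measurable_compose[OF shy \<Phi>]])
    also have "\<dots> = (\<integral>\<^sup>+\<omega>. \<Phi> (shift s \<omega>) * indicator {\<omega>. alive X s \<omega>} \<omega> \<partial>path_law y)"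
      by (intro nn_integral_cong) (auto simp: indicator_def)
    finally show ?thesis .
  qed
  ultimately show ?thesis by simp
qed

section \<open>Hitting events\<close>

text \<open>Open sets of states remain open in the one-point compactification, so the convergence
  built into \<open>borel_right_process\<close> applies. Times are real here, hence the case
  distinction for an infinite bound.\<close>

lemma right_continuous:
  assumes w: "\<omega> \<in> \<Omega>" and t: "0 \<le> t" and U: "open U" "visits X U t \<omega>"
  shows "\<exists>b>t. \<forall>s. t < s \<longrightarrow> s < b \<longrightarrow> visits X U s \<omega>"
proof -
  have "\<forall>t<\<infinity>. limitin (Alexandroff_compactification euclidean) (\<lambda>s. traj X s \<omega>) (traj X t \<omega>) (at_right t)"
    using rp w by (simp add: borel_right_process_def)
  then have "limitin (Alexandroff_compactification euclidean) (\<lambda>s. traj X s \<omega>) (traj X (ennreal t) \<omega>) (at_right (ennreal t))"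
    by simp
  then have ev: "\<forall>\<^sub>F s in at_right (ennreal t). traj X s \<omega> \<in> Some ` U"
    using U by (simp add: limitin_def visits_def)
  have lt: "ennreal t < \<infinity>" by simp
  obtain b where b: "b > ennreal t" "\<And>s. ennreal t < s \<Longrightarrow> s < b \<Longrightarrow> traj X s \<omega> \<in> Some ` U"
    using ev unfolding eventually_at_right[OF lt] by auto
  show ?thesis
  proof (cases "b = \<infinity>")
    case True
    show ?thesis
      by (rule exI[of _ "t + 1"]) (use b True t in \<open>auto simp: visits_def ennreal_less_iff\<close>)
  next
    case False
    then obtain b' where b': "b = ennreal b'" "0 \<le> b'" by (cases b) auto
    show ?thesis
      by (rule exI[of _ b']) (use b b' t in \<open>auto simp: visits_def ennreal_less_iff\<close>)
  qed
qed

section \<open>Joint measurability of the visits in time and path\<close>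

definition graph_set :: "'e set \<Rightarrow> (real \<times> 'w) set" where
  "graph_set A = {(s, \<omega>). 0 \<le> s \<and> \<omega> \<in> \<Omega> \<and> visits X A s \<omega>}"

text \<open>The least multiple of \<open>1 / 2 ^ n\<close> strictly above \<open>s\<close>.
  Strictness matters because right continuity speaks of later times only; the countable range makes
  sampled graphs countable unions of rectangles.\<close>

definition grid_above :: "nat \<Rightarrow> real \<Rightarrow> real" where
  "grid_above n s = (of_int \<lfloor>2 ^ n * s\<rfloor> + 1) / 2 ^ n"

lemma grid_above: "s < grid_above n s" "grid_above n s \<le> s + 1 / 2 ^ n"
proof -
  have *: "2 ^ n * s < of_int \<lfloor>2 ^ n * s\<rfloor> + 1" "of_int \<lfloor>2 ^ n * s\<rfloor> \<le> 2 ^ n * s"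
    by linarith+
  show "s < grid_above n s" "grid_above n s \<le> s + 1 / 2 ^ n"
    using * by (simp_all add: grid_above_def field_simps)
qed

lemma eventually_grid_above:
  assumes "s < b"
  shows "\<exists>N. \<forall>n\<ge>N. grid_above n s < b"
proof -
  obtain N where N: "(1 / 2) ^ N < b - s"
    using real_arch_pow_inv[of "b - s" "1 / 2"] assms by auto
  have "grid_above n s < b" if "n \<ge> N" for n
  proof -
    have "(1 / 2 :: real) ^ n \<le> (1 / 2) ^ N" using that by (intro power_decreasing) auto
    then have "1 / 2 ^ n < b - s" using N by (simp add: power_one_over)
    with grid_above(2)[of n s] show ?thesis by linarith
  qed
  then show ?thesis by blast
qed

lemma grid_graph_measurable:
  assumes "A \<in> sets borel"
  shows "{(s, \<omega>). 0 \<le> s \<and> \<omega> \<in> \<Omega> \<and> visits X A (grid_above n s) \<omega>} \<in> sets (borel \<Otimes>\<^sub>M path_events X)"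
proof -
  have "{(s, \<omega>). 0 \<le> s \<and> \<omega> \<in> \<Omega> \<and> visits X A (grid_above n s) \<omega>}
    = (\<Union>k::nat. {s. 0 \<le> s \<and> \<lfloor>2 ^ n * s\<rfloor> = int k} \<times> {\<omega>\<in>\<Omega>. visits X A ((real k + 1) / 2 ^ n) \<omega>})"
    (is "?L = ?R")
  proof (intro set_eqI iffI)
    fix z assume "z \<in> ?L"
    then obtain s \<omega> where z: "z = (s, \<omega>)" "0 \<le> s" "\<omega> \<in> \<Omega>" "visits X A (grid_above n s) \<omega>" by auto
    have "0 \<le> \<lfloor>2 ^ n * s\<rfloor>" using z(2) by simp
    then obtain k where k: "\<lfloor>2 ^ n * s\<rfloor> = int k" using nonneg_int_cases by blast
    then show "z \<in> ?R" using z by (auto simp: grid_above_def)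
  qed (auto simp: grid_above_def)
  also have "\<dots> \<in> sets (borel \<Otimes>\<^sub>M path_events X)"
  proof -
    have "{\<omega>\<in>\<Omega>. visits X A ((real k + 1) / 2 ^ n) \<omega>} \<in> sets (path_events X)" for k
      using assms by (intro visits_path_events) auto
    moreover have "{s::real. 0 \<le> s \<and> \<lfloor>2 ^ n * s\<rfloor> = int k} \<in> sets borel" for k
      by measurable
    ultimately show ?thesis by (intro sets.countable_UN) (auto intro!: pair_measureI)
  qed
  finally show ?thesis .
qed

text \<open>The closed sets \<open>C m\<close> exhaust \<open>U\<close>, and a small ball around a
  point of \<open>U\<close> lies in one of them. So a visit to \<open>U\<close> at \<open>s\<close>
  puts the path into one \<open>C m\<close> at all sufficiently fine grid times above
  \<open>s\<close>; conversely, by right continuity, lying in a closed set along these times passes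
  to time \<open>s\<close>.\<close>

lemma graph_measurable_open:
  assumes "open U"
  shows "graph_set U \<in> sets (borel \<Otimes>\<^sub>M path_events X)"
proof -
  define C where "C m = {y. \<forall>z. z \<notin> U \<longrightarrow> 1 / (real m + 1) \<le> dist y z}" for m :: nat
  have clC: "closed (C m)" for m
  proof -
    have "C m = (\<Inter>z\<in>-U. {y. 1 / (real m + 1) \<le> dist y z})" by (auto simp: C_def)
    also have "closed \<dots>" by (intro closed_INT ballI closed_Collect_le continuous_intros)
    finally show ?thesis .
  qed
  have CU: "C m \<subseteq> U" for m
  proof
    fix y assume "y \<in> C m"
    moreover have "\<not> 1 / (real m + 1) \<le> dist y y" by (simp add: field_simps)
    ultimately show "y \<in> U" by (auto simp: C_def)
  qed
  have eq: "visits X U s \<omega> \<longleftrightarrow> (\<exists>m N. \<forall>n\<ge>N. visits X (C m) (grid_above n s) \<omega>)"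
    if w: "\<omega> \<in> \<Omega>" and s: "0 \<le> s" for s \<omega>
  proof
    assume "visits X U s \<omega>"
    then obtain y where y: "traj X (ennreal s) \<omega> = Some y" "y \<in> U" by (auto simp: visits_def)
    then obtain e where e: "0 < e" "ball y e \<subseteq> U" using assms by (auto simp: open_contains_ball)
    obtain m :: nat where m: "2 / e < real m" using reals_Archimedean2 by blast
    have m': "1 / (real m + 1) \<le> e / 2"
      using m e(1) by (simp add: field_simps)
    have sub: "ball y (e / 2) \<subseteq> C m"
    proof
      fix w assume w: "w \<in> ball y (e / 2)"
      have "1 / (real m + 1) \<le> dist w z" if "z \<notin> U" for z
      proof -
        have "e \<le> dist y z" using that e(2) by (meson mem_ball not_le subsetD)
        also have "\<dots> \<le> dist y w + dist w z" by (rule dist_triangle)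
        finally show ?thesis using w m' by simp
      qed
      then show "w \<in> C m" by (simp add: C_def)
    qed
    have "visits X (ball y (e / 2)) s \<omega>" using y e by (auto simp: visits_def)
    then obtain b where b: "b > s" "\<And>t. s < t \<Longrightarrow> t < b \<Longrightarrow> visits X (ball y (e / 2)) t \<omega>"
      using right_continuous[OF w s open_ball] by blast
    obtain N where "\<forall>n\<ge>N. grid_above n s < b" using eventually_grid_above[OF b(1)] by blast
    then have "visits X (C m) (grid_above n s) \<omega>" if "n \<ge> N" for n
      using b(2)[OF grid_above(1)[of s n]] that visits_mono[OF _ sub] by simp
    then show "\<exists>m N. \<forall>n\<ge>N. visits X (C m) (grid_above n s) \<omega>" by blast
  next
    assume "\<exists>m N. \<forall>n\<ge>N. visits X (C m) (grid_above n s) \<omega>"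
    then obtain m N where mN: "\<And>n. n \<ge> N \<Longrightarrow> visits X (C m) (grid_above n s) \<omega>" by blast
    \<comment> \<open>Not visiting the complement of \<open>C m\<close> amounts to visiting
      \<open>C m\<close> only for a living path; life at a later grid time gives life at
      \<open>s\<close>.\<close>
    have "alive X (grid_above N s) \<omega>"
      using visits_mono[OF mN[OF order_refl]] by simp
    then have "alive X s \<omega>"
      using dies[OF w] grid_above(1)[of s N] by (simp add: less_imp_le)
    moreover have "\<not> visits X (- C m) s \<omega>"
    proof
      assume "visits X (- C m) s \<omega>"
      then obtain b where b: "b > s" "\<And>t. s < t \<Longrightarrow> t < b \<Longrightarrow> visits X (- C m) t \<omega>"
        using right_continuous[OF w s open_Compl[OF clC]] by metis
      obtain N' where N': "\<forall>n\<ge>N'. grid_above n s < b" using eventually_grid_above[OF b(1)] by blast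
      let ?n = "max N N'"
      have "visits X (- C m) (grid_above ?n s) \<omega>" "visits X (C m) (grid_above ?n s) \<omega>"
        using b(2)[OF grid_above(1)[of s ?n]] N' mN[of ?n] by simp_all
      then show False by (auto simp: visits_def)
    qed
    ultimately have "visits X (C m) s \<omega>" by (auto simp: visits_def)
    then show "visits X U s \<omega>" using CU by (rule visits_mono)
  qed
  have "graph_set U = (\<Union>m. \<Union>N. \<Inter>n\<in>{N..}. {(s, \<omega>). 0 \<le> s \<and> \<omega> \<in> \<Omega> \<and> visits X (C m) (grid_above n s) \<omega>})"
  proof (intro set_eqI)
    fix z
    show "z \<in> graph_set U \<longleftrightarrow> z \<in> (\<Union>m. \<Union>N. \<Inter>n\<in>{N..}. {(s, \<omega>). 0 \<le> s \<and> \<omega> \<in> \<Omega> \<and> visits X (C m) (grid_above n s) \<omega>})"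
      using eq[of "snd z" "fst z"] by (cases z) (auto simp: graph_set_def)
  qed
  also have "\<dots> \<in> sets (borel \<Otimes>\<^sub>M path_events X)"
  proof -
    have "{(s, \<omega>). 0 \<le> s \<and> \<omega> \<in> \<Omega> \<and> visits X (C m) (grid_above n s) \<omega>} \<in> sets (borel \<Otimes>\<^sub>M path_events X)" for m n
      by (intro grid_graph_measurable borel_closed clC)
    then show ?thesis
      by (intro sets.countable_UN sets.countable_INT image_subsetI) auto
  qed
  finally show ?thesis .
qed

lemma graph_measurable:
  assumes "A \<in> sets borel"
  shows "graph_set A \<in> sets (borel \<Otimes>\<^sub>M path_events X)"
proof -
  have "A \<in> sigma_sets UNIV {S. open S}"
    using assms by (simp add: borel_def)
  then show ?thesis
  proof induction
    case (Basic A)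
    then show ?case by (simp add: graph_measurable_open)
  next
    case Empty
    have "graph_set {} = {}" by (auto simp: graph_set_def)
    then show ?case by simp
  next
    case (Compl A)
    have "graph_set (UNIV - A) = graph_set UNIV - graph_set A"
      by (auto simp: graph_set_def visits_Diff)
    then show ?case using Compl graph_measurable_open[OF open_UNIV] by auto
  next
    case (Union A)
    have "graph_set (\<Union>i. A i) = (\<Union>i. graph_set (A i))"
      by (auto simp: graph_set_def visits_UN)
    then show ?case using Union by auto
  qed
qed

section \<open>Borel targets after completion, open targets on dyadic grids\<close>

definition hits :: "'e set \<Rightarrow> real set \<Rightarrow> 'w set" where
  "hits A I = {\<omega>\<in>\<Omega>. \<exists>s\<in>I. visits X A s \<omega>}"

lemma hits_completion:
  assumes M: "finite_measure M" "sets M = sets (path_events X)"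
    and A: "A \<in> sets borel" and I: "I \<in> sets borel" "I \<subseteq> {0..}"
  shows "hits A I \<in> sets (completion M)"
proof -
  have "I \<times> \<Omega> \<in> sets (borel \<Otimes>\<^sub>M M)"
    using I(1) sets.top[of "path_events X"] by (intro pair_measureI) (auto simp: M(2) space_path_events)
  moreover have "graph_set A \<in> sets (borel \<Otimes>\<^sub>M M)"
    using graph_measurable[OF A] sets_pair_measure_cong[OF refl M(2)] by blast
  ultimately have "graph_set A \<inter> I \<times> \<Omega> \<in> sets (borel \<Otimes>\<^sub>M M)" by blast
  then have "snd ` (graph_set A \<inter> I \<times> \<Omega>) \<in> sets (completion M)"
    by (rule measurable_projection[OF M(1)])
  also have "snd ` (graph_set A \<inter> I \<times> \<Omega>) = hits A I"
    using I(2) by (force simp: graph_set_def hits_def)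
  finally show ?thesis .
qed

lemma hits_law_completion:
  assumes "A \<in> sets borel" "I \<in> sets borel" "I \<subseteq> {0..}"
  shows "hits A I \<in> sets (completion (law X y))"
proof -
  interpret P: prob_space "path_law y" by (rule prob_space_path_law)
  have "hits A I \<in> sets (completion (path_law y))"
    using assms by (intro hits_completion P.finite_measure_axioms) auto
  then obtain S N N' where D: "hits A I = S \<union> N" "N \<subseteq> N'" "N' \<in> null_sets (path_law y)" "S \<in> sets (path_law y)"
    by (rule sets_completionE)
  have "N' \<in> null_sets (law X y)"
    using D(3) path_events_sub by (auto simp: null_sets_def emeasure_path_law)
  then show ?thesis using D path_events_sub by (intro sets_completionI[of _ S N N']) auto
qed

text \<open>A visit to an open set persists on a short interval to the right, and that interval
  contains a dyadic fraction of \<open>t\<close>. Leaving out the endpoint \<open>t\<close> ensures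
  that there is room for such a time below \<open>t\<close>.\<close>

lemma hits_open_grid:
  assumes U: "open U" and t: "0 < t"
  shows "hits U {0..<t} = (\<Union>n. \<Union>k<2 ^ n. {\<omega>\<in>\<Omega>. visits X U (real k * (t / 2 ^ n)) \<omega>})"
proof (intro set_eqI iffI)
  fix \<omega> assume "\<omega> \<in> hits U {0..<t}"
  then obtain s where s: "\<omega> \<in> \<Omega>" "0 \<le> s" "s < t" "visits X U s \<omega>" by (auto simp: hits_def)
  then obtain b where b: "b > s" "\<And>u. s < u \<Longrightarrow> u < b \<Longrightarrow> visits X U u \<omega>"
    using right_continuous[OF s(1,2) U] by blast
  have "s / t < min b t / t" using b(1) s t by (simp add: divide_strict_right_mono)
  then obtain N where N: "grid_above N (s / t) < min b t / t"
    using eventually_grid_above by blast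
  have "0 \<le> \<lfloor>2 ^ N * (s / t)\<rfloor>" using s t by simp
  then obtain k where k: "\<lfloor>2 ^ N * (s / t)\<rfloor> = int k" using nonneg_int_cases by blast
  have g: "grid_above N (s / t) = real (Suc k) / 2 ^ N"
    unfolding grid_above_def k by (simp add: add.commute)
  have "real (Suc k) * (t / 2 ^ N) < min b t"
    using N t by (simp add: g field_simps)
  moreover have "s < real (Suc k) * (t / 2 ^ N)"
    using grid_above(1)[of "s / t" N] t by (simp add: g field_simps)
  ultimately have "visits X U (real (Suc k) * (t / 2 ^ N)) \<omega>" using b(2) by simp
  moreover have "real (Suc k) < 2 ^ N"
  proof -
    have "min b t / t \<le> 1" using t by (simp add: divide_le_eq_1)
    then have "real (Suc k) / 2 ^ N < 1" using N by (simp only: g)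
    then show ?thesis by (simp add: divide_less_eq_1)
  qed
  then have "Suc k < 2 ^ N" by (metis of_nat_less_iff of_nat_numeral of_nat_power)
  ultimately show "\<omega> \<in> (\<Union>n. \<Union>k<2 ^ n. {\<omega>\<in>\<Omega>. visits X U (real k * (t / 2 ^ n)) \<omega>})"
    using s(1) by blast
next
  fix \<omega> assume "\<omega> \<in> (\<Union>n. \<Union>k<2 ^ n. {\<omega>\<in>\<Omega>. visits X U (real k * (t / 2 ^ n)) \<omega>})"
  then obtain n k where nk: "k < 2 ^ n" "\<omega> \<in> \<Omega>" "visits X U (real k * (t / 2 ^ n)) \<omega>" by auto
  have "real k < 2 ^ n" using nk(1) by (metis of_nat_less_iff of_nat_numeral of_nat_power)
  then have "real k * (t / 2 ^ n) < t" using t by (simp add: field_simps)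
  then show "\<omega> \<in> hits U {0..<t}" using nk t by (auto simp: hits_def intro!: bexI[of _ "real k * (t / 2 ^ n)"])
qed

lemma hits_open_measurable:
  assumes "open U" "0 < t"
  shows "hits U {0..<t} \<in> sets (path_events X)"
  unfolding hits_open_grid[OF assms] using assms
  by (intro sets.countable_UN image_subsetI sets.finite_UN visits_path_events) auto

text \<open>Decompose according to the first grid time in \<open>U\<close>: from there the path is still in \<open>W\<close> at time \<open>t\<close> with
  probability at least \<open>\<kappa>\<close>.\<close>

lemma emeasure_hits_open_le:
  assumes U: "open U" and W: "W \<in> sets borel" and t: "0 < t"
    and \<kappa>: "\<And>u z. 0 < u \<Longrightarrow> u \<le> t \<Longrightarrow> z \<in> U \<Longrightarrow> \<kappa> \<le> emeasure (kern X u z) W"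
  shows "\<kappa> * emeasure (law X y) (hits U {0..<t}) \<le> emeasure (kern X t y) W"
proof -
  define E where "E n = (\<Union>k<2 ^ n. {\<omega>\<in>\<Omega>. visits X U (real k * (t / 2 ^ n)) \<omega>})" for n :: nat
  have Ev: "E n \<in> sets (events X)" for n
    unfolding E_def using U by (intro sets.finite_UN visits_events) auto
  have inc: "incseq E"
  proof (rule incseq_SucI, rule subsetI)
    fix n \<omega> assume "\<omega> \<in> E n"
    then obtain k where k: "k < 2 ^ n" "\<omega> \<in> \<Omega>" "visits X U (real k * (t / 2 ^ n)) \<omega>" by (auto simp: E_def)
    have "real (2 * k) * (t / 2 ^ Suc n) = real k * (t / 2 ^ n)" by simp
    then show "\<omega> \<in> E (Suc n)"
      unfolding E_def using k by (intro UN_I[of "2 * k"]) auto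
  qed
  have le: "\<kappa> * emeasure (law X y) (E n) \<le> emeasure (kern X t y) W" for n
  proof -
    define h where "h = t / 2 ^ n"
    have h: "0 < h" using t by (simp add: h_def)
    define F where "F k = {\<omega>\<in>\<Omega>. visits X U (real k * h) \<omega> \<and> (\<forall>j<k. \<not> visits X U (real j * h) \<omega>)}" for k :: nat
    have kh: "real k * h < t" if "k < 2 ^ n" for k
    proof -
      have "real k < 2 ^ n" using that by (metis of_nat_less_iff of_nat_numeral of_nat_power)
      then show ?thesis using t by (simp add: h_def field_simps)
    qed
    have F_eq: "F k = {\<omega>\<in>\<Omega>. visits X U (real k * h) \<omega>} - (\<Union>j<k. {\<omega>\<in>\<Omega>. visits X U (real j * h) \<omega>})" for k
      by (auto simp: F_def)
    have F: "F k \<in> sets (filt X (ennreal (real k * h)))" for k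
      unfolding F_eq using U h by (intro sets.Diff sets.finite_UN visits_filt) auto
    have Fe: "F k \<in> sets (law X y)" for k using F[of k] filt_events by auto
    have disj: "disjoint_family F"
      unfolding disjoint_family_on_def F_def by (auto simp: neq_iff)
    have E_F: "E n = (\<Union>k<2 ^ n. F k)"
    proof (intro set_eqI iffI)
      fix \<omega> assume "\<omega> \<in> E n"
      then obtain k where k: "k < 2 ^ n" "\<omega> \<in> \<Omega>" "visits X U (real k * h) \<omega>" by (auto simp: E_def h_def)
      define k' where "k' = (LEAST k. visits X U (real k * h) \<omega>)"
      have "visits X U (real k' * h) \<omega>" unfolding k'_def by (rule LeastI[of _ k]) (rule k(3))
      moreover have "k' \<le> k" unfolding k'_def by (rule Least_le) (rule k(3))
      moreover have "\<forall>j<k'. \<not> visits X U (real j * h) \<omega>" unfolding k'_def using not_less_Least by blast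
      ultimately show "\<omega> \<in> (\<Union>k<2 ^ n. F k)" using k by (auto simp: F_def intro!: bexI[of _ k'])
    qed (auto simp: E_def F_def h_def)
    have step: "\<kappa> * emeasure (law X y) (F k) \<le> emeasure (law X y) (F k \<inter> {\<omega>\<in>\<Omega>. visits X W t \<omega>})"
      if k: "k < 2 ^ n" for k
    proof -
      have "\<kappa> * emeasure (law X y) (F k) = (\<integral>\<^sup>+\<omega>. \<kappa> * indicator (F k) \<omega> \<partial>law X y)"
        using Fe by (simp add: nn_integral_cmult_indicator)
      also have "\<dots> \<le> (\<integral>\<^sup>+\<omega>. lift_fn X (\<lambda>z. emeasure (kern X (t - real k * h) z) W) (real k * h) \<omega> * indicator (F k) \<omega> \<partial>law X y)"
      proof (rule nn_integral_mono)
        fix \<omega>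
        show "\<kappa> * indicator (F k) \<omega> \<le> lift_fn X (\<lambda>z. emeasure (kern X (t - real k * h) z) W) (real k * h) \<omega> * indicator (F k) \<omega>"
        proof (cases "\<omega> \<in> F k")
          case True
          then obtain z where "traj X (ennreal (real k * h)) \<omega> = Some z" "z \<in> U"
            by (auto simp: F_def visits_def)
          then show ?thesis
            using True \<kappa>[of "t - real k * h" z] kh[OF k] h by (simp add: lift_fn_def)
        qed simp
      qed
      also have "\<dots> = emeasure (law X y) {\<omega>\<in>F k. visits X W (real k * h + (t - real k * h)) \<omega>}"
        using kh[OF k] h by (intro markov_set[OF F W, symmetric]) auto
      also have "{\<omega>\<in>F k. visits X W (real k * h + (t - real k * h)) \<omega>} = F k \<inter> {\<omega>\<in>\<Omega>. visits X W t \<omega>}"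
        by (auto simp: F_def)
      finally show ?thesis .
    qed
    have "\<kappa> * emeasure (law X y) (E n) = (\<Sum>k<2 ^ n. \<kappa> * emeasure (law X y) (F k))"
      unfolding E_F using Fe disj
      by (subst sum_emeasure[symmetric]) (auto simp: sum_distrib_left image_subset_iff intro: disjoint_family_on_mono)
    also have "\<dots> \<le> (\<Sum>k<2 ^ n. emeasure (law X y) (F k \<inter> {\<omega>\<in>\<Omega>. visits X W t \<omega>}))"
      by (intro sum_mono step) simp
    also have "\<dots> = emeasure (law X y) (\<Union>k<2 ^ n. F k \<inter> {\<omega>\<in>\<Omega>. visits X W t \<omega>})"
    proof (rule sum_emeasure)
      show "disjoint_family_on (\<lambda>k. F k \<inter> {\<omega>\<in>\<Omega>. visits X W t \<omega>}) {..<2 ^ n}"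
        using disj unfolding disjoint_family_on_def by blast
    qed (use Fe visits_events[OF W, of t] in auto)
    also have "\<dots> \<le> emeasure (law X y) {\<omega>\<in>\<Omega>. visits X W t \<omega>}"
      using visits_events[OF W, of t] by (intro emeasure_mono) auto
    finally show ?thesis by (simp add: emeasure_kern W)
  qed
  have "\<kappa> * emeasure (law X y) (hits U {0..<t}) = \<kappa> * emeasure (law X y) (\<Union>n. E n)"
    by (simp add: hits_open_grid[OF U t] E_def)
  also have "emeasure (law X y) (\<Union>n. E n) = (SUP n. emeasure (law X y) (E n))"
    using Ev inc by (intro SUP_emeasure_incseq[symmetric]) auto
  also have "\<kappa> * (SUP n. emeasure (law X y) (E n)) = (SUP n. \<kappa> * emeasure (law X y) (E n))"
    by (rule SUP_mult_left_ennreal)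
  also have "\<dots> \<le> emeasure (kern X t y) W"
    by (intro SUP_least le)
  finally show ?thesis .
qed

end

section \<open>Hitting potentials\<close>

locale density_process = right_process X
  for X :: "('w, 'e::{metric_space, second_countable_topology}) process" +
  fixes \<mu> :: "'e measure" and p :: "real \<Rightarrow> 'e \<Rightarrow> 'e \<Rightarrow> real"
  assumes sets_mu [simp]: "sets \<mu> = sets borel"
    and sigma_finite: "sigma_finite_measure \<mu>"
    and full: "full_support \<mu>"
    and density: "transition_density \<mu> X p"
begin

lemma space_mu [simp]: "space \<mu> = UNIV"
  using sets_eq_imp_space_eq[OF sets_mu] by simp

lemma p_measurable: "0 < t \<Longrightarrow> p t y \<in> borel_measurable borel"
proof -
  assume t: "0 < t"
  have *: "(\<lambda>(t, x, y). p t x y) \<in> borel_measurable (restrict_space borel {0<..} \<Otimes>\<^sub>M borel \<Otimes>\<^sub>M borel)"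
    using density by (simp add: transition_density_def)
  have "(\<lambda>z. (t, y, z)) \<in> borel \<rightarrow>\<^sub>M restrict_space borel {0<..} \<Otimes>\<^sub>M borel \<Otimes>\<^sub>M borel"
    using t by (intro measurable_Pair measurable_const) (auto simp: space_restrict_space)
  from measurable_compose[OF this *] show ?thesis by simp
qed

lemma p_nonneg: "0 < t \<Longrightarrow> 0 \<le> p t y z"
  using density by (simp add: transition_density_def)

lemma kern_density: "0 < t \<Longrightarrow> kern X t y = Nonnegative_Lebesgue_Integration.density \<mu> (\<lambda>z. ennreal (p t y z))"
  using density by (simp add: transition_density_def)

lemma p_measurable_mu: "0 < t \<Longrightarrow> (\<lambda>z. ennreal (p t y z)) \<in> borel_measurable \<mu>"
  using p_measurable[of t y] by (simp cong: measurable_cong_sets)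

lemma nn_integral_kern_density:
  "0 < t \<Longrightarrow> g \<in> borel_measurable borel \<Longrightarrow> (\<integral>\<^sup>+z. g z \<partial>kern X t y) = (\<integral>\<^sup>+z. ennreal (p t y z) * g z \<partial>\<mu>)"
  by (simp add: kern_density nn_integral_density[OF p_measurable_mu] cong: measurable_cong_sets)

lemma AE_kern:
  assumes "0 < t" "AE z in \<mu>. P z"
  shows "AE z in kern X t y. P z"
  unfolding kern_density[OF assms(1)] AE_density[OF p_measurable_mu[OF assms(1)]]
  using assms(2) by eventually_elim simp

lemma chapman_kolmogorov:
  assumes "g \<in> borel_measurable borel" "0 \<le> s" "0 \<le> t"
  shows "(\<integral>\<^sup>+z. g z \<partial>kern X (s + t) y) = (\<integral>\<^sup>+z. \<integral>\<^sup>+w. g w \<partial>kern X t z \<partial>kern X s y)"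
proof -
  have "\<Omega> \<in> sets (filt X (ennreal s))" using sets.top[of "filt X (ennreal s)"] by simp
  from markov_fn[OF this assms, of y]
  have *: "(\<integral>\<^sup>+\<omega>. lift_fn X g (s + t) \<omega> \<partial>law X y) = (\<integral>\<^sup>+\<omega>. lift_fn X (\<lambda>z. \<integral>\<^sup>+w. g w \<partial>kern X t z) s \<omega> \<partial>law X y)"
    by (simp cong: nn_integral_cong_simp)
  show ?thesis
    unfolding nn_integral_kern[OF nn_integral_kern_measurable[OF assms(1)]] nn_integral_kern[OF assms(1), of "s + t"]
    by (rule *)
qed

text \<open>Initial laws have to be probabilities, whereas \<mu> is only sigma-finite. Normalizing
  by a strictly positive integrable density keeps the null sets, so the kernels at positive times
  are absolutely continuous with respect to \<open>m\<close> as well.\<close>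

lemma equivalent_prob:
  obtains m where "prob_on m" "\<And>P. (AE z in m. P z) \<longleftrightarrow> (AE z in \<mu>. P z)"
proof -
  interpret sigma_finite_measure \<mu> by (rule sigma_finite)
  obtain h where h: "h \<in> borel_measurable \<mu>" "integral\<^sup>N \<mu> h \<noteq> \<infinity>" "\<And>z. 0 < h z" "\<And>z. h z < \<infinity>"
    using Ex_finite_integrable_function by auto
  let ?c = "integral\<^sup>N \<mu> h"
  have "?c \<noteq> 0"
  proof
    assume "?c = 0"
    then have "AE z in \<mu>. h z = 0" using h(1) by (simp add: nn_integral_0_iff_AE)
    then have "AE z in \<mu>. False" by eventually_elim (use h(3) in \<open>simp add: less_le\<close>)
    then have "emeasure \<mu> UNIV = 0" by (simp add: AE_iff_measurable[OF _ refl])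
    then show False using full by (auto simp: full_support_def dest: spec[of _ UNIV])
  qed
  define m where "m = Nonnegative_Lebesgue_Integration.density \<mu> (\<lambda>z. h z / ?c)"
  have hm: "(\<lambda>z. h z / ?c) \<in> borel_measurable \<mu>" using h(1) by simp
  have "emeasure m (space m) = (\<integral>\<^sup>+z. h z / ?c \<partial>\<mu>)"
    unfolding m_def by (subst emeasure_density[OF hm]) auto
  also have "\<dots> = 1"
    using \<open>?c \<noteq> 0\<close> h(2) by (simp add: nn_integral_divide[OF h(1)] ennreal_divide_self less_top)
  finally have "prob_space m" by (rule prob_spaceI)
  then have "prob_on m" by (simp add: prob_on_def m_def)
  moreover have "(AE z in m. P z) \<longleftrightarrow> (AE z in \<mu>. P z)" for P
    unfolding m_def AE_density[OF hm] using h \<open>?c \<noteq> 0\<close>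
    by (simp add: ennreal_zero_less_divide less_top)
  ultimately show ?thesis by (rule that)
qed

section \<open>Exceptional sets common to all starting points\<close>

definition mixture :: "'e measure \<Rightarrow> 'w measure" where
  "mixture m = m \<bind> path_law"

lemma mixture_measurable: "prob_on m \<Longrightarrow> path_law \<in> m \<rightarrow>\<^sub>M prob_algebra (path_events X)"
  using path_law_measurable by (simp add: prob_on_def cong: measurable_cong_sets)

lemma space_prob_on: "prob_on m \<Longrightarrow> space m = UNIV"
  using sets_eq_imp_space_eq[of m borel] by (simp add: prob_on_def)

lemma emeasure_mixture:
  "prob_on m \<Longrightarrow> \<Gamma> \<in> sets (path_events X) \<Longrightarrow> emeasure (mixture m) \<Gamma> = (\<integral>\<^sup>+z. emeasure (law X z) \<Gamma> \<partial>m)"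
  unfolding mixture_def
  by (subst emeasure_bind[OF _ measurable_prob_algebraD[OF mixture_measurable]])
     (simp_all add: emeasure_path_law space_prob_on)

lemma sets_mixture: "prob_on m \<Longrightarrow> sets (mixture m) = sets (path_events X)"
  unfolding mixture_def by (subst sets_bind[where N="path_events X"]) (auto simp: space_prob_on)

lemma space_mixture: "prob_on m \<Longrightarrow> space (mixture m) = \<Omega>"
  using sets_eq_imp_space_eq[OF sets_mixture] by (simp add: space_path_events)

lemma prob_space_mixture: "prob_on m \<Longrightarrow> prob_space (mixture m)"
proof (rule prob_spaceI)
  assume m: "prob_on m"
  have "emeasure (mixture m) \<Omega> = (\<integral>\<^sup>+z. 1 \<partial>m)"
    using m sets.top[of "path_events X"] prob_space.emeasure_space_1[OF prob_space_law]
    by (simp add: emeasure_mixture space_path_events)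
  also have "\<dots> = 1" using m by (simp add: prob_on_def prob_space.emeasure_space_1)
  finally show "emeasure (mixture m) (space (mixture m)) = 1" by (simp add: space_mixture[OF m])
qed

lemma mixture_null:
  assumes m: "prob_on m" and \<Gamma>: "\<Gamma> \<in> sets (path_events X)" and 0: "emeasure (mixture m) \<Gamma> = 0"
  shows "AE z in m. emeasure (law X z) \<Gamma> = 0"
proof -
  have "(\<lambda>z. emeasure (law X z) \<Gamma>) \<in> borel_measurable m"
    using law_path_measurable[OF \<Gamma>] m by (simp add: prob_on_def cong: measurable_cong_sets)
  with 0 show ?thesis by (simp add: emeasure_mixture m \<Gamma> nn_integral_0_iff_AE)
qed

text \<open>A null set of the mixture is null from \<mu>-almost every starting point, and
  \<open>kern X s y\<close> does not charge the remaining points once \<open>s\<close> is positive.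
  The Markov property at time \<open>s\<close> then serves every \<open>y\<close>.\<close>

lemma mixture_null_shift:
  assumes m: "prob_on m" "\<And>P. (AE z in m. P z) \<longleftrightarrow> (AE z in \<mu>. P z)"
    and \<Gamma>: "\<Gamma> \<in> sets (path_events X)" and 0: "emeasure (mixture m) \<Gamma> = 0" and s: "0 < s"
  shows "AE \<omega> in law X y. alive X s \<omega> \<longrightarrow> shift s \<omega> \<notin> \<Gamma>"
proof -
  have "AE z in kern X s y. emeasure (law X z) \<Gamma> = 0"
    using mixture_null[OF m(1) \<Gamma> 0] m(2) AE_kern[OF s] by blast
  then have "(\<integral>\<^sup>+z. emeasure (law X z) \<Gamma> \<partial>kern X s y) = (\<integral>\<^sup>+z. 0 \<partial>kern X s y)"
    by (rule nn_integral_cong_AE)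
  then have e0: "emeasure (law X y) {\<omega>\<in>\<Omega>. alive X s \<omega> \<and> shift s \<omega> \<in> \<Gamma>} = 0"
    using markov_path[OF \<Gamma>, of s y] s by simp
  have "{\<omega>\<in>\<Omega>. alive X s \<omega> \<and> shift s \<omega> \<in> \<Gamma>} \<in> sets (law X y)"
    using shift_vimage_events[OF \<Gamma>, of s] s path_events_sub by auto
  with e0 show ?thesis
    by (intro AE_I[where N="{\<omega>\<in>\<Omega>. alive X s \<omega> \<and> shift s \<omega> \<in> \<Gamma>}"]) auto
qed

lemma hits_shift:
  assumes "\<omega> \<in> \<Omega>" "0 \<le> s" "s \<le> t" "visits X A t \<omega>" "t - s \<in> I"
  shows "shift s \<omega> \<in> hits A I"
  using assms visits_shift[of \<omega> s "t - s" A] shift_space by (auto simp: hits_def)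

lemma AE_all_positive_times:
  assumes "\<And>s. 0 < s \<Longrightarrow> AE \<omega> in M. \<forall>t>s. P t \<omega>"
  shows "AE \<omega> in M. \<forall>t>0::real. P t \<omega>"
proof -
  have "AE \<omega> in M. \<forall>n::nat. \<forall>t>1 / (real n + 1). P t \<omega>"
    unfolding AE_all_countable by (intro allI assms) simp
  then show ?thesis
  proof eventually_elim
    case (elim \<omega>)
    show ?case
    proof (intro allI impI)
      fix t :: real assume "0 < t"
      then obtain n :: nat where n: "1 / t < real n" using reals_Archimedean2 by blast
      have "1 / (real n + 1) < t" using n \<open>0 < t\<close> by (simp add: field_simps)
      then show "P t \<omega>" using elim by blast
    qed
  qed
qed

text \<open>Absolute continuity makes one Borel approximation work for all starting points, at positive times.\<close>

lemma nearly_borel_core: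
  assumes "B \<in> nearly_borel X"
  obtains B1 where "B1 \<in> sets borel" "B1 \<subseteq> B"
    "\<And>y. AE \<omega> in law X y. \<forall>t>0. visits X B t \<omega> \<longrightarrow> visits X B1 t \<omega>"
proof -
  obtain m where m: "prob_on m" "\<And>P. (AE z in m. P z) \<longleftrightarrow> (AE z in \<mu>. P z)" by (rule equivalent_prob) blast
  obtain B1 B2 where B: "B1 \<in> sets borel" "B2 \<in> sets borel" "B1 \<subseteq> B" "B \<subseteq> B2"
    and ae: "AE \<omega> in law_init X m. \<not> (\<exists>t. traj X t \<omega> \<in> Some ` (B2 - B1))"
    using assms m(1) unfolding nearly_borel_def by blast
  interpret M: prob_space "mixture m" by (rule prob_space_mixture[OF m(1)])
  let ?D = "hits (B2 - B1) {0..}"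
  have "?D \<in> sets (completion (mixture m))"
    using B by (intro hits_completion sets_mixture m M.finite_measure_axioms) auto
  then obtain S N N' where D: "?D = S \<union> N" "N \<subseteq> N'" "N' \<in> null_sets (mixture m)" "S \<in> sets (mixture m)"
    by (rule sets_completionE)
  have S: "S \<in> sets (path_events X)" using D(4) by (simp add: sets_mixture m)
  obtain N0 where N0: "{\<omega>\<in>space (law_init X m). \<exists>t. traj X t \<omega> \<in> Some ` (B2 - B1)} \<subseteq> N0"
    "N0 \<in> sets (law_init X m)" "emeasure (law_init X m) N0 = 0"
    using ae by (rule AE_E) auto
  have sp: "space (law_init X m) = \<Omega>" using sets_eq_imp_space_eq[OF sets_law_init[OF m(1)]] .
  \<comment> \<open>\<open>law_init X m\<close> and \<open>mixture m\<close> agree on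
    \<open>path_events X\<close>, so it suffices that the measurable part \<open>S\<close> of
    \<open>?D\<close> lies in a null set of the former; the rest of \<open>?D\<close> is covered by
    \<open>N'\<close>.\<close>
  have "S \<subseteq> N0"
  proof
    fix \<omega> assume "\<omega> \<in> S"
    then have "\<omega> \<in> ?D" using D(1) by auto
    then show "\<omega> \<in> N0" using N0(1) by (auto simp: hits_def visits_def sp)
  qed
  then have "emeasure (law_init X m) S \<le> 0"
    using emeasure_mono[OF _ N0(2)] N0(3) by metis
  then have "emeasure (mixture m) S = 0"
    using S path_events_sub emeasure_law_init[OF m(1), of S] emeasure_mixture[OF m(1) S] by auto
  moreover have N': "N' \<in> sets (path_events X)" "emeasure (mixture m) N' = 0"
    using D(3) by (auto simp: sets_mixture[OF m(1), symmetric])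
  ultimately have null: "emeasure (mixture m) (S \<union> N') = 0"
    using emeasure_subadditive[of S "mixture m" N'] S by (simp add: sets_mixture[OF m(1)])
  have sub: "?D \<subseteq> S \<union> N'" using D by auto
  have "AE \<omega> in law X y. \<forall>t>0. visits X B t \<omega> \<longrightarrow> visits X B1 t \<omega>" for y
  proof (rule AE_all_positive_times)
    fix s :: real assume s: "0 < s"
    have "S \<union> N' \<in> sets (path_events X)" using S N' by auto
    from mixture_null_shift[OF m this null s, of y] AE_space
    show "AE \<omega> in law X y. \<forall>t>s. visits X B t \<omega> \<longrightarrow> visits X B1 t \<omega>"
    proof eventually_elim
      case (elim \<omega>)
      have "visits X B1 t \<omega>" if t: "s < t" "visits X B t \<omega>" for t
      proof (rule ccontr)
        assume "\<not> visits X B1 t \<omega>"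
        then have v: "visits X (B2 - B1) t \<omega>" using t(2) B(4) visits_mono by (auto simp: visits_Diff)
        have "shift s \<omega> \<in> ?D"
          using elim(2) s t v by (intro hits_shift[of \<omega> s t]) auto
        moreover have "alive X s \<omega>"
          using elim(2) t dies[of \<omega> t s] visits_mono[OF v] by auto
        ultimately show False using elim(1) sub by blast
      qed
      then show ?case by blast
    qed
  qed
  with B show ?thesis by (intro that) auto
qed

text \<open>This is exp (- D) for the first hitting time D after \<open>a\<close>, with value 0 if
  there is none. In the form of a supremum its superlevel sets are visibly hitting events over a
  Borel set of times.\<close>

definition disc_hit :: "'e set \<Rightarrow> real \<Rightarrow> 'w \<Rightarrow> ennreal" where
  "disc_hit A a \<omega> = (SUP s\<in>{s. a < s \<and> visits X A s \<omega>}. ennreal (exp (- s)))"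

lemma disc_hit_mono: "a \<le> b \<Longrightarrow> disc_hit A b \<omega> \<le> disc_hit A a \<omega>"
  unfolding disc_hit_def by (intro SUP_subset_mono) auto

lemma disc_hit_le: "disc_hit A a \<omega> \<le> ennreal (exp (- a))"
  unfolding disc_hit_def by (intro SUP_least ennreal_leI) auto

lemma disc_hit_eq_0: "disc_hit A a \<omega> = 0 \<Longrightarrow> a < s \<Longrightarrow> \<not> visits X A s \<omega>"
proof
  assume 0: "disc_hit A a \<omega> = 0" "a < s" "visits X A s \<omega>"
  then have "ennreal (exp (- s)) \<le> disc_hit A a \<omega>"
    unfolding disc_hit_def by (intro SUP_upper) auto
  with 0 show False by simp
qed

text \<open>Without a visit in \<open>{a<..b}\<close> the first visits after \<open>a\<close> and
  after \<open>b\<close> coincide; otherwise the indicator is 1 and dominates, as the discount is at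
  most 1.\<close>

lemma disc_hit_step:
  assumes "0 \<le> a" "\<omega> \<in> \<Omega>"
  shows "disc_hit A a \<omega> \<le> disc_hit A b \<omega> + indicator (hits A {a<..b}) \<omega>"
proof (cases "\<omega> \<in> hits A {a<..b}")
  case True
  have "disc_hit A a \<omega> \<le> ennreal (exp (- a))" by (rule disc_hit_le)
  also have "\<dots> \<le> 1" using assms by simp
  finally show ?thesis using True by (simp add: add_increasing)
next
  case False
  then have "{s. a < s \<and> visits X A s \<omega>} \<subseteq> {s. b < s \<and> visits X A s \<omega>}"
    using assms(2) by (auto simp: hits_def not_less[symmetric])
  then have "disc_hit A a \<omega> \<le> disc_hit A b \<omega>"
    unfolding disc_hit_def by (intro SUP_subset_mono) auto
  then show ?thesis using False by simp
qed

lemma disc_hit_shift: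
  assumes w: "\<omega> \<in> \<Omega>" and s: "0 \<le> s"
  shows "disc_hit A s \<omega> = ennreal (exp (- s)) * disc_hit A 0 (shift s \<omega>)"
proof -
  have eq: "{u. s < u \<and> visits X A u \<omega>} = (\<lambda>r. s + r) ` {r. 0 < r \<and> visits X A r (shift s \<omega>)}" (is "?L = ?R")
  proof (intro set_eqI iffI)
    fix u assume "u \<in> ?L"
    then show "u \<in> ?R"
      using visits_shift[OF w s, of "u - s" A] by (intro image_eqI[of _ _ "u - s"]) auto
  next
    fix u assume "u \<in> ?R"
    then show "u \<in> ?L" using visits_shift[OF w s] by auto
  qed
  have "disc_hit A s \<omega> = (SUP r\<in>{r. 0 < r \<and> visits X A r (shift s \<omega>)}. ennreal (exp (- s)) * ennreal (exp (- r)))"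
    unfolding disc_hit_def eq image_image by (simp add: exp_add[symmetric] flip: ennreal_mult)
  also have "\<dots> = ennreal (exp (- s)) * disc_hit A 0 (shift s \<omega>)"
    unfolding disc_hit_def by (rule SUP_mult_left_ennreal[symmetric])
  finally show ?thesis .
qed

lemma disc_hit_not_alive: "\<omega> \<in> \<Omega> \<Longrightarrow> \<not> alive X s \<omega> \<Longrightarrow> disc_hit A s \<omega> = 0"
proof -
  assume "\<omega> \<in> \<Omega>" "\<not> alive X s \<omega>"
  then have "\<not> visits X A u \<omega>" if "s < u" for u
    using dies[of \<omega> u s] visits_mono[of X A u \<omega> UNIV] that by (auto simp: less_imp_le)
  then have empty: "{u. s < u \<and> visits X A u \<omega>} = {}" by blast
  show ?thesis unfolding disc_hit_def empty by (simp add: bot_ennreal)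
qed

lemma disc_hit_completion:
  assumes M: "finite_measure M" "sets M = sets (path_events X)" and A: "A \<in> sets borel"
  shows "disc_hit A 0 \<in> borel_measurable (completion M)"
proof (rule borel_measurableI_greater)
  fix v
  have "{\<omega>\<in>space (completion M). v < disc_hit A 0 \<omega>} = hits A {s. 0 < s \<and> v < ennreal (exp (- s))}"
    using sets_eq_imp_space_eq[OF M(2)]
    by (auto simp: disc_hit_def less_SUP_iff hits_def space_path_events)
  moreover have "{s::real. 0 < s \<and> v < ennreal (exp (- s))} \<in> sets borel" by measurable
  ultimately show "{\<omega>\<in>space (completion M). v < disc_hit A 0 \<omega>} \<in> sets (completion M)"
    using hits_completion[OF M A, of "{s. 0 < s \<and> v < ennreal (exp (- s))}"] by (simp add: subset_iff)
qed

text \<open>With \<open>D\<^sub>s\<close> the first hitting time of \<open>A\<close> after \<open>s\<close>, \<open>V s y\<close> is \<open>E\<^sup>y[exp (- D\<^sub>s)]\<close> and \<open>G h z\<close> is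
  \<open>E\<^sup>z[exp (- D\<^sub>0) - exp (- D\<^sub>h)]\<close> for almost all \<open>z\<close>; the latter is nonzero only if \<open>A\<close> is hit before
  time \<open>h\<close>. As \<open>D\<^sub>0\<close> is not measurable with respect to \<open>path_events X\<close>, a measurable version is used.\<close>

lemma hitting_potential:
  assumes A: "A \<in> sets borel"
  obtains V G :: "real \<Rightarrow> 'e \<Rightarrow> ennreal"
  where "\<And>h. 0 < h \<Longrightarrow> G h \<in> borel_measurable borel"
    and "\<And>s y. 0 < s \<Longrightarrow> V s y \<le> ennreal (exp (- s))"
    and "\<And>s t y. 0 < s \<Longrightarrow> s \<le> t \<Longrightarrow> V t y \<le> V s y"
    and "\<And>s h y. 0 < s \<Longrightarrow> 0 < h \<Longrightarrow> V (s + h) y = ennreal (exp (- s)) * (\<integral>\<^sup>+z. V h z \<partial>kern X s y)"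
    and "\<And>s h y. 0 < s \<Longrightarrow> 0 < h \<Longrightarrow> V s y = V (s + h) y + ennreal (exp (- s)) * (\<integral>\<^sup>+z. G h z \<partial>kern X s y)"
    and "\<And>h. 0 < h \<Longrightarrow> AE z in \<mu>. \<forall>\<Gamma>\<in>sets (events X). hits A {0<..h} \<subseteq> \<Gamma> \<longrightarrow> G h z \<le> emeasure (law X z) \<Gamma>"
    and "\<And>s t y \<Gamma>. 0 < s \<Longrightarrow> s \<le> t \<Longrightarrow> \<Gamma> \<in> sets (completion (law X y)) \<Longrightarrow> hits A {s<..t} \<subseteq> \<Gamma> \<Longrightarrow>
      V s y \<le> V t y + emeasure (completion (law X y)) \<Gamma>"
    and "\<And>y. (\<And>s. 0 < s \<Longrightarrow> V s y = 0) \<Longrightarrow> AE \<omega> in law X y. \<forall>t>0. \<not> visits X A t \<omega>"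
proof -
  obtain m where m: "prob_on m" "\<And>P. (AE z in m. P z) \<longleftrightarrow> (AE z in \<mu>. P z)" by (rule equivalent_prob) blast
  interpret M: prob_space "mixture m" by (rule prob_space_mixture[OF m(1)])
  obtain \<Psi>0 where "\<Psi>0 \<in> borel_measurable (mixture m)" and ae: "AE \<omega> in mixture m. disc_hit A 0 \<omega> = \<Psi>0 \<omega>"
    using completion_ex_borel_measurable[OF disc_hit_completion[OF M.finite_measure_axioms sets_mixture[OF m(1)] A]]
    by blast
  then have \<Psi>0: "\<Psi>0 \<in> borel_measurable (path_events X)"
    by (simp add: sets_mixture[OF m(1)] cong: measurable_cong_sets)
  from ae obtain N where N: "{\<omega>\<in>space (mixture m). \<not> disc_hit A 0 \<omega> = \<Psi>0 \<omega>} \<subseteq> N"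
    "N \<in> sets (mixture m)" "emeasure (mixture m) N = 0"
    by (rule AE_E) auto
  have Np: "N \<in> sets (path_events X)" using N(2) by (simp add: sets_mixture[OF m(1)])
  have Neq: "disc_hit A 0 \<omega> = \<Psi>0 \<omega>" if "\<omega> \<in> \<Omega>" "\<omega> \<notin> N" for \<omega>
    using N(1) that by (auto simp: space_mixture[OF m(1)])
  define \<Psi> where "\<Psi> s \<omega> = ennreal (exp (- s)) * (\<Psi>0 (shift s \<omega>) * indicator {\<omega>. alive X s \<omega>} \<omega>)" for s \<omega>
  have \<Psi>_mp: "(\<lambda>\<omega>. \<Psi>0 (shift s \<omega>) * indicator {\<omega>. alive X s \<omega>} \<omega>) \<in> borel_measurable (path_events X)" if "0 \<le> s" for s
  proof -
    have "(indicator {\<omega>\<in>\<Omega>. alive X s \<omega>} :: 'w \<Rightarrow> ennreal) \<in> borel_measurable (path_events X)"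
      using that by (intro borel_measurable_indicator visits_path_events) auto
    then have "(\<lambda>\<omega>. \<Psi>0 (shift s \<omega>) * indicator {\<omega>\<in>\<Omega>. alive X s \<omega>} \<omega>) \<in> borel_measurable (path_events X)"
      using measurable_compose[OF shift_measurable[OF that] \<Psi>0] by simp
    then show ?thesis
      by (subst measurable_cong) (auto simp: space_path_events indicator_def)
  qed
  have path_law_mono: "f \<in> borel_measurable (path_events X) \<Longrightarrow> f \<in> borel_measurable (law X y)" for f :: "'w \<Rightarrow> ennreal" and y
    by (rule measurable_compose[OF id_path_measurable])
  have \<Psi>_m: "\<Psi> s \<in> borel_measurable (law X y)" if "0 \<le> s" for s y
    unfolding \<Psi>_def by (intro borel_measurable_times_ennreal path_law_mono[OF \<Psi>_mp[OF that]]) simp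
  \<comment> \<open>The exceptional set \<open>N\<close> of the version \<Psi>0 is null for the
    mixture. Moved by a positive shift it is null from every starting point, so here
    \<open>y\<close> is arbitrary.\<close>
  have \<Psi>_eq: "AE \<omega> in law X y. disc_hit A s \<omega> = \<Psi> s \<omega>" if s: "0 < s" for s y
    using mixture_null_shift[OF m Np N(3) s, of y] AE_space
  proof eventually_elim
    case (elim \<omega>)
    show ?case
    proof (cases "alive X s \<omega>")
      case True
      then show ?thesis
        using elim s Neq[of "shift s \<omega>"] shift_space by (simp add: \<Psi>_def disc_hit_shift)
    next
      case False
      then show ?thesis using elim by (simp add: \<Psi>_def disc_hit_not_alive)
    qed
  qed
  define F where "F z = (\<integral>\<^sup>+\<omega>. \<Psi>0 \<omega> \<partial>path_law z)" for z
  have F: "F \<in> borel_measurable borel"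
    unfolding F_def by (rule nn_integral_path_law_measurable[OF \<Psi>0])
  define V where "V s y = ennreal (exp (- s)) * (\<integral>\<^sup>+z. F z \<partial>kern X s y)" for s y
  have V_meas: "V s \<in> borel_measurable borel" for s
    unfolding V_def by (intro borel_measurable_times_ennreal nn_integral_kern_measurable[OF F]) simp
  have V_eq: "V s y = (\<integral>\<^sup>+\<omega>. \<Psi> s \<omega> \<partial>law X y)" if "0 \<le> s" for s y
  proof -
    have "(\<integral>\<^sup>+z. F z \<partial>kern X s y) = (\<integral>\<^sup>+\<omega>. \<Psi>0 (shift s \<omega>) * indicator {\<omega>. alive X s \<omega>} \<omega> \<partial>path_law y)"
      unfolding F_def by (rule markov_functional[symmetric, OF \<Psi>0 that])
    also have "\<dots> = (\<integral>\<^sup>+\<omega>. \<Psi>0 (shift s \<omega>) * indicator {\<omega>. alive X s \<omega>} \<omega> \<partial>law X y)"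
      by (rule nn_integral_path_law[OF \<Psi>_mp[OF that]])
    finally show ?thesis
      unfolding V_def \<Psi>_def by (simp add: nn_integral_cmult[OF path_law_mono[OF \<Psi>_mp[OF that]]])
  qed
  define G where "G h z = F z - V h z" for h z
  have G_m: "G h \<in> borel_measurable borel" for h
    unfolding G_def using F V_meas by (intro borel_measurable_minus_ennreal)
  \<comment> \<open>At time 0 there is no shift to help, and the version is correct only from almost
    every starting point. Hence the properties of \<open>G h\<close> hold almost everywhere, which
    is enough for integrals against kernels.\<close>
  have F0: "AE z in \<mu>. AE \<omega> in law X z. disc_hit A 0 \<omega> = \<Psi>0 \<omega>"
  proof -
    have "AE z in \<mu>. emeasure (law X z) N = 0"
      using mixture_null[OF m(1) Np N(3)] m(2) by blast
    then show ?thesis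
    proof eventually_elim
      case (elim z)
      show ?case
        by (rule AE_I[of _ _ N]) (use elim Neq Np path_events_sub in auto)
    qed
  qed
  have F_law: "F z = (\<integral>\<^sup>+\<omega>. \<Psi>0 \<omega> \<partial>law X z)" for z
    unfolding F_def by (rule nn_integral_path_law[OF \<Psi>0])
  have FV: "AE z in \<mu>. V h z \<le> F z \<and> (\<forall>\<Gamma>\<in>sets (events X). hits A {0<..h} \<subseteq> \<Gamma> \<longrightarrow> F z \<le> V h z + emeasure (law X z) \<Gamma>)"
    if h: "0 < h" for h
    using F0
  proof eventually_elim
    case (elim z)
    have "V h z \<le> F z"
      unfolding V_eq[OF less_imp_le[OF h]] F_law
    proof (rule nn_integral_mono_AE)
      show "AE \<omega> in law X z. \<Psi> h \<omega> \<le> \<Psi>0 \<omega>"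
        using elim \<Psi>_eq[OF h, of z] by eventually_elim (metis disc_hit_mono less_imp_le h)
    qed
    moreover have "F z \<le> V h z + emeasure (law X z) \<Gamma>"
      if \<Gamma>: "\<Gamma> \<in> sets (events X)" "hits A {0<..h} \<subseteq> \<Gamma>" for \<Gamma>
    proof -
      have "F z \<le> (\<integral>\<^sup>+\<omega>. \<Psi> h \<omega> + indicator \<Gamma> \<omega> \<partial>law X z)"
        unfolding F_law
      proof (rule nn_integral_mono_AE)
        show "AE \<omega> in law X z. \<Psi>0 \<omega> \<le> \<Psi> h \<omega> + indicator \<Gamma> \<omega>"
          using elim \<Psi>_eq[OF h, of z] AE_space
        proof eventually_elim
          case (elim \<omega>)
          then have "\<Psi>0 \<omega> \<le> disc_hit A h \<omega> + indicator (hits A {0<..h}) \<omega>"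
            using disc_hit_step[of 0 \<omega> A h] by simp
          also have "\<dots> \<le> \<Psi> h \<omega> + indicator \<Gamma> \<omega>"
            using elim \<Gamma>(2) by (auto simp: indicator_def)
          finally show ?case .
        qed
      qed
      also have "\<dots> = V h z + emeasure (law X z) \<Gamma>"
        using \<Gamma>(1) h by (subst nn_integral_add[OF \<Psi>_m]) (auto simp: V_eq intro!: borel_measurable_indicator)
      finally show ?thesis .
    qed
    ultimately show ?case by blast
  qed
  have V_le: "V s y \<le> ennreal (exp (- s))" if s: "0 < s" for s y
  proof -
    have "V s y \<le> (\<integral>\<^sup>+\<omega>. ennreal (exp (- s)) \<partial>law X y)"
      unfolding V_eq[OF less_imp_le[OF s]]
    proof (rule nn_integral_mono_AE)
      show "AE \<omega> in law X y. \<Psi> s \<omega> \<le> ennreal (exp (- s))"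
        using \<Psi>_eq[OF s, of y] by eventually_elim (metis disc_hit_le)
    qed
    then show ?thesis
      using prob_space.emeasure_space_1[OF prob_space_law[of y]] by simp
  qed
  show ?thesis
  proof
    show "G h \<in> borel_measurable borel" for h by (rule G_m)
    show "V s y \<le> ennreal (exp (- s))" if "0 < s" for s y using that by (rule V_le)
    show "V t y \<le> V s y" if s: "0 < s" "s \<le> t" for s t y
    proof -
      have t: "0 < t" using s by simp
      show ?thesis
        unfolding V_eq[OF less_imp_le[OF s(1)]] V_eq[OF less_imp_le[OF t]]
      proof (rule nn_integral_mono_AE)
        show "AE \<omega> in law X y. \<Psi> t \<omega> \<le> \<Psi> s \<omega>"
          using \<Psi>_eq[OF s(1), of y] \<Psi>_eq[OF t, of y] by eventually_elim (metis disc_hit_mono s(2))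
      qed
    qed
    show semi: "V (s + h) y = ennreal (exp (- s)) * (\<integral>\<^sup>+z. V h z \<partial>kern X s y)" if "0 < s" "0 < h" for s h y
    proof -
      have "(\<lambda>z. \<integral>\<^sup>+w. F w \<partial>kern X h z) \<in> borel_measurable (kern X s y)"
        using nn_integral_kern_measurable[OF F] by (simp cong: measurable_cong_sets)
      then have "(\<integral>\<^sup>+z. V h z \<partial>kern X s y) = ennreal (exp (- h)) * (\<integral>\<^sup>+z. F z \<partial>kern X (s + h) y)"
        using that by (simp only: V_def nn_integral_cmult chapman_kolmogorov[OF F] less_imp_le)
      moreover have "ennreal (exp (- (s + h))) = ennreal (exp (- s)) * ennreal (exp (- h))"
        by (simp add: exp_add[symmetric] flip: ennreal_mult)
      ultimately show ?thesis
        by (simp only: V_def[of "s + h"] mult.assoc)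
    qed
    show "V s y = V (s + h) y + ennreal (exp (- s)) * (\<integral>\<^sup>+z. G h z \<partial>kern X s y)" if sh: "0 < s" "0 < h" for s h y
    proof -
      \<comment> \<open>Subtraction in \<open>ennreal\<close> is truncated at 0, so the sum is
        recovered only where \<open>V h z \<le> F z\<close>, that is, almost everywhere.\<close>
      have "AE z in kern X s y. F z = V h z + G h z"
        using AE_kern[OF sh(1) FV[OF sh(2)], of y] by eventually_elim (simp add: G_def add_diff_inverse_ennreal)
      then have "(\<integral>\<^sup>+z. F z \<partial>kern X s y) = (\<integral>\<^sup>+z. V h z + G h z \<partial>kern X s y)"
        by (rule nn_integral_cong_AE)
      also have "\<dots> = (\<integral>\<^sup>+z. V h z \<partial>kern X s y) + (\<integral>\<^sup>+z. G h z \<partial>kern X s y)"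
        using V_meas G_m by (intro nn_integral_add) (auto cong: measurable_cong_sets)
      finally show ?thesis
        unfolding semi[OF sh] by (simp add: V_def[of s y] distrib_left)
    qed
    show "AE z in \<mu>. \<forall>\<Gamma>\<in>sets (events X). hits A {0<..h} \<subseteq> \<Gamma> \<longrightarrow> G h z \<le> emeasure (law X z) \<Gamma>" if "0 < h" for h
      using FV[OF that]
    proof eventually_elim
      case (elim z)
      have "V h z \<noteq> top"
        using V_le[OF that, of z] by (auto simp: top_unique)
      with elim show ?case unfolding G_def ennreal_minus_le_iff by blast
    qed
    show "V s y \<le> V t y + emeasure (completion (law X y)) \<Gamma>"
      if s: "0 < s" "s \<le> t" and \<Gamma>: "\<Gamma> \<in> sets (completion (law X y))" "hits A {s<..t} \<subseteq> \<Gamma>" for s t y \<Gamma>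
    proof -
      have t: "0 < t" using s by simp
      have "V s y \<le> (\<integral>\<^sup>+\<omega>. \<Psi> t \<omega> + indicator \<Gamma> \<omega> \<partial>law X y)"
        unfolding V_eq[OF less_imp_le[OF s(1)]]
      proof (rule nn_integral_mono_AE)
        show "AE \<omega> in law X y. \<Psi> s \<omega> \<le> \<Psi> t \<omega> + indicator \<Gamma> \<omega>"
          using \<Psi>_eq[OF s(1), of y] \<Psi>_eq[OF t, of y] AE_space
        proof eventually_elim
          case (elim \<omega>)
          then have "\<Psi> s \<omega> \<le> disc_hit A t \<omega> + indicator (hits A {s<..t}) \<omega>"
            using disc_hit_step[of s \<omega> A t] s(1) by simp
          also have "\<dots> \<le> \<Psi> t \<omega> + indicator \<Gamma> \<omega>"
            using elim \<Gamma>(2) by (auto simp: indicator_def)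
          finally show ?case .
        qed
      qed
      also have "\<dots> = (\<integral>\<^sup>+\<omega>. \<Psi> t \<omega> + indicator \<Gamma> \<omega> \<partial>completion (law X y))"
        by (rule nn_integral_completion[symmetric])
      also have "\<dots> = (\<integral>\<^sup>+\<omega>. \<Psi> t \<omega> \<partial>completion (law X y)) + emeasure (completion (law X y)) \<Gamma>"
        using \<Gamma>(1) measurable_completion[OF \<Psi>_m[OF less_imp_le[OF t]]]
        by (subst nn_integral_add) (auto simp del: emeasure_completion intro!: borel_measurable_indicator)
      finally show ?thesis by (simp only: nn_integral_completion V_eq[OF less_imp_le[OF t]])
    qed
    show "AE \<omega> in law X y. \<forall>t>0. \<not> visits X A t \<omega>" if V0: "\<And>s. 0 < s \<Longrightarrow> V s y = 0" for y
    proof (rule AE_all_positive_times)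
      fix s :: real assume s: "0 < s"
      have "AE \<omega> in law X y. \<Psi> s \<omega> = 0"
        using V0[OF s] \<Psi>_m[of s y] s by (simp add: V_eq nn_integral_0_iff_AE)
      then show "AE \<omega> in law X y. \<forall>t>s. \<not> visits X A t \<omega>"
        using \<Psi>_eq[OF s, of y] by eventually_elim (metis disc_hit_eq_0)
    qed
  qed
qed

end

section \<open>Consequences of the heat kernel bounds\<close>

locale heat_process = density_process X \<mu> p
  for X :: "('w, 'e::{metric_space, second_countable_topology}) process" and \<mu> p +
  fixes \<alpha> \<beta> C2 T c C :: real
  assumes \<beta>: "1 < \<beta>" and pos: "0 < C2" "0 < T" "0 < c" "0 < C" and \<alpha>: "0 < \<alpha>"
    and ball_finite: "\<And>x r. emeasure \<mu> (ball x r) < \<infinity>"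
    and bounds: "\<And>t y z. 0 < t \<Longrightarrow> t \<le> T \<Longrightarrow>
      c / t powr (\<alpha> / \<beta>) * exp (- C2 * (dist y z / t powr (1 / \<beta>)) powr (\<beta> / (\<beta> - 1))) \<le> p t y z \<and>
      p t y z \<le> C / t powr (\<alpha> / \<beta>) * exp (- C2 * (dist y z / t powr (1 / \<beta>)) powr (\<beta> / (\<beta> - 1)))"
begin

section \<open>Exponents and elementary kernel estimates\<close>

definition \<gamma> :: real where "\<gamma> = \<beta> / (\<beta> - 1)"
definition \<delta> :: real where "\<delta> = 1 / (\<beta> - 1)"
definition \<nu> :: real where "\<nu> = \<alpha> / \<beta>"
text \<open>The exponent of the heat kernel bounds with the powers of time collected, using that
  \<gamma> / \<beta> equals \<delta>. It is the cost of covering the distance \<open>r\<close> in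
  time \<open>t\<close>; multiplied by \<open>t powr \<delta> / C2\<close> it becomes the power of
  the distance in the limit.\<close>

definition action :: "real \<Rightarrow> real \<Rightarrow> real" where "action r t = C2 * (r powr \<gamma> / t powr \<delta>)"

lemma exponents: "0 < \<gamma>" "0 < \<delta>" "0 < \<nu>" "\<gamma> / \<beta> = \<delta>" "\<delta> * (\<beta> - 1) = 1"
  using \<beta> \<alpha> by (auto simp: \<gamma>_def \<delta>_def \<nu>_def)

lemma action_eq: "0 < t \<Longrightarrow> 0 \<le> r \<Longrightarrow> C2 * (r / t powr (1 / \<beta>)) powr (\<beta> / (\<beta> - 1)) = action r t"
proof -
  assume t: "0 < t" "0 \<le> r"
  have "(r / t powr (1 / \<beta>)) powr \<gamma> = r powr \<gamma> / t powr (\<gamma> / \<beta>)"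
    using t by (simp add: powr_divide powr_powr)
  then show ?thesis using exponents(4) by (simp add: action_def \<gamma>_def[symmetric])
qed

lemma action_nonneg: "0 < t \<Longrightarrow> 0 \<le> action r t"
  using pos by (simp add: action_def)

lemma action_mono: "0 \<le> r \<Longrightarrow> r \<le> r' \<Longrightarrow> 0 < t \<Longrightarrow> action r t \<le> action r' t"
  using pos exponents by (auto simp: action_def intro!: mult_left_mono divide_right_mono powr_mono2)

lemma action_antimono: "0 < t \<Longrightarrow> t \<le> t' \<Longrightarrow> action r t' \<le> action r t"
  using pos exponents unfolding action_def
  by (intro mult_left_mono divide_left_mono powr_mono2) (auto simp: mult_pos_pos)

lemma p_lower: "0 < t \<Longrightarrow> t \<le> T \<Longrightarrow> c / t powr \<nu> * exp (- action (dist y z) t) \<le> p t y z"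
  using bounds[of t y z] action_eq[of t "dist y z"] by (simp add: \<nu>_def)

lemma p_upper: "0 < t \<Longrightarrow> t \<le> T \<Longrightarrow> p t y z \<le> C / t powr \<nu> * exp (- action (dist y z) t)"
  using bounds[of t y z] action_eq[of t "dist y z"] by (simp add: \<nu>_def)

lemma p_bounded: "0 < t \<Longrightarrow> t \<le> T \<Longrightarrow> p t y z \<le> C / t powr \<nu>"
proof -
  assume t: "0 < t" "t \<le> T"
  have "C / t powr \<nu> * exp (- action (dist y z) t) \<le> C / t powr \<nu> * 1"
    using pos t action_nonneg by (intro mult_left_mono) auto
  with p_upper[OF t, of y z] show ?thesis by simp
qed

lemma emeasure_kern_density:
  "0 < t \<Longrightarrow> W \<in> sets borel \<Longrightarrow> emeasure (kern X t y) W = (\<integral>\<^sup>+z. ennreal (p t y z) * indicator W z \<partial>\<mu>)"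
  by (simp add: kern_density emeasure_density[OF p_measurable_mu])

text \<open>The quotient of the lower bound at time \<open>2 * s\<close> by the upper bound at time
  \<open>s\<close>: the prefactors give \<open>c / C\<close> and the power of 2, and
  \<open>exp (- C2)\<close> bounds the exponential from below on a ball of radius
  \<open>s powr (1 / \<beta>)\<close>.\<close>

definition mass_bound :: real where "mass_bound = c / C * 2 powr (- \<nu>) * exp (- C2)"

lemma mass_bound_pos: "0 < mass_bound"
  using pos by (simp add: mass_bound_def)

text \<open>Compare \<open>p (2 * s)\<close> with \<open>p s\<close> through the
  Chapman-Kolmogorov identity on a ball of radius \<open>s powr (1 / \<beta>)\<close>.\<close>

lemma kern_mass:
  assumes s: "0 < s" "2 * s \<le> T"
  shows "ennreal mass_bound \<le> emeasure (kern X s y) UNIV"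
proof -
  define W where "W = ball y (s powr (1 / \<beta>))"
  have W: "W \<in> sets borel" by (simp add: W_def)
  interpret K: subprob_space "kern X s y" by (rule subprob_kern)
  have "0 < emeasure \<mu> W"
    using full s unfolding W_def full_support_def by (metis open_ball centre_in_ball empty_iff powr_gt_zero less_irrefl)
  then obtain w where w: "emeasure \<mu> W = ennreal w" "0 < w"
    using ball_finite[of y "s powr (1 / \<beta>)"] unfolding W_def by (cases "emeasure \<mu> (ball y (s powr (1 / \<beta>)))") auto
  obtain m where m: "emeasure (kern X s y) UNIV = ennreal m" "0 \<le> m"
    using K.emeasure_finite[of UNIV] by (cases "emeasure (kern X s y) UNIV") auto
  define k where "k = c / (2 * s) powr \<nu> * exp (- C2)"
  have k: "0 \<le> k" using pos by (simp add: k_def)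
  have low: "k \<le> p (2 * s) y z" if "z \<in> W" for z
  proof -
    have "dist y z powr \<gamma> \<le> (s powr (1 / \<beta>)) powr \<gamma>"
      using that exponents by (intro powr_mono2) (auto simp: W_def)
    also have "\<dots> = s powr \<delta>" using exponents(4) by (simp add: powr_powr)
    also have "\<dots> \<le> (2 * s) powr \<delta>" using s exponents by (intro powr_mono2) auto
    finally have "dist y z powr \<gamma> / (2 * s) powr \<delta> \<le> 1"
      using s by (simp add: divide_le_eq_1)
    then have "action (dist y z) (2 * s) \<le> C2"
      using pos unfolding action_def by (intro mult_left_le) auto
    then have "k \<le> c / (2 * s) powr \<nu> * exp (- action (dist y z) (2 * s))"
      unfolding k_def using pos by (intro mult_left_mono) auto
    also have "\<dots> \<le> p (2 * s) y z" using s by (intro p_lower) auto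
    finally show ?thesis .
  qed
  have "ennreal (k * w) = (\<integral>\<^sup>+z. ennreal k * indicator W z \<partial>\<mu>)"
    using W w k by (simp add: nn_integral_cmult_indicator ennreal_mult)
  also have "\<dots> \<le> (\<integral>\<^sup>+z. ennreal (p (2 * s) y z) * indicator W z \<partial>\<mu>)"
    using low by (intro nn_integral_mono) (auto simp: indicator_def ennreal_leI)
  also have "\<dots> = emeasure (kern X (2 * s) y) W"
    using s W by (subst emeasure_kern_density) auto
  also have "\<dots> = (\<integral>\<^sup>+z. indicator W z \<partial>kern X (s + s) y)"
    using W by (simp only: mult_2 nn_integral_indicator sets_kern)
  also have "\<dots> = (\<integral>\<^sup>+z. emeasure (kern X s z) W \<partial>kern X s y)"
    using s W by (subst chapman_kolmogorov) auto
  also have "\<dots> \<le> (\<integral>\<^sup>+z. ennreal (C / s powr \<nu> * w) \<partial>kern X s y)"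
  proof (rule nn_integral_mono)
    fix z
    have "emeasure (kern X s z) W = (\<integral>\<^sup>+v. ennreal (p s z v) * indicator W v \<partial>\<mu>)"
      by (rule emeasure_kern_density[OF s(1) W])
    also have "\<dots> \<le> (\<integral>\<^sup>+v. ennreal (C / s powr \<nu>) * indicator W v \<partial>\<mu>)"
      using p_bounded s by (intro nn_integral_mono mult_right_mono ennreal_leI) auto
    also have "\<dots> = ennreal (C / s powr \<nu>) * ennreal w"
      using W w by (simp add: nn_integral_cmult_indicator)
    also have "\<dots> = ennreal (C / s powr \<nu> * w)"
      using w pos by (intro ennreal_mult[symmetric]) auto
    finally show "emeasure (kern X s z) W \<le> ennreal (C / s powr \<nu> * w)" .
  qed
  also have "\<dots> = ennreal (C / s powr \<nu> * w) * ennreal m"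
    using m by simp
  also have "\<dots> = ennreal (C / s powr \<nu> * w * m)"
    using m w pos by (intro ennreal_mult[symmetric]) auto
  finally have "k * w \<le> C / s powr \<nu> * w * m"
    using m w pos by (subst (asm) ennreal_le_iff) auto
  \<comment> \<open>The volume \<open>w\<close> of the ball occurs on both sides and cancels, which
    makes the bound uniform in \<open>s\<close> and \<open>y\<close>.\<close>
  then have "k * w \<le> (C / s powr \<nu> * m) * w" by (simp only: mult_ac)
  then have "k \<le> C / s powr \<nu> * m" by (rule mult_right_le_imp_le) (rule w(2))
  then have "k / (C / s powr \<nu>) \<le> m" using pos s by (simp add: field_simps)
  moreover have "k / (C / s powr \<nu>) = mass_bound"
    using pos s by (simp add: k_def mass_bound_def powr_mult powr_minus field_simps)
  ultimately show ?thesis using m by (simp add: ennreal_leI)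
qed

text \<open>The time t' = t / \<eta> powr (\<beta> - 1) is chosen so that the action at t' is \<eta>
  times the action at \<open>t\<close>. Splitting off this part of the exponent compares
  \<open>p t\<close> with the lower bound for \<open>p t'\<close>, whose integral is at most 1; the
  part 1 - \<eta> remains as decay. The constant is the ratio of the prefactors at the two
  times.\<close>

lemma kern_tail:
  assumes \<eta>: "0 < \<eta>" "\<eta> < 1" and t: "0 < t" "t / \<eta> powr (\<beta> - 1) \<le> T" and r: "0 \<le> r"
  shows "emeasure (kern X t y) {z. r \<le> dist y z}
    \<le> ennreal (C / c * (1 / \<eta> powr (\<beta> - 1)) powr \<nu> * exp (- (1 - \<eta>) * action r t))"
proof -
  define t' where "t' = t / \<eta> powr (\<beta> - 1)"
  have t': "0 < t'" "t' \<le> T" using t \<eta> by (auto simp: t'_def)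
  have "\<eta> powr (\<beta> - 1) \<le> 1" using \<eta> \<beta> by (intro powr_le1) auto
  then have tt': "t \<le> t'" using t \<eta> by (simp add: t'_def field_simps)
  have "t' powr \<delta> = t powr \<delta> / \<eta>"
    using t \<eta> exponents(5) by (simp add: t'_def powr_divide powr_powr mult.commute)
  then have act: "action d t' = \<eta> * action d t" for d
    by (simp add: action_def)
  define K where "K = C / c * (1 / \<eta> powr (\<beta> - 1)) powr \<nu>"
  have K: "0 \<le> K" using pos by (simp add: K_def)
  have K_eq: "C / t powr \<nu> = K * (c / t' powr \<nu>)"
    using pos t \<eta> by (simp add: K_def t'_def powr_divide field_simps)
  let ?W = "{z. r \<le> dist y z}"
  have W: "?W \<in> sets borel" by measurable
  have le: "p t y z \<le> K * exp (- (1 - \<eta>) * action r t) * p t' y z" if "r \<le> dist y z" for z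
  proof -
    let ?d = "dist y z"
    have "- action ?d t = - (1 - \<eta>) * action ?d t + - action ?d t'" by (simp add: act algebra_simps)
    then have e: "exp (- action ?d t) = exp (- (1 - \<eta>) * action ?d t) * exp (- action ?d t')"
      by (metis exp_add)
    have "p t y z \<le> C / t powr \<nu> * exp (- action ?d t)"
      using t tt' t' by (intro p_upper) auto
    also have "\<dots> = K * exp (- (1 - \<eta>) * action ?d t) * (c / t' powr \<nu> * exp (- action ?d t'))"
      unfolding K_eq e by (simp only: mult_ac)
    also have "\<dots> \<le> K * exp (- (1 - \<eta>) * action ?d t) * p t' y z"
      using K t' by (intro mult_left_mono p_lower) auto
    also have "\<dots> \<le> K * exp (- (1 - \<eta>) * action r t) * p t' y z"
    proof (intro mult_right_mono mult_left_mono)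
      have "(1 - \<eta>) * action r t \<le> (1 - \<eta>) * action ?d t"
        using \<eta> r t that by (intro mult_left_mono action_mono) auto
      then show "exp (- (1 - \<eta>) * action ?d t) \<le> exp (- (1 - \<eta>) * action r t)"
        by (simp only: mult_minus_left exp_le_cancel_iff neg_le_iff_le)
    qed (use K p_nonneg t' in auto)
    finally show ?thesis .
  qed
  have "emeasure (kern X t y) ?W = (\<integral>\<^sup>+z. ennreal (p t y z) * indicator ?W z \<partial>\<mu>)"
    by (rule emeasure_kern_density[OF t(1) W])
  also have "\<dots> \<le> (\<integral>\<^sup>+z. ennreal (K * exp (- (1 - \<eta>) * action r t)) * ennreal (p t' y z) \<partial>\<mu>)"
  proof (rule nn_integral_mono)
    fix z
    show "ennreal (p t y z) * indicator ?W z \<le> ennreal (K * exp (- (1 - \<eta>) * action r t)) * ennreal (p t' y z)"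
      using le[of z] K p_nonneg[OF t'(1), of y z]
      by (auto simp: indicator_def ennreal_mult[symmetric] intro!: ennreal_leI)
  qed
  also have "\<dots> = ennreal (K * exp (- (1 - \<eta>) * action r t)) * (\<integral>\<^sup>+z. ennreal (p t' y z) \<partial>\<mu>)"
    by (rule nn_integral_cmult[OF p_measurable_mu[OF t'(1)]])
  also have "(\<integral>\<^sup>+z. ennreal (p t' y z) \<partial>\<mu>) = emeasure (kern X t' y) UNIV"
    using t' by (simp add: emeasure_kern_density)
  also have "\<dots> \<le> 1"
    using subprob_space.emeasure_space_le_1[OF subprob_kern, of t' y] by simp
  finally show ?thesis by (simp add: K_def mult_left_mono)
qed

lemma exp_action_tendsto:
  assumes "0 < r" "0 < b"
  shows "((\<lambda>t. exp (- b * action r t)) \<longlongrightarrow> 0) (at_right 0)"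
proof -
  have "filterlim (\<lambda>t::real. t powr \<delta>) (at_right 0) (at_right 0)"
  proof -
    have "((\<lambda>t::real. t powr \<delta>) \<longlongrightarrow> 0 powr \<delta>) (at_right 0)"
      using exponents(2) by (intro tendsto_powr' tendsto_ident_at tendsto_const) (auto simp: eventually_at_right_less[THEN eventually_mono])
    then show ?thesis
      unfolding filterlim_at using exponents(2)
      by (auto simp: eventually_at_right_less[THEN eventually_mono])
  qed
  then have "filterlim (\<lambda>t::real. inverse (t powr \<delta>)) at_top (at_right 0)"
    by (rule filterlim_compose[OF filterlim_inverse_at_top_right])
  then have "filterlim (\<lambda>t::real. b * C2 * r powr \<gamma> * inverse (t powr \<delta>)) at_top (at_right 0)"
    using assms pos by (intro filterlim_tendsto_pos_mult_at_top[OF tendsto_const]) auto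
  then have "filterlim (\<lambda>t. b * action r t) at_top (at_right 0)"
    by (simp add: action_def field_simps)
  then show ?thesis
    using filterlim_compose[OF exp_at_bot filterlim_compose[OF filterlim_uminus_at_bot_at_top]] by simp
qed

text \<open>From the total mass, bounded below by \<open>mass_bound\<close>, the tail outside the
  ball is subtracted. \<open>kern_tail\<close> with parameter 1/2 makes the tail smaller than half
  of it for small times, uniformly in \<open>y\<close>.\<close>

lemma kern_ball:
  assumes "0 < \<epsilon>"
  shows "\<exists>t0>0. \<forall>s y. 0 < s \<longrightarrow> s \<le> t0 \<longrightarrow> ennreal (mass_bound / 2) \<le> emeasure (kern X s y) (ball y \<epsilon>)"
proof -
  define K where "K = C / c * (1 / (1 / 2) powr (\<beta> - 1)) powr \<nu>"
  have "((\<lambda>t. K * exp (- (1 / 2) * action \<epsilon> t)) \<longlongrightarrow> K * 0) (at_right 0)"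
    using assms by (intro tendsto_mult_left exp_action_tendsto) auto
  then have "\<forall>\<^sub>F t in at_right 0. K * exp (- (1 / 2) * action \<epsilon> t) < mass_bound / 2"
    using mass_bound_pos by (intro order_tendstoD) auto
  then obtain t1 where t1: "0 < t1" "\<And>t. 0 < t \<Longrightarrow> t < t1 \<Longrightarrow> K * exp (- (1 / 2) * action \<epsilon> t) < mass_bound / 2"
    unfolding eventually_at_right_field by auto
  \<comment> \<open>The bound \<open>T / 2\<close> serves \<open>kern_mass\<close>, which looks at
    time \<open>2 * s\<close>; the last bound keeps the comparison time of \<open>kern_tail\<close>
    below \<open>T\<close>.\<close>
  define t0 where "t0 = min (t1 / 2) (min (T / 2) (T * (1 / 2) powr (\<beta> - 1)))"
  have "ennreal (mass_bound / 2) \<le> emeasure (kern X s y) (ball y \<epsilon>)" if s: "0 < s" "s \<le> t0" for s y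
  proof -
    interpret K: subprob_space "kern X s y" by (rule subprob_kern)
    let ?W = "{z. \<epsilon> \<le> dist y z}"
    have W: "?W \<in> sets borel" by measurable
    have "emeasure (kern X s y) ?W \<le> ennreal (C / c * (1 / (1 / 2) powr (\<beta> - 1)) powr \<nu> * exp (- (1 - 1 / 2) * action \<epsilon> s))"
      using s assms by (intro kern_tail) (auto simp: t0_def field_simps)
    also have "\<dots> \<le> ennreal (mass_bound / 2)"
      using t1(2)[of s] s t1(1) by (intro ennreal_leI) (simp add: K_def t0_def)
    finally have tail: "emeasure (kern X s y) ?W \<le> ennreal (mass_bound / 2)" .
    have "ennreal (mass_bound / 2) + ennreal (mass_bound / 2) = ennreal mass_bound"
      using mass_bound_pos by (simp flip: ennreal_plus)
    also have "\<dots> \<le> emeasure (kern X s y) UNIV"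
      using s by (intro kern_mass) (auto simp: t0_def)
    also have "UNIV = ball y \<epsilon> \<union> ?W" by (auto simp: not_less)
    also have "emeasure (kern X s y) (ball y \<epsilon> \<union> ?W) = emeasure (kern X s y) (ball y \<epsilon>) + emeasure (kern X s y) ?W"
      using W by (intro plus_emeasure[symmetric]) auto
    also have "\<dots> \<le> emeasure (kern X s y) (ball y \<epsilon>) + ennreal (mass_bound / 2)"
      by (intro add_left_mono tail)
    also have "\<dots> = ennreal (mass_bound / 2) + emeasure (kern X s y) (ball y \<epsilon>)"
      by (rule add.commute)
    finally show ?thesis by (simp add: ennreal_add_left_cancel_le)
  qed
  moreover have "0 < t0" using t1(1) pos by (simp add: t0_def)
  ultimately show ?thesis by blast
qed

text \<open>A path at distance more than \<open>r\<close> is, with probability at least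
  \<open>mass_bound / 2\<close>, within \<epsilon> of that place after the remaining time. Dividing
  the tail at radius \<open>r - \<epsilon>\<close> by this probability gives the constant.\<close>

lemma exit_bound:
  assumes \<eta>: "0 < \<eta>" "\<eta> < 1" and \<epsilon>: "0 < \<epsilon>" "\<epsilon> \<le> r"
  obtains K t0 where "0 < K" "0 < t0"
    "\<And>t y. 0 < t \<Longrightarrow> t \<le> t0 \<Longrightarrow>
      emeasure (law X y) (hits {z. r < dist y z} {0..<t}) \<le> ennreal (K * exp (- (1 - \<eta>) * action (r - \<epsilon>) t))"
proof -
  obtain t1 where t1: "0 < t1" "\<And>s y. 0 < s \<Longrightarrow> s \<le> t1 \<Longrightarrow> ennreal (mass_bound / 2) \<le> emeasure (kern X s y) (ball y \<epsilon>)"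
    using kern_ball[OF \<epsilon>(1)] by blast
  define K where "K = C / c * (1 / \<eta> powr (\<beta> - 1)) powr \<nu>"
  have K: "0 < K" using pos \<eta> by (simp add: K_def)
  define t0 where "t0 = min t1 (T * \<eta> powr (\<beta> - 1))"
  have "emeasure (law X y) (hits {z. r < dist y z} {0..<t}) \<le> ennreal (2 / mass_bound * K * exp (- (1 - \<eta>) * action (r - \<epsilon>) t))"
    if t: "0 < t" "t \<le> t0" for t y
  proof -
    let ?U = "{z. r < dist y z}" and ?W = "{z. r - \<epsilon> \<le> dist y z}"
    have U: "open ?U" by (intro open_Collect_less continuous_intros)
    have W: "?W \<in> sets borel" by measurable
    have "ennreal (mass_bound / 2) * emeasure (law X y) (hits ?U {0..<t}) \<le> emeasure (kern X t y) ?W"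
    proof (rule emeasure_hits_open_le[OF U W t(1)])
      fix u z assume u: "0 < u" "u \<le> t" and z: "z \<in> ?U"
      have "ball z \<epsilon> \<subseteq> ?W"
      proof
        fix w assume "w \<in> ball z \<epsilon>"
        moreover have "dist y z \<le> dist y w + dist z w" by (metis dist_triangle dist_commute)
        ultimately show "w \<in> ?W" using z by auto
      qed
      then have "emeasure (kern X u z) (ball z \<epsilon>) \<le> emeasure (kern X u z) ?W"
        using W by (intro emeasure_mono) auto
      then show "ennreal (mass_bound / 2) \<le> emeasure (kern X u z) ?W"
        using t1(2)[of u z] u t by (auto simp: t0_def)
    qed
    also have "\<dots> \<le> ennreal (K * exp (- (1 - \<eta>) * action (r - \<epsilon>) t))"
      unfolding K_def using t \<eta> \<epsilon> by (intro kern_tail) (auto simp: t0_def field_simps)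
    finally have "ennreal (2 / mass_bound) * (ennreal (mass_bound / 2) * emeasure (law X y) (hits ?U {0..<t}))
        \<le> ennreal (2 / mass_bound) * ennreal (K * exp (- (1 - \<eta>) * action (r - \<epsilon>) t))"
      by (rule mult_left_mono) simp
    moreover have "ennreal (2 / mass_bound) * ennreal (mass_bound / 2) = 1"
      using mass_bound_pos by (simp flip: ennreal_mult)
    ultimately show ?thesis
      using mass_bound_pos K by (simp add: mult.assoc[symmetric] ennreal_mult[symmetric])
  qed
  moreover have "0 < 2 / mass_bound * K" "0 < t0"
    using K mass_bound_pos t1 pos \<eta> by (auto simp: t0_def)
  ultimately show ?thesis by (rule that[rotated 2])
qed

section \<open>Lower bound on hitting probabilities\<close>

lemma telescope:
  fixes V :: "real \<Rightarrow> ennreal" and g :: "real \<Rightarrow> ennreal"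
  assumes "\<And>s. 0 < s \<Longrightarrow> V s = V (s + h) + g s" "0 < s" "0 < h"
  shows "V s = V (s + real n * h) + (\<Sum>k<n. g (s + real k * h))"
proof (induction n)
  case (Suc n)
  have "0 < s + real n * h" using assms by (simp add: add_pos_nonneg)
  from assms(1)[OF this] have "V (s + real n * h) = V (s + real (Suc n) * h) + g (s + real n * h)"
    by (simp add: algebra_simps)
  with Suc show ?case by (simp add: ac_simps)
qed simp

text \<open>The semigroup identity carries constancy from (0, T) to all positive times. Steps of
  \<open>T / 4\<close> are short enough for \<open>?h + ?h\<close> and for \<open>s + ?h\<close>
  with \<open>s < T / 2\<close> to stay below \<open>T\<close>. The discount then bounds
  \<open>V s y\<close> by exp (- u) for arbitrarily large u.\<close>

lemma constant_potential_eq_0: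
  fixes V :: "real \<Rightarrow> 'e \<Rightarrow> ennreal"
  assumes le: "\<And>s y. 0 < s \<Longrightarrow> V s y \<le> ennreal (exp (- s))"
    and semi: "\<And>s h y. 0 < s \<Longrightarrow> 0 < h \<Longrightarrow> V (s + h) y = ennreal (exp (- s)) * (\<integral>\<^sup>+z. V h z \<partial>kern X s y)"
    and const: "\<And>s t y. 0 < s \<Longrightarrow> s \<le> t \<Longrightarrow> t < T \<Longrightarrow> V s y = V t y"
    and s: "0 < s"
  shows "V s y = 0"
proof -
  let ?h = "T / 4"
  have step: "V s y = V (s + ?h) y" if "0 < s" for s y
  proof (cases "s < T / 2")
    case True
    then show ?thesis using that pos by (intro const) auto
  next
    case False
    define u where "u = s - ?h"
    have u: "0 < u" using False pos by (simp add: u_def)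
    have eq: "s = u + ?h" "s + ?h = u + (?h + ?h)" by (simp_all add: u_def)
    have "V ?h z = V (?h + ?h) z" for z
      using pos by (intro const) auto
    moreover have "V (u + ?h) y = ennreal (exp (- u)) * (\<integral>\<^sup>+z. V ?h z \<partial>kern X u y)"
      "V (u + (?h + ?h)) y = ennreal (exp (- u)) * (\<integral>\<^sup>+z. V (?h + ?h) z \<partial>kern X u y)"
      using pos u by (intro semi; simp)+
    ultimately show ?thesis
      unfolding eq(2) unfolding eq(1) by simp
  qed
  have "V s y = V (s + real n * ?h) y" for n
  proof (induction n)
    case (Suc n)
    have "0 < s + real n * ?h" using s pos by (simp add: add_pos_nonneg)
    from step[OF this, of y] have "V (s + real n * ?h) y = V (s + real n * ?h + ?h) y" .
    moreover have "s + real n * ?h + ?h = s + real (Suc n) * ?h" by (simp add: field_simps)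
    ultimately show ?case using Suc by metis
  qed simp
  then have bound: "V s y \<le> ennreal (exp (- (s + real n * ?h)))" for n
    using le[of "s + real n * ?h" y] s pos by (simp add: add_pos_nonneg)
  have "(\<lambda>n. ennreal (exp (- (s + real n * ?h)))) \<longlonglongrightarrow> ennreal 0"
  proof (rule tendsto_ennrealI)
    show "(\<lambda>n. exp (- (s + real n * ?h))) \<longlonglongrightarrow> 0"
      using pos by real_asymp
  qed
  then have "V s y \<le> ennreal 0"
    by (rule LIMSEQ_le_const) (use bound in auto)
  then show ?thesis by simp
qed

text \<open>The exponential of a negative power of \<open>h\<close> vanishes faster than any power
  of \<open>h\<close>. The linear rate is the one to beat, since an error of order
  \<open>e * h\<close> per grid step sums up to order \<open>e\<close>.\<close>

lemma small_tail:
  assumes r: "0 < r" and e: "0 < e" and K: "0 < K" and b: "0 < b"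
  shows "\<exists>h0>0. \<forall>h. 0 < h \<longrightarrow> h < h0 \<longrightarrow> K * exp (- b * action r (2 * h)) \<le> e * h"
proof -
  have "((\<lambda>h::real. exp (- (b * C2 * r powr \<gamma>) / (2 * h) powr \<delta>) / h) \<longlongrightarrow> 0) (at_right 0)"
  proof -
    define q where "q = b * C2 * r powr \<gamma>"
    have q: "0 < q" using r b pos by (simp add: q_def)
    have d: "0 < \<delta>" by (rule exponents)
    show ?thesis unfolding q_def[symmetric] using q d by real_asymp
  qed
  then have "\<forall>\<^sub>F h in at_right 0. exp (- (b * C2 * r powr \<gamma>) / (2 * h) powr \<delta>) / h < e / K"
    using e K by (intro order_tendstoD) auto
  then obtain h0 where h0: "0 < h0"
    "\<And>h. 0 < h \<Longrightarrow> h < h0 \<Longrightarrow> exp (- (b * C2 * r powr \<gamma>) / (2 * h) powr \<delta>) / h < e / K"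
    unfolding eventually_at_right_field by auto
  have "K * exp (- b * action r (2 * h)) \<le> e * h" if "0 < h" "h < h0" for h
    using h0(2)[OF that] that K by (simp add: action_def field_simps)
  with h0(1) show ?thesis by blast
qed

text \<open>Triangle inequality. The time is doubled so that the closed end \<open>h\<close> lies
  inside the half-open interval used by the exit bounds.\<close>

lemma hits_outside:
  assumes A: "A \<subseteq> ball x R0" and z: "z \<notin> ball x R" and R: "0 < R - R0" and h: "0 < h"
  shows "hits A {0<..h} \<subseteq> hits {w. (R - R0) / 2 < dist z w} {0..<2 * h}"
proof
  fix \<omega> assume "\<omega> \<in> hits A {0<..h}"
  then obtain s where s: "\<omega> \<in> \<Omega>" "0 < s" "s \<le> h" "visits X A s \<omega>" by (auto simp: hits_def)
  have "A \<subseteq> {w. (R - R0) / 2 < dist z w}"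
  proof
    fix w assume "w \<in> A"
    then have "dist x w < R0" using A by auto
    moreover have "R \<le> dist x w + dist z w" using z by (metis dist_commute dist_triangle mem_ball not_less order_trans)
    ultimately show "w \<in> {w. (R - R0) / 2 < dist z w}" using R by (simp add: field_simps)
  qed
  then show "\<omega> \<in> hits {w. (R - R0) / 2 < dist z w} {0..<2 * h}"
    using s h visits_mono[OF s(4)] by (auto simp: hits_def intro!: bexI[of _ s])
qed

text \<open>On \<open>S\<close> the density is at most its on-diagonal bound; outside
  \<open>S\<close> the integrand is at most \<rho> and the kernel has mass at most 1.\<close>

lemma kern_integral_upper:
  assumes u: "0 < u" "u \<le> T" and G: "G \<in> borel_measurable borel" and S: "S \<in> sets borel"
    and out: "AE z in \<mu>. z \<notin> S \<longrightarrow> G z \<le> \<rho>"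
  shows "(\<integral>\<^sup>+z. G z \<partial>kern X u y) \<le> ennreal (C / u powr \<nu>) * (\<integral>\<^sup>+z. G z * indicator S z \<partial>\<mu>) + \<rho>"
proof -
  have GS: "(\<lambda>z. G z * indicator S z) \<in> borel_measurable borel" using G S by measurable
  have "(\<integral>\<^sup>+z. G z \<partial>kern X u y) \<le> (\<integral>\<^sup>+z. G z * indicator S z + \<rho> \<partial>kern X u y)"
  proof (rule nn_integral_mono_AE)
    show "AE z in kern X u y. G z \<le> G z * indicator S z + \<rho>"
      using AE_kern[OF u(1) out, of y] by eventually_elim (auto simp: indicator_def)
  qed
  also have "\<dots> = (\<integral>\<^sup>+z. G z * indicator S z \<partial>kern X u y) + \<rho> * emeasure (kern X u y) UNIV"
    using GS by (subst nn_integral_add) (auto cong: measurable_cong_sets)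
  also have "\<dots> \<le> ennreal (C / u powr \<nu>) * (\<integral>\<^sup>+z. G z * indicator S z \<partial>\<mu>) + \<rho>"
  proof (rule add_mono)
    have "(\<integral>\<^sup>+z. G z * indicator S z \<partial>kern X u y) = (\<integral>\<^sup>+z. ennreal (p u y z) * (G z * indicator S z) \<partial>\<mu>)"
      by (rule nn_integral_kern_density[OF u(1) GS])
    also have "\<dots> \<le> (\<integral>\<^sup>+z. ennreal (C / u powr \<nu>) * (G z * indicator S z) \<partial>\<mu>)"
      using p_bounded[OF u] by (intro nn_integral_mono mult_right_mono ennreal_leI) auto
    also have "\<dots> = ennreal (C / u powr \<nu>) * (\<integral>\<^sup>+z. G z * indicator S z \<partial>\<mu>)"
      using GS by (intro nn_integral_cmult) (simp cong: measurable_cong_sets)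
    finally show "(\<integral>\<^sup>+z. G z * indicator S z \<partial>kern X u y) \<le> ennreal (C / u powr \<nu>) * (\<integral>\<^sup>+z. G z * indicator S z \<partial>\<mu>)" .
    have "emeasure (kern X u y) UNIV \<le> 1"
      using subprob_space.emeasure_space_le_1[OF subprob_kern, of u y] by simp
    then show "\<rho> * emeasure (kern X u y) UNIV \<le> \<rho>"
      by (metis mult_left_mono mult.right_neutral zero_le)
  qed
  finally show ?thesis .
qed

lemma kern_integral_lower:
  assumes u: "0 < u" "u \<le> T" and G: "G \<in> borel_measurable borel"
  shows "ennreal (c / u powr \<nu> * exp (- action R u)) * (\<integral>\<^sup>+z. G z * indicator (ball y R) z \<partial>\<mu>)
    \<le> (\<integral>\<^sup>+z. G z \<partial>kern X u y)"
proof -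
  have GS: "(\<lambda>z. G z * indicator (ball y R) z) \<in> borel_measurable borel"
    using G by (intro borel_measurable_times_ennreal borel_measurable_indicator) auto
  have "ennreal (c / u powr \<nu> * exp (- action R u)) * (\<integral>\<^sup>+z. G z * indicator (ball y R) z \<partial>\<mu>)
    = (\<integral>\<^sup>+z. ennreal (c / u powr \<nu> * exp (- action R u)) * (G z * indicator (ball y R) z) \<partial>\<mu>)"
    using GS by (intro nn_integral_cmult[symmetric]) (simp cong: measurable_cong_sets)
  also have "\<dots> \<le> (\<integral>\<^sup>+z. ennreal (p u y z) * G z \<partial>\<mu>)"
  proof (rule nn_integral_mono)
    fix z
    show "ennreal (c / u powr \<nu> * exp (- action R u)) * (G z * indicator (ball y R) z) \<le> ennreal (p u y z) * G z"
    proof (cases "z \<in> ball y R")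
      case True
      then have "c / u powr \<nu> * exp (- action R u) \<le> c / u powr \<nu> * exp (- action (dist y z) u)"
        using pos u by (intro mult_left_mono) (auto intro!: action_mono)
      also have "\<dots> \<le> p u y z" by (rule p_lower[OF u])
      finally show ?thesis using True by (auto intro!: mult_right_mono ennreal_leI)
    qed simp
  qed
  also have "\<dots> = (\<integral>\<^sup>+z. G z \<partial>kern X u y)"
    by (rule nn_integral_kern_density[symmetric, OF u(1) G])
  finally show ?thesis .
qed

text \<open>The mass that \<open>G h\<close> puts on a ball around \<open>A\<close> is at least of order \<open>h\<close>: otherwise \<open>V\<close> would be constant in
  time, hence zero, and \<open>A\<close> would never be hit.\<close>

lemma potential_mass:
  fixes V G :: "real \<Rightarrow> 'e \<Rightarrow> ennreal"
  assumes A: "A \<subseteq> ball x R0" "R0 < R"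
    and G: "\<And>h. 0 < h \<Longrightarrow> G h \<in> borel_measurable borel"
    and le: "\<And>s y. 0 < s \<Longrightarrow> V s y \<le> ennreal (exp (- s))"
    and anti: "\<And>s t y. 0 < s \<Longrightarrow> s \<le> t \<Longrightarrow> V t y \<le> V s y"
    and semi: "\<And>s h y. 0 < s \<Longrightarrow> 0 < h \<Longrightarrow> V (s + h) y = ennreal (exp (- s)) * (\<integral>\<^sup>+z. V h z \<partial>kern X s y)"
    and step: "\<And>s h y. 0 < s \<Longrightarrow> 0 < h \<Longrightarrow> V s y = V (s + h) y + ennreal (exp (- s)) * (\<integral>\<^sup>+z. G h z \<partial>kern X s y)"
    and hit: "\<And>h. 0 < h \<Longrightarrow> AE z in \<mu>. \<forall>\<Gamma>\<in>sets (events X). hits A {0<..h} \<subseteq> \<Gamma> \<longrightarrow> G h z \<le> emeasure (law X z) \<Gamma>"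
    and nonzero: "0 < s0" "V s0 y0 \<noteq> 0"
  shows "\<exists>m0>0. \<exists>h0>0. \<forall>h. 0 < h \<longrightarrow> h < h0 \<longrightarrow>
    ennreal (m0 * h) \<le> (\<integral>\<^sup>+z. G h z * indicator (ball x R) z \<partial>\<mu>)"
proof (rule ccontr)
  let ?I = "\<lambda>h. \<integral>\<^sup>+z. G h z * indicator (ball x R) z \<partial>\<mu>"
  assume "\<not> ?thesis"
  then have small: "\<exists>h>0. h < h0 \<and> ?I h < ennreal (e * h)" if "0 < e" "0 < h0" for e h0
    using that by (meson not_le)
  define r where "r = (R - R0) / 2"
  have r: "0 < r" using A(2) by (simp add: r_def)
  obtain K t0 where K: "0 < K" "0 < t0" "\<And>t y. 0 < t \<Longrightarrow> t \<le> t0 \<Longrightarrow>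
      emeasure (law X y) (hits {z. r < dist y z} {0..<t}) \<le> ennreal (K * exp (- (1 - 1 / 2) * action (r - r / 2) t))"
    using exit_bound[of "1 / 2" "r / 2" r] r by auto
  \<comment> \<open>To reach \<open>A\<close> from outside \<open>ball x R\<close> within time
    \<open>h\<close> the path has to travel more than \<open>r\<close>, so \<open>G h\<close> is
    dominated there by an exit probability.\<close>
  have out: "AE z in \<mu>. z \<notin> ball x R \<longrightarrow> G h z \<le> ennreal (K * exp (- (1 / 2) * action (r / 2) (2 * h)))"
    if h: "0 < h" "2 * h \<le> t0" for h
    using hit[OF h(1)]
  proof eventually_elim
    case (elim z)
    show ?case
    proof
      assume "z \<notin> ball x R"
      then have "hits A {0<..h} \<subseteq> hits {w. r < dist z w} {0..<2 * h}"
        using A h unfolding r_def by (intro hits_outside) auto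
      moreover have "open {w. r < dist z w}" by (intro open_Collect_less continuous_intros)
      from hits_open_measurable[OF this, of "2 * h"] have "hits {w. r < dist z w} {0..<2 * h} \<in> sets (events X)"
        using h path_events_sub by auto
      ultimately have "G h z \<le> emeasure (law X z) (hits {w. r < dist z w} {0..<2 * h})"
        using elim by blast
      also have "\<dots> \<le> ennreal (K * exp (- (1 / 2) * action (r / 2) (2 * h)))"
        using K(3)[of "2 * h" z] h by simp
      finally show "G h z \<le> ennreal (K * exp (- (1 / 2) * action (r / 2) (2 * h)))" .
    qed
  qed
  have "V s y \<le> V t y" if st: "0 < s" "s \<le> t" "t < T" for s t y
  proof (rule ennreal_le_epsilon)
    fix e' :: real assume e': "0 < e'"
    \<comment> \<open>There are at most \<open>T / h\<close> grid steps; each contributes at most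
      \<open>e * h\<close> times \<open>C / s powr \<nu>\<close> from the ball and another
      \<open>e * h\<close> from outside.\<close>
    define D where "D = T * (C / s powr \<nu> + 1)"
    have D: "0 < D" using pos st by (simp add: D_def add_pos_pos)
    define e where "e = e' / D"
    have e: "0 < e" using e' D by (simp add: e_def)
    obtain h1 where h1: "0 < h1" "\<And>h. 0 < h \<Longrightarrow> h < h1 \<Longrightarrow> K * exp (- (1 / 2) * action (r / 2) (2 * h)) \<le> e * h"
      using small_tail[of "r / 2" e K "1 / 2"] r e K(1) by auto
    \<comment> \<open>Keeping \<open>h\<close> below \<open>T - t\<close> makes all kernel times at
      most \<open>T\<close>, although the last grid point may overshoot \<open>t\<close>.\<close>
    obtain h where h: "0 < h" "h < min h1 (min (t0 / 2) (T - t))" "?I h < ennreal (e * h)"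
      using small[OF e, of "min h1 (min (t0 / 2) (T - t))"] h1(1) K(2) st by auto
    define n where "n = nat \<lceil>(t - s) / h\<rceil>"
    have "0 \<le> (t - s) / h" using st h by simp
    then have "(t - s) / h \<le> real n" "real n < (t - s) / h + 1"
      unfolding n_def by linarith+
    then have n: "t - s \<le> real n * h" "real n * h < t - s + h"
      using h(1) by (simp_all add: field_simps)
    define g where "g u = ennreal (exp (- u)) * (\<integral>\<^sup>+z. G h z \<partial>kern X u y)" for u
    have "V u y = V (u + h) y + g u" if "0 < u" for u
      unfolding g_def by (rule step[OF that h(1)])
    from telescope[of "\<lambda>u. V u y" h g, OF this st(1) h(1)]
    have "V s y = V (s + real n * h) y + (\<Sum>k<n. g (s + real k * h))" .
    also have "\<dots> \<le> V t y + (\<Sum>k<n. ennreal (h * (e * (C / s powr \<nu> + 1))))"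
    proof (intro add_mono sum_mono)
      show "V (s + real n * h) y \<le> V t y" using n st by (intro anti) auto
      fix k assume k: "k \<in> {..<n}"
      let ?u = "s + real k * h"
      have kn: "real k * h \<le> real n * h" using k h by (intro mult_right_mono) auto
      have "0 \<le> real k * h" "h < T - t" using h by auto
      with kn n(2) st have u: "0 < ?u" "s \<le> ?u" "?u \<le> T" by linarith+
      have "g ?u \<le> (\<integral>\<^sup>+z. G h z \<partial>kern X ?u y)"
        unfolding g_def using u(1) mult_right_mono[of "ennreal (exp (- ?u))" 1] by simp
      also have "\<dots> \<le> ennreal (C / ?u powr \<nu>) * ?I h + ennreal (K * exp (- (1 / 2) * action (r / 2) (2 * h)))"
        using u h G out[of h] by (intro kern_integral_upper) auto
      also have "\<dots> \<le> ennreal (C / s powr \<nu>) * ennreal (e * h) + ennreal (e * h)"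
      proof (rule add_mono[OF mult_mono])
        show "ennreal (C / ?u powr \<nu>) \<le> ennreal (C / s powr \<nu>)"
          using pos st u exponents by (intro ennreal_leI divide_left_mono powr_mono2) auto
        show "?I h \<le> ennreal (e * h)" using h(3) by simp
        show "ennreal (K * exp (- (1 / 2) * action (r / 2) (2 * h))) \<le> ennreal (e * h)"
          using h h1(2)[of h] by (intro ennreal_leI) auto
      qed auto
      also have "\<dots> = ennreal (h * (e * (C / s powr \<nu> + 1)))"
        using pos e h by (simp add: algebra_simps flip: ennreal_mult ennreal_plus)
      finally show "g ?u \<le> ennreal (h * (e * (C / s powr \<nu> + 1)))" .
    qed
    also have "(\<Sum>k<n. ennreal (h * (e * (C / s powr \<nu> + 1)))) = ennreal ((real n * h) * (e * (C / s powr \<nu> + 1)))"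
      using h e pos by (simp add: ennreal_of_nat_eq_real_of_nat mult.assoc flip: ennreal_mult)
    also have "\<dots> \<le> ennreal (T * (e * (C / s powr \<nu> + 1)))"
      using n h st e pos by (intro ennreal_leI mult_right_mono) auto
    also have "T * (e * (C / s powr \<nu> + 1)) = e'"
    proof -
      have "T * (e * (C / s powr \<nu> + 1)) = e * D" by (simp add: D_def)
      then show ?thesis using D by (simp add: e_def)
    qed
    finally show "V s y \<le> V t y + ennreal e'" by (simp add: add_left_mono)
  qed
  then have const: "V s y = V t y" if "0 < s" "s \<le> t" "t < T" for s t y
    using that anti by (intro antisym) auto
  have "V s0 y0 = 0"
    by (rule constant_potential_eq_0[OF le semi const nonzero(1)])
  with nonzero(2) show False by simp
qed

text \<open>Each telescoping term is at least the kernel bound at distance \<open>R\<close> times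
  the mass \<open>m0 * h\<close>, and there are \<eta> t / h of them, so the mesh drops out. The
  power \<open>1 - \<nu>\<close> combines the window length with the prefactor of the
  kernel.\<close>

theorem hitting_lower_bound:
  assumes A: "A \<in> sets borel" "A \<subseteq> ball x R0" "R0 < R" "0 < R"
    and nonpolar: "\<not> (\<forall>y. AE \<omega> in law X y. \<forall>t>0. \<not> visits X A t \<omega>)"
    and \<eta>: "0 < \<eta>" "\<eta> < 1"
  obtains M0 t0 where "0 < M0" "0 < t0"
    "\<And>t. 0 < t \<Longrightarrow> t \<le> t0 \<Longrightarrow> ennreal (M0 * (t powr (1 - \<nu>) * exp (- action R ((1 - \<eta>) * t))))
      \<le> emeasure (completion (law X x)) (hits A {(1 - \<eta>) * t<..t})"
proof -
  obtain V G where G: "\<And>h. 0 < h \<Longrightarrow> G h \<in> borel_measurable borel"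
    and le: "\<And>s y. 0 < s \<Longrightarrow> V s y \<le> ennreal (exp (- s))"
    and anti: "\<And>s t y. 0 < s \<Longrightarrow> s \<le> t \<Longrightarrow> V t y \<le> V s y"
    and semi: "\<And>s h y. 0 < s \<Longrightarrow> 0 < h \<Longrightarrow> V (s + h) y = ennreal (exp (- s)) * (\<integral>\<^sup>+z. V h z \<partial>kern X s y)"
    and step: "\<And>s h y. 0 < s \<Longrightarrow> 0 < h \<Longrightarrow> V s y = V (s + h) y + ennreal (exp (- s)) * (\<integral>\<^sup>+z. G h z \<partial>kern X s y)"
    and hit: "\<And>h. 0 < h \<Longrightarrow> AE z in \<mu>. \<forall>\<Gamma>\<in>sets (events X). hits A {0<..h} \<subseteq> \<Gamma> \<longrightarrow> G h z \<le> emeasure (law X z) \<Gamma>"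
    and V_hit: "\<And>s t y \<Gamma>. 0 < s \<Longrightarrow> s \<le> t \<Longrightarrow> \<Gamma> \<in> sets (completion (law X y)) \<Longrightarrow> hits A {s<..t} \<subseteq> \<Gamma> \<Longrightarrow>
      V s y \<le> V t y + emeasure (completion (law X y)) \<Gamma>"
    and V_zero: "\<And>y. (\<And>s. 0 < s \<Longrightarrow> V s y = 0) \<Longrightarrow> AE \<omega> in law X y. \<forall>t>0. \<not> visits X A t \<omega>"
    by (rule hitting_potential[OF A(1)]) blast
  obtain s0 y0 where nz: "0 < s0" "V s0 y0 \<noteq> 0"
    using nonpolar V_zero by blast
  obtain m0 h0 where m0: "0 < m0" "0 < h0"
    "\<And>h. 0 < h \<Longrightarrow> h < h0 \<Longrightarrow> ennreal (m0 * h) \<le> (\<integral>\<^sup>+z. G h z * indicator (ball x R) z \<partial>\<mu>)"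
    using potential_mass[OF A(2,3) G le anti semi step hit nz] by blast
  \<comment> \<open>\<open>exp (- T)\<close> bounds the discount on times up to \<open>T\<close>,
    \<open>c\<close> comes from the kernel, \<open>m0\<close> is the mass of \<open>G h\<close> per
    unit of \<open>h\<close>, and \<eta> is the length of the window relative to
    \<open>t\<close>.\<close>
  define M0 where "M0 = exp (- T) * c * m0 * \<eta>"
  have M0: "0 < M0" using pos m0 \<eta> by (simp add: M0_def)
  have "ennreal (M0 * (t powr (1 - \<nu>) * exp (- action R ((1 - \<eta>) * t))))
      \<le> emeasure (completion (law X x)) (hits A {(1 - \<eta>) * t<..t})" if t: "0 < t" "t \<le> T" for t
  proof -
    define s where "s = (1 - \<eta>) * t"
    have s: "0 < s" "s \<le> t" using t \<eta> by (auto simp: s_def)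
    \<comment> \<open>The mesh has to divide the window exactly and to lie below \<open>h0\<close>;
      otherwise it is arbitrary.\<close>
    obtain n :: nat where n: "\<eta> * t / h0 < real n" using reals_Archimedean2 by blast
    have "0 < \<eta> * t / h0" using \<eta> t m0 by simp
    with n have n0: "0 < n" by (cases n) auto
    define h where "h = \<eta> * t / real n"
    have h: "0 < h" "h < h0" using n n0 \<eta> t m0 by (auto simp: h_def field_simps)
    have sn: "s + real n * h = t" using n0 by (simp add: h_def s_def algebra_simps)
    define g where "g u = ennreal (exp (- u)) * (\<integral>\<^sup>+z. G h z \<partial>kern X u x)" for u
    define q where "q = exp (- T) * (c / t powr \<nu> * exp (- action R s))"
    have q: "0 \<le> q" using pos by (simp add: q_def)
    have "ennreal (M0 * (t powr (1 - \<nu>) * exp (- action R ((1 - \<eta>) * t)))) = (\<Sum>k<n. ennreal (q * (m0 * h)))"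
    proof -
      have "(\<Sum>k<n. ennreal (q * (m0 * h))) = ennreal (real n * (q * (m0 * h)))"
        using q m0 h by (simp add: ennreal_of_nat_eq_real_of_nat flip: ennreal_mult)
      also have "real n * (q * (m0 * h)) = q * m0 * (\<eta> * t)"
        using n0 by (simp add: h_def)
      also have "\<dots> = M0 * (t powr (1 - \<nu>) * exp (- action R ((1 - \<eta>) * t)))"
        using t by (simp add: q_def M0_def s_def powr_diff)
      finally show ?thesis by simp
    qed
    also have "\<dots> \<le> (\<Sum>k<n. g (s + real k * h))"
    proof (rule sum_mono)
      fix k assume k: "k \<in> {..<n}"
      let ?u = "s + real k * h"
      have "real k * h \<le> real n * h" using k h by (intro mult_right_mono) auto
      then have u: "0 < ?u" "s \<le> ?u" "?u \<le> t"
        using sn s h by (auto intro: add_pos_nonneg)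
      have le1: "c / t powr \<nu> * exp (- action R s) \<le> c / ?u powr \<nu> * exp (- action R ?u)"
      proof (rule mult_mono)
        show "c / t powr \<nu> \<le> c / ?u powr \<nu>"
          using pos u exponents t by (intro divide_left_mono powr_mono2) auto
        show "exp (- action R s) \<le> exp (- action R ?u)"
          using action_antimono[OF s(1) u(2), of R] by simp
      qed (use pos in auto)
      have le2: "exp (- T) \<le> exp (- ?u)" using u t by simp
      have "q \<le> exp (- ?u) * (c / ?u powr \<nu> * exp (- action R ?u))"
        unfolding q_def by (rule mult_mono[OF le2 le1]) (use pos in auto)
      then have "ennreal (q * (m0 * h)) \<le> ennreal (exp (- ?u) * (c / ?u powr \<nu> * exp (- action R ?u)) * (m0 * h))"
        using m0 h by (intro ennreal_leI mult_right_mono) auto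
      also have "\<dots> = ennreal (exp (- ?u)) * (ennreal (c / ?u powr \<nu> * exp (- action R ?u)) * ennreal (m0 * h))"
        using pos m0 h by (simp add: mult.assoc flip: ennreal_mult)
      also have "\<dots> \<le> ennreal (exp (- ?u)) * (ennreal (c / ?u powr \<nu> * exp (- action R ?u)) *
          (\<integral>\<^sup>+z. G h z * indicator (ball x R) z \<partial>\<mu>))"
        by (intro mult_left_mono m0(3) h) auto
      also have "\<dots> \<le> g ?u"
        unfolding g_def using u t G h by (intro mult_left_mono kern_integral_lower) auto
      finally show "ennreal (q * (m0 * h)) \<le> g ?u" .
    qed
    finally have sum: "ennreal (M0 * (t powr (1 - \<nu>) * exp (- action R ((1 - \<eta>) * t)))) \<le> (\<Sum>k<n. g (s + real k * h))" .
    have meas: "hits A {s<..t} \<in> sets (completion (law X x))"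
      using s A by (intro hits_law_completion) auto
    have "V u x = V (u + h) x + g u" if "0 < u" for u
      unfolding g_def by (rule step[OF that h(1)])
    from telescope[of "\<lambda>u. V u x" h g, OF this s(1) h(1)]
    have "V s x = V (s + real n * h) x + (\<Sum>k<n. g (s + real k * h))" .
    then have "V t x + (\<Sum>k<n. g (s + real k * h)) \<le> V t x + emeasure (completion (law X x)) (hits A {s<..t})"
      using V_hit[OF s meas] by (simp add: sn)
    moreover have "V t x \<noteq> \<infinity>" using le[of t x] t by (auto simp: top_unique)
    ultimately have "(\<Sum>k<n. g (s + real k * h)) \<le> emeasure (completion (law X x)) (hits A {s<..t})"
      by (simp add: ennreal_add_left_cancel_le del: emeasure_completion)
    with sum show ?thesis by (simp add: s_def)
  qed
  with M0 pos show ?thesis by (intro that[of M0 T]) auto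
qed

section \<open>The small-time limit\<close>

text \<open>Up to a null set \<open>B\<close> may be replaced by its Borel core. The core is
  adequate at positive times only, whence the restriction on \<open>I\<close>.\<close>

lemma hits_nearly_borel:
  assumes B: "B \<in> nearly_borel X" and I: "I \<in> sets borel" "I \<subseteq> {0<..}"
  shows "hits B I \<in> sets (completion (law X x))"
proof -
  obtain B1 where B1: "B1 \<in> sets borel" "B1 \<subseteq> B"
    and ae: "AE \<omega> in law X x. \<forall>t>0. visits X B t \<omega> \<longrightarrow> visits X B1 t \<omega>"
    by (rule nearly_borel_core[OF B]) blast
  have "AE \<omega> in completion (law X x). \<omega> \<in> hits B1 I \<longleftrightarrow> \<omega> \<in> hits B I"
    using AE_completion[OF ae]
  proof eventually_elim
    case (elim \<omega>)
    have "visits X B1 s \<omega> \<longleftrightarrow> visits X B s \<omega>" if "s \<in> I" for s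
      using elim I(2) that visits_mono[OF _ B1(2), of X s \<omega>] by auto
    then show ?case unfolding hits_def by blast
  qed
  moreover have "hits B1 I \<in> sets (completion (law X x))"
    using I by (intro hits_law_completion B1) auto
  moreover have "hits B I \<subseteq> space (completion (law X x))" by (auto simp: hits_def)
  ultimately show ?thesis by (rule completion.in_sets_AE)
qed

text \<open>The infimum need not be attained: a hitting time equal to \<open>t\<close> may come from
  visits strictly after \<open>t\<close> that accumulate at it. Hence the slightly larger
  horizons.\<close>

lemma hitting_time_le_iff:
  assumes w: "\<omega> \<in> \<Omega>" and t: "0 \<le> t"
  shows "hitting_time X B \<omega> \<le> ennreal t \<longleftrightarrow> (\<forall>n::nat. \<omega> \<in> hits B {0<..<t + 1 / (real n + 1)})"
proof
  assume le: "hitting_time X B \<omega> \<le> ennreal t"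
  show "\<forall>n::nat. \<omega> \<in> hits B {0<..<t + 1 / (real n + 1)}"
  proof
    fix n :: nat
    have "ennreal t < ennreal (t + 1 / (real n + 1))" using t by (simp add: ennreal_less_iff)
    with le have "Inf {u. 0 < u \<and> traj X u \<omega> \<in> Some ` B} < ennreal (t + 1 / (real n + 1))"
      by (simp add: hitting_time_def)
    then obtain u where u: "0 < u" "traj X u \<omega> \<in> Some ` B" "u < ennreal (t + 1 / (real n + 1))"
      by (auto simp: Inf_less_iff)
    then obtain s where s: "u = ennreal s" "0 \<le> s" by (cases u) auto
    then show "\<omega> \<in> hits B {0<..<t + 1 / (real n + 1)}"
      using u w by (auto simp: hits_def visits_def ennreal_less_iff intro!: bexI[of _ s])
  qed
next
  assume *: "\<forall>n::nat. \<omega> \<in> hits B {0<..<t + 1 / (real n + 1)}"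
  show "hitting_time X B \<omega> \<le> ennreal t"
  proof (rule ccontr)
    assume "\<not> ?thesis"
    then obtain z where z: "ennreal t < z" "z < hitting_time X B \<omega>" using dense[of "ennreal t"] by (auto simp: not_le)
    then obtain r where r: "z = ennreal r" "0 \<le> r" by (cases z) auto
    have "t < r" using z(1) t by (simp add: r ennreal_less_iff)
    obtain n :: nat where "1 / (r - t) < real n" using reals_Archimedean2 by blast
    then have n: "t + 1 / (real n + 1) < r" using \<open>t < r\<close> by (simp add: field_simps)
    have "\<omega> \<in> hits B {0<..<t + 1 / (real n + 1)}" using * by blast
    then obtain s where s: "0 < s" "s < t + 1 / (real n + 1)" "visits X B s \<omega>"
      by (auto simp: hits_def)
    have "hitting_time X B \<omega> \<le> ennreal s"
      unfolding hitting_time_def using s by (intro Inf_lower) (auto simp: visits_def)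
    also have "\<dots> \<le> z" using s n by (simp add: r ennreal_leI)
    finally show False using z(2) by simp
  qed
qed

lemma hitting_time_infinite:
  assumes "\<forall>t>0. \<not> visits X A t \<omega>" "\<omega> \<in> \<Omega>"
  shows "hitting_time X A \<omega> = \<infinity>"
proof -
  have "u = \<infinity>" if "0 < u" "traj X u \<omega> \<in> Some ` A" for u
    using that assms(1) by (cases u) (auto simp: visits_def)
  moreover have "traj X \<infinity> \<omega> = None" using rp assms(2) by (simp add: borel_right_process_def)
  ultimately have empty: "{u. 0 < u \<and> traj X u \<omega> \<in> Some ` A} = {}" by force
  show ?thesis unfolding hitting_time_def empty by (simp add: infinity_ennreal_def)
qed

section \<open>Hitting probabilities at small times\<close>

abbreviation hit_event :: "'e set \<Rightarrow> real \<Rightarrow> 'w set" where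
  "hit_event B t \<equiv> {\<omega>\<in>\<Omega>. hitting_time X B \<omega> \<le> ennreal t}"

lemma hit_event_measurable:
  assumes "B \<in> nearly_borel X" "0 \<le> t"
  shows "hit_event B t \<in> sets (completion (law X x))"
proof -
  have "hit_event B t = (\<Inter>n::nat. hits B {0<..<t + 1 / (real n + 1)})"
    using hitting_time_le_iff[OF _ assms(2)] by (auto simp: hits_def)
  also have "\<dots> \<in> sets (completion (law X x))"
    using assms(1) by (intro sets.countable_INT image_subsetI hits_nearly_borel) auto
  finally show ?thesis .
qed

lemma prob_space_completion_law: "prob_space (completion (law X x))"
proof (rule prob_spaceI)
  show "emeasure (completion (law X x)) (space (completion (law X x))) = 1"
    using prob_space.emeasure_space_1[OF prob_space_law[of x]] by simp
qed

lemma hitting_prob_emeasure: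
  "ennreal (hitting_prob X B x (ennreal t)) = emeasure (completion (law X x)) (hit_event B t)"
  unfolding hitting_prob_def
  by (rule finite_measure.emeasure_eq_measure[symmetric]) (use prob_space_completion_law in \<open>simp add: prob_space_def\<close>)

lemma hitting_prob_bounds: "0 \<le> hitting_prob X B x t" "hitting_prob X B x t \<le> 1"
  unfolding hitting_prob_def using prob_space.prob_le_1[OF prob_space_completion_law] by auto

text \<open>Outside \<open>N\<close>, the points of \<open>B\<close> lie farther than
  \<open>r\<close> from \<open>x\<close>, and \<open>N\<close> itself is almost surely not visited
  at positive times. The horizon \<open>(1 + \<eta>) * t\<close> leaves room for a genuine visit
  when the hitting time \<open>t\<close> is only an infimum.\<close>

lemma hitting_prob_upper:
  assumes B: "B \<in> nearly_borel X" and N: "N \<in> polar_sets X" and r: "ennreal r < dist_set x (B - N)"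
    and \<epsilon>: "0 < \<epsilon>" "\<epsilon> \<le> r" and \<eta>: "0 < \<eta>" "\<eta> < 1"
  obtains K t0 where "0 < K" "0 < t0"
    "\<And>t. 0 < t \<Longrightarrow> t \<le> t0 \<Longrightarrow>
      hitting_prob X B x (ennreal t) \<le> K * exp (- (1 - \<eta>) * action (r - \<epsilon>) ((1 + \<eta>) * t))"
proof -
  obtain K t0 where K: "0 < K" "0 < t0" "\<And>t y. 0 < t \<Longrightarrow> t \<le> t0 \<Longrightarrow>
      emeasure (law X y) (hits {z. r < dist y z} {0..<t}) \<le> ennreal (K * exp (- (1 - \<eta>) * action (r - \<epsilon>) t))"
    by (rule exit_bound[OF \<eta> \<epsilon>]) blast
  have "hitting_prob X B x (ennreal t) \<le> K * exp (- (1 - \<eta>) * action (r - \<epsilon>) ((1 + \<eta>) * t))"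
    if t: "0 < t" "t \<le> t0 / (1 + \<eta>)" for t
  proof -
    let ?t = "(1 + \<eta>) * t"
    let ?H = "hits {z. r < dist x z} {0..<?t}"
    have "0 < 1 + \<eta>" using \<eta> by simp
    with t have t': "0 < ?t" "?t \<le> t0" by (simp_all add: pos_le_divide_eq mult.commute)
    have "open {z. r < dist x z}" by (intro open_Collect_less continuous_intros)
    from hits_open_measurable[OF this t'(1)] have H: "?H \<in> sets (law X x)" using path_events_sub by auto
    have "AE \<omega> in law X x. \<not> hitting_time X N \<omega> < \<infinity>" using N by (simp add: polar_sets_def)
    then have ae: "AE \<omega> in law X x. \<omega> \<in> hit_event B t \<longrightarrow> \<omega> \<in> ?H"
    proof eventually_elim
      case (elim \<omega>)
      show ?case
      proof
        assume w: "\<omega> \<in> hit_event B t"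
        obtain n :: nat where "1 / (\<eta> * t) < real n" using reals_Archimedean2 by blast
        moreover have ht: "0 < \<eta> * t" using \<eta> t by simp
        ultimately have "1 < \<eta> * t * (real n + 1)" by (simp add: divide_less_eq distrib_left mult.commute)
        then have n: "1 / (real n + 1) < \<eta> * t" by (simp add: divide_less_eq)
        have "\<omega> \<in> hits B {0<..<t + 1 / (real n + 1)}" using w t hitting_time_le_iff[of \<omega> t B] by auto
        then obtain s where s: "0 < s" "s < t + 1 / (real n + 1)" "visits X B s \<omega>" by (auto simp: hits_def)
        have "\<not> visits X N s \<omega>"
        proof
          assume "visits X N s \<omega>"
          then have "hitting_time X N \<omega> \<le> ennreal s"
            unfolding hitting_time_def using s(1) by (intro Inf_lower) (auto simp: visits_def)
          with elim show False by (simp add: less_top[symmetric] top_unique)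
        qed
        with s(3) have v: "visits X (B - N) s \<omega>" by (simp add: visits_Diff)
        have "B - N \<subseteq> {z. r < dist x z}"
        proof
          fix z assume "z \<in> B - N"
          then have "dist_set x (B - N) \<le> ennreal (dist x z)" unfolding dist_set_def by (rule INF_lower)
          with r have "ennreal r < ennreal (dist x z)" by (rule less_le_trans)
          then show "z \<in> {z. r < dist x z}" using \<epsilon> by (simp add: ennreal_less_iff)
        qed
        from visits_mono[OF v this] show "\<omega> \<in> ?H"
          using s n w by (auto simp: hits_def algebra_simps intro!: bexI[of _ s])
      qed
    qed
    have "emeasure (completion (law X x)) (hit_event B t) \<le> emeasure (completion (law X x)) ?H"
      using AE_completion[OF ae] H by (intro emeasure_mono_AE) auto
    also have "\<dots> = emeasure (law X x) ?H" using H by simp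
    also have "\<dots> \<le> ennreal (K * exp (- (1 - \<eta>) * action (r - \<epsilon>) ?t))" by (rule K(3)[OF t'])
    finally show ?thesis
      using K(1) by (simp add: hitting_prob_emeasure[symmetric] ennreal_le_iff)
  qed
  moreover have "0 < t0 / (1 + \<eta>)" using K \<eta> by simp
  ultimately show ?thesis using that K(1) by blast
qed

lemma nearly_borel_Int_open:
  assumes "B \<in> nearly_borel X" "open U"
  shows "B \<inter> U \<in> nearly_borel X"
  unfolding nearly_borel_def
proof (intro CollectI allI impI)
  fix \<nu> :: "'e measure" assume "prob_on \<nu>"
  then obtain B1 B2 where B: "B1 \<in> sets borel" "B2 \<in> sets borel" "B1 \<subseteq> B" "B \<subseteq> B2"
    and ae: "AE \<omega> in law_init X \<nu>. \<not> (\<exists>t. traj X t \<omega> \<in> Some ` (B2 - B1))"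
    using assms(1) unfolding nearly_borel_def by blast
  from ae have "AE \<omega> in law_init X \<nu>. \<not> (\<exists>t. traj X t \<omega> \<in> Some ` (B2 \<inter> U - B1 \<inter> U))"
    by eventually_elim blast
  then show "\<exists>C1\<in>sets borel. \<exists>C2\<in>sets borel. C1 \<subseteq> B \<inter> U \<and> B \<inter> U \<subseteq> C2 \<and>
      (AE \<omega> in law_init X \<nu>. \<not> (\<exists>t. traj X t \<omega> \<in> Some ` (C2 - C1)))"
    using B assms(2) by (intro bexI[of _ "B1 \<inter> U"] bexI[of _ "B2 \<inter> U"]) auto
qed

lemma hitting_prob_lower:
  assumes B: "B \<in> nearly_borel X" and R0: "dist_mod_polar X x B < ennreal R0" "R0 < R" "0 < R"
    and \<eta>: "0 < \<eta>" "\<eta> < 1"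
  obtains M0 t0 where "0 < M0" "0 < t0"
    "\<And>t. 0 < t \<Longrightarrow> t \<le> t0 \<Longrightarrow>
      M0 * (t powr (1 - \<nu>) * exp (- action R ((1 - \<eta>) * t))) \<le> hitting_prob X B x (ennreal t)"
proof -
  define A where "A = B \<inter> ball x R0"
  have A: "A \<in> nearly_borel X" unfolding A_def by (intro nearly_borel_Int_open B open_ball)
  \<comment> \<open>If \<open>A\<close> were polar, removing it would push the distance modulo polar
    sets up to at least \<open>R0\<close>.\<close>
  have "ennreal R0 \<le> dist_set x (B - A)"
    unfolding dist_set_def by (intro INF_greatest ennreal_leI) (auto simp: A_def)
  then have "A \<notin> polar_sets X"
    using R0(1) SUP_upper[of A "polar_sets X" "\<lambda>N. dist_set x (B - N)"]
    unfolding dist_mod_polar_def by (meson leD le_less_trans)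
  obtain A1 where A1: "A1 \<in> sets borel" "A1 \<subseteq> A"
    "\<And>y. AE \<omega> in law X y. \<forall>t>0. visits X A t \<omega> \<longrightarrow> visits X A1 t \<omega>"
    by (rule nearly_borel_core[OF A]) blast
  \<comment> \<open>Non-polarity passes to the Borel core because it catches the visits to
    \<open>A\<close> at all positive times, almost surely from every starting point.\<close>
  have nonpolar: "\<not> (\<forall>y. AE \<omega> in law X y. \<forall>t>0. \<not> visits X A1 t \<omega>)"
  proof
    assume *: "\<forall>y. AE \<omega> in law X y. \<forall>t>0. \<not> visits X A1 t \<omega>"
    have "AE \<omega> in law X y. \<not> hitting_time X A \<omega> < \<infinity>" for y
      using *[rule_format, of y] A1(3)[of y] AE_space
    proof eventually_elim
      case (elim \<omega>)
      then have "hitting_time X A \<omega> = \<infinity>" by (intro hitting_time_infinite) auto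
      then show ?case by simp
    qed
    with A have "A \<in> polar_sets X" by (simp add: polar_sets_def)
    with \<open>A \<notin> polar_sets X\<close> show False by simp
  qed
  have A1_sub: "A1 \<subseteq> ball x R0" using A1(2) by (auto simp: A_def)
  obtain M0 t0 where M0: "0 < M0" "0 < t0"
    "\<And>t. 0 < t \<Longrightarrow> t \<le> t0 \<Longrightarrow> ennreal (M0 * (t powr (1 - \<nu>) * exp (- action R ((1 - \<eta>) * t))))
      \<le> emeasure (completion (law X x)) (hits A1 {(1 - \<eta>) * t<..t})"
    by (rule hitting_lower_bound[OF A1(1) A1_sub R0(2,3) nonpolar \<eta>]) blast
  have "M0 * (t powr (1 - \<nu>) * exp (- action R ((1 - \<eta>) * t))) \<le> hitting_prob X B x (ennreal t)"
    if t: "0 < t" "t \<le> t0" for t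
  proof -
    have "hits A1 {(1 - \<eta>) * t<..t} \<subseteq> hit_event B t"
    proof
      fix \<omega> assume "\<omega> \<in> hits A1 {(1 - \<eta>) * t<..t}"
      then obtain s where s: "\<omega> \<in> \<Omega>" "(1 - \<eta>) * t < s" "s \<le> t" "visits X A1 s \<omega>" by (auto simp: hits_def)
      have "0 < (1 - \<eta>) * t" using t \<eta> by simp
      then have "0 < s" using s by simp
      have "visits X B s \<omega>" using s(4) by (rule visits_mono) (use A1(2) in \<open>auto simp: A_def\<close>)
      then have "hitting_time X B \<omega> \<le> ennreal s"
        unfolding hitting_time_def using \<open>0 < s\<close> by (intro Inf_lower) (auto simp: visits_def)
      also have "\<dots> \<le> ennreal t" using s by (intro ennreal_leI)
      finally show "\<omega> \<in> hit_event B t" using s by simp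
    qed
    then have "emeasure (completion (law X x)) (hits A1 {(1 - \<eta>) * t<..t}) \<le> emeasure (completion (law X x)) (hit_event B t)"
      using t by (intro emeasure_mono hit_event_measurable B) auto
    with M0(3)[OF t] have "ennreal (M0 * (t powr (1 - \<nu>) * exp (- action R ((1 - \<eta>) * t)))) \<le> ennreal (hitting_prob X B x (ennreal t))"
      unfolding hitting_prob_emeasure by (rule order.trans)
    then show ?thesis by (simp add: ennreal_le_iff hitting_prob_bounds)
  qed
  with M0 show ?thesis by (intro that[of M0 t0]) auto
qed

section \<open>The logarithmic rate and its limit\<close>

abbreviation rate :: "'e set \<Rightarrow> 'e \<Rightarrow> real \<Rightarrow> ereal" where
  "rate B x t \<equiv> - ereal (t powr \<delta>) * elog (hitting_prob X B x (ennreal t)) / ereal C2"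

lemma rate_eq:
  "0 < hitting_prob X B x (ennreal t) \<Longrightarrow> rate B x t = ereal (- (t powr \<delta>) * ln (hitting_prob X B x (ennreal t)) / C2)"
  using pos by (simp add: elog_def)

lemma rate_infinite: "0 < t \<Longrightarrow> hitting_prob X B x (ennreal t) = 0 \<Longrightarrow> rate B x t = \<infinity>"
  using pos by (simp add: elog_def)

lemma rate_nonneg:
  assumes t: "0 < t"
  shows "0 \<le> rate B x t"
proof (cases "hitting_prob X B x (ennreal t) = 0")
  case False
  then have q: "0 < hitting_prob X B x (ennreal t)" using hitting_prob_bounds(1)[of B x "ennreal t"] by simp
  then have "ln (hitting_prob X B x (ennreal t)) \<le> 0" using hitting_prob_bounds(2)[of B x "ennreal t"] by simp
  then have "0 \<le> - (t powr \<delta>) * ln (hitting_prob X B x (ennreal t)) / C2"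
    using pos by (intro divide_nonneg_pos mult_nonpos_nonpos) auto
  then show ?thesis unfolding rate_eq[OF q] by simp
next
  case True
  show ?thesis unfolding rate_infinite[OF t True] by simp
qed

text \<open>Constants and powers of \<open>t\<close> in front of the exponentials become
  \<open>a + b * ln t\<close> under the logarithm, and \<open>t powr \<delta>\<close> suppresses
  both.\<close>

lemma powr_ln_tendsto: "((\<lambda>t. - (t powr \<delta>) * (a + b * ln t) / C2) \<longlongrightarrow> 0) (at_right 0)"
proof -
  have "((\<lambda>t::real. t powr \<delta>) \<longlongrightarrow> 0) (at_right 0)" "((\<lambda>t::real. t powr \<delta> * ln t) \<longlongrightarrow> 0) (at_right 0)"
    using exponents(2) by real_asymp+
  then have "((\<lambda>t. (- a / C2) * t powr \<delta> + (- b / C2) * (t powr \<delta> * ln t)) \<longlongrightarrow> (- a / C2) * 0 + (- b / C2) * 0) (at_right 0)"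
    by (intro tendsto_intros)
  moreover have "(\<lambda>t. (- a / C2) * t powr \<delta> + (- b / C2) * (t powr \<delta> * ln t)) = (\<lambda>t. - (t powr \<delta>) * (a + b * ln t) / C2)"
    using pos by (intro ext) (simp add: field_simps)
  ultimately show ?thesis by simp
qed

lemma add_mult_divide: "(u + C2 * v) / C2 = u / C2 + v"
  using pos by (simp add: field_simps)

lemma action_scale: "0 < t \<Longrightarrow> 0 < b \<Longrightarrow> t powr \<delta> * action r (b * t) = C2 * (r powr \<gamma> / b powr \<delta>)"
  by (simp add: action_def powr_mult field_simps)

text \<open>A level below the limit leaves room for a radius \<open>r\<close> below the distance
  modulo polar sets. That distance is a supremum, so a single polar set suffices for
  \<open>r\<close>, and the upper estimate with this set applies.\<close>

lemma rate_lower: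
  assumes B: "B \<in> nearly_borel X" and v: "v < epowr (dist_mod_polar X x B) \<gamma>"
  shows "\<forall>\<^sub>F t in at_right 0. v < rate B x t"
proof (cases "v < 0")
  \<comment> \<open>Negative levels are treated apart because the argument below needs a positive
    radius.\<close>
  case True
  have "\<forall>\<^sub>F t::real in at_right 0. 0 < t" by (rule eventually_at_right_less)
  then show ?thesis by eventually_elim (use True rate_nonneg less_le_trans in blast)
next
  case False
  let ?d = "dist_mod_polar X x B"
  obtain v' where v': "v = ereal v'" "0 \<le> v'"
    using False v by (cases v) auto
  have gp: "0 < \<gamma>" "0 < 1 / \<gamma>" using exponents by auto
  \<comment> \<open>For an infinite distance every radius is admissible, which also yields the
    infinite limit for a polar \<open>B\<close>; otherwise the midpoint leaves strict room on both
    sides.\<close>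
  obtain w where w: "v' < w" "ennreal (w powr (1 / \<gamma>)) < ?d"
  proof (cases "?d = \<infinity>")
    case True
    then show ?thesis by (intro that[of "v' + 1"]) auto
  next
    case False
    then obtain d where d: "?d = ennreal d" "0 \<le> d" by (cases ?d) auto
    have vd: "v' < d powr \<gamma>" using v d by (simp add: v' epowr_def)
    define w where "w = (v' + d powr \<gamma>) / 2"
    have w: "v' < w" "w < d powr \<gamma>" using vd by (auto simp: w_def)
    have "w powr (1 / \<gamma>) < (d powr \<gamma>) powr (1 / \<gamma>)"
      using w v' gp by (intro powr_less_mono2) auto
    also have "\<dots> = d" using gp d by (simp add: powr_powr)
    finally show ?thesis using w d by (intro that[of w]) (auto simp: ennreal_less_iff)
  qed
  define r where "r = w powr (1 / \<gamma>)"
  have r: "0 < r" "r powr \<gamma> = w" using w v' gp by (auto simp: r_def powr_powr)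
  obtain N where N: "N \<in> polar_sets X" "ennreal r < dist_set x (B - N)"
    using w(2) unfolding r_def[symmetric] dist_mod_polar_def less_SUP_iff by blast
  \<comment> \<open>The three losses of the upper estimate: \<open>1 - \<eta>\<close> from the tail
    comparison, \<open>\<eta> * r\<close> from the smaller exit radius, \<open>1 + \<eta>\<close>
    from the enlarged horizon.\<close>
  let ?f = "\<lambda>\<eta>. (1 - \<eta>) * ((r - \<eta> * r) powr \<gamma> / (1 + \<eta>) powr \<delta>)"
  have "(?f \<longlongrightarrow> (1 - 0) * ((r - 0 * r) powr \<gamma> / (1 + 0) powr \<delta>)) (at_right 0)"
    using r by (intro tendsto_intros) auto
  then have "(?f \<longlongrightarrow> w) (at_right 0)" using r by simp
  then have "\<forall>\<^sub>F \<eta> in at_right 0. v' < ?f \<eta>" using w(1) by (rule order_tendstoD)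
  then obtain b where b: "0 < b" "\<And>\<eta>. 0 < \<eta> \<Longrightarrow> \<eta> < b \<Longrightarrow> v' < ?f \<eta>"
    unfolding eventually_at_right_field by auto
  define \<eta> where "\<eta> = min (b / 2) (1 / 2)"
  have \<eta>: "0 < \<eta>" "\<eta> < 1" "v' < ?f \<eta>" using b by (auto simp: \<eta>_def)
  have er: "0 < \<eta> * r" "\<eta> * r \<le> r" using r \<eta> by auto
  obtain K t0 where K: "0 < K" "0 < t0"
    "\<And>t. 0 < t \<Longrightarrow> t \<le> t0 \<Longrightarrow>
      hitting_prob X B x (ennreal t) \<le> K * exp (- (1 - \<eta>) * action (r - \<eta> * r) ((1 + \<eta>) * t))"
    by (rule hitting_prob_upper[OF B N er \<eta>(1,2)]) blast
  have "((\<lambda>t. - (t powr \<delta>) * ln K / C2 + ?f \<eta>) \<longlongrightarrow> 0 + ?f \<eta>) (at_right 0)"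
    using powr_ln_tendsto[of "ln K" 0] by (intro tendsto_add tendsto_const) simp
  then have "\<forall>\<^sub>F t in at_right 0. v' < - (t powr \<delta>) * ln K / C2 + ?f \<eta>"
    using \<eta>(3) by (intro order_tendstoD) auto
  moreover have "\<forall>\<^sub>F t in at_right 0. 0 < t \<and> t \<le> t0"
    unfolding eventually_at_right_field using K(2) by (intro exI[of _ t0]) auto
  ultimately show ?thesis
  proof eventually_elim
    case (elim t)
    show ?case
    proof (cases "hitting_prob X B x (ennreal t) = 0")
      case True
      have "0 < t" using elim by simp
      from rate_infinite[OF this True] show ?thesis unfolding v' by simp
    next
      case False
      then have q: "0 < hitting_prob X B x (ennreal t)" using hitting_prob_bounds(1)[of B x "ennreal t"] by simp
      let ?a = "action (r - \<eta> * r) ((1 + \<eta>) * t)"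
      have "ln (hitting_prob X B x (ennreal t)) \<le> ln (K * exp (- (1 - \<eta>) * ?a))"
        using q K elim by simp
      also have "\<dots> = ln K - (1 - \<eta>) * ?a" using K by (simp add: ln_mult algebra_simps)
      finally have "t powr \<delta> * ln (hitting_prob X B x (ennreal t)) \<le> t powr \<delta> * (ln K - (1 - \<eta>) * ?a)"
        by (intro mult_left_mono) auto
      also have "\<dots> = t powr \<delta> * ln K - (1 - \<eta>) * (t powr \<delta> * ?a)" by (simp add: algebra_simps)
      also have "t powr \<delta> * ?a = C2 * ((r - \<eta> * r) powr \<gamma> / (1 + \<eta>) powr \<delta>)"
        using elim \<eta> by (intro action_scale) auto
      finally have "(- (t powr \<delta>) * ln K + C2 * ?f \<eta>) / C2 \<le> - (t powr \<delta>) * ln (hitting_prob X B x (ennreal t)) / C2"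
        using pos by (intro divide_right_mono) (auto simp: algebra_simps)
      moreover have "(- (t powr \<delta>) * ln K + C2 * ?f \<eta>) / C2 = - (t powr \<delta>) * ln K / C2 + ?f \<eta>"
        by (rule add_mult_divide)
      ultimately show ?thesis using elim unfolding rate_eq[OF q] v' by simp
    qed
  qed
qed

lemma rate_upper:
  assumes B: "B \<in> nearly_borel X" and v: "epowr (dist_mod_polar X x B) \<gamma> < v"
  shows "\<forall>\<^sub>F t in at_right 0. rate B x t < v"
proof -
  let ?d = "dist_mod_polar X x B"
  have "?d \<noteq> \<infinity>" using v by (auto simp: epowr_def)
  then obtain d where d: "?d = ennreal d" "0 \<le> d" by (cases ?d) auto
  have "ereal (d powr \<gamma>) < v" using v d by (simp add: epowr_def)
  then obtain v' where v': "d powr \<gamma> < v'" "ereal v' < v" using ereal_dense2 by force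
  \<comment> \<open>\<open>d + 2 * s\<close> is the radius of the ball that carries the mass of
    \<open>G h\<close>, with \<open>d + s\<close> left for the ball that contains \<open>A\<close>;
    \<open>1 - s\<close> comes from the start of the time window.\<close>
  let ?f = "\<lambda>s. (d + 2 * s) powr \<gamma> / (1 - s) powr \<delta>"
  have "(?f \<longlongrightarrow> (d + 2 * 0) powr \<gamma> / (1 - 0) powr \<delta>) (at_right 0)"
    using exponents d by (intro tendsto_divide tendsto_powr' tendsto_intros)
      (auto intro!: eventually_at_right_less[THEN eventually_mono])
  then have "(?f \<longlongrightarrow> d powr \<gamma>) (at_right 0)" by simp
  then have "\<forall>\<^sub>F s in at_right 0. ?f s < v'" using v'(1) by (rule order_tendstoD)
  then obtain b where b: "0 < b" "\<And>s. 0 < s \<Longrightarrow> s < b \<Longrightarrow> ?f s < v'"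
    unfolding eventually_at_right_field by auto
  define \<eta> where "\<eta> = min (b / 2) (1 / 2)"
  have \<eta>: "0 < \<eta>" "\<eta> < 1" "?f \<eta> < v'" using b by (auto simp: \<eta>_def)
  define R where "R = d + 2 * \<eta>"
  have R: "?d < ennreal (d + \<eta>)" "d + \<eta> < R" "0 < R"
    using d \<eta> by (auto simp: R_def ennreal_less_iff)
  obtain M0 t0 where M0: "0 < M0" "0 < t0"
    "\<And>t. 0 < t \<Longrightarrow> t \<le> t0 \<Longrightarrow>
      M0 * (t powr (1 - \<nu>) * exp (- action R ((1 - \<eta>) * t))) \<le> hitting_prob X B x (ennreal t)"
    by (rule hitting_prob_lower[OF B R \<eta>(1,2)]) blast
  have "((\<lambda>t. - (t powr \<delta>) * (ln M0 + (1 - \<nu>) * ln t) / C2 + ?f \<eta>) \<longlongrightarrow> 0 + ?f \<eta>) (at_right 0)"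
    by (intro tendsto_add tendsto_const powr_ln_tendsto)
  then have "\<forall>\<^sub>F t in at_right 0. - (t powr \<delta>) * (ln M0 + (1 - \<nu>) * ln t) / C2 + ?f \<eta> < v'"
    using \<eta>(3) by (intro order_tendstoD) auto
  moreover have "\<forall>\<^sub>F t in at_right 0. 0 < t \<and> t \<le> t0"
    unfolding eventually_at_right_field using M0(2) by (intro exI[of _ t0]) auto
  ultimately show ?thesis
  proof eventually_elim
    case (elim t)
    let ?a = "action R ((1 - \<eta>) * t)" and ?q = "hitting_prob X B x (ennreal t)"
    have m: "0 < M0 * (t powr (1 - \<nu>) * exp (- ?a))" using M0 elim by simp
    then have q: "0 < ?q" using M0(3)[of t] elim by linarith
    have "ln (M0 * (t powr (1 - \<nu>) * exp (- ?a))) \<le> ln ?q" using m q M0(3)[of t] elim by simp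
    moreover have "ln (M0 * (t powr (1 - \<nu>) * exp (- ?a))) = ln M0 + (1 - \<nu>) * ln t - ?a"
      using M0 elim by (simp add: ln_mult ln_powr)
    ultimately have "t powr \<delta> * (ln M0 + (1 - \<nu>) * ln t - ?a) \<le> t powr \<delta> * ln ?q"
      by (intro mult_left_mono) auto
    moreover have "t powr \<delta> * ?a = C2 * ?f \<eta>"
      unfolding R_def using elim \<eta> by (intro action_scale) auto
    ultimately have "t powr \<delta> * (ln M0 + (1 - \<nu>) * ln t) - C2 * ?f \<eta> \<le> t powr \<delta> * ln ?q"
      by (simp add: right_diff_distrib)
    then have "- (t powr \<delta>) * ln ?q / C2 \<le> (- (t powr \<delta>) * (ln M0 + (1 - \<nu>) * ln t) + C2 * ?f \<eta>) / C2"
      using pos by (intro divide_right_mono) auto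
    also have "\<dots> = - (t powr \<delta>) * (ln M0 + (1 - \<nu>) * ln t) / C2 + ?f \<eta>"
      by (rule add_mult_divide)
    finally have "ereal (- (t powr \<delta>) * ln ?q / C2) < ereal v'" using elim by simp
    then show ?case unfolding rate_eq[OF q] using v'(2) by (rule less_trans)
  qed
qed

theorem rate_tendsto:
  assumes "B \<in> nearly_borel X"
  shows "((\<lambda>t. rate B x t) \<longlongrightarrow> epowr (dist_mod_polar X x B) \<gamma>) (at_right 0)"
  by (rule order_tendstoI) (use rate_lower rate_upper assms in blast)+

end

theorem corollary6p4:
  fixes \<mu> :: "'e::{metric_space, second_countable_topology} measure"
    and X :: "('w, 'e) process"
    and p :: "real \<Rightarrow> 'e \<Rightarrow> 'e \<Rightarrow> real"
    and \<alpha> \<beta> C0 C2 T c C :: real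
    and x :: 'e and B :: "'e set"
  assumes lusin: "lusin (UNIV :: 'e set)"
    and mu: "sets \<mu> = sets borel" "sigma_finite_measure \<mu>" "full_support \<mu>"
    and X: "borel_right_process X" "abs_cont_transition \<mu> X"
    and p: "transition_density \<mu> X p"
    and volume: "C0 > 0" "\<alpha> > 0"
      "\<And>x r. r > 0 \<Longrightarrow> emeasure \<mu> (ball x r) \<le> ennreal (C0 * r powr \<alpha>)"
    and proper: "\<And>S :: 'e set. closed S \<Longrightarrow> bounded S \<Longrightarrow> compact S"
    and cases: "symmetry_assumption \<mu> X p
      \<or> (\<exists>Y :: ('v, 'e) process. duality_assumption \<mu> X Y p)
      \<or> sector_assumption \<mu> X"
    and constants: "\<beta> > 1" "C2 > 0" "T > 0" "c > 0" "C > 0"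
    and bounds: "\<And>t y z. 0 < t \<Longrightarrow> t \<le> T \<Longrightarrow>
      c / t powr (\<alpha> / \<beta>) * exp (- C2 * (dist y z / t powr (1 / \<beta>)) powr (\<beta> / (\<beta> - 1))) \<le> p t y z \<and>
      p t y z \<le> C / t powr (\<alpha> / \<beta>) * exp (- C2 * (dist y z / t powr (1 / \<beta>)) powr (\<beta> / (\<beta> - 1)))"
    and B: "B \<in> nearly_borel X"
  shows "((\<lambda>t. - ereal (t powr (1 / (\<beta> - 1))) * elog (hitting_prob X B x (ennreal t)) / ereal C2)
           \<longlongrightarrow> epowr (dist_mod_polar X x B) (\<beta> / (\<beta> - 1))) (at_right 0)"
proof -
  have fin: "emeasure \<mu> (ball y r) < \<infinity>" for y r
  proof (cases "r > 0")
    case True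
    then show ?thesis using volume(3)[of r y] by (simp add: le_less_trans)
  next
    case False
    then have empty: "ball y r = {}" by auto
    show ?thesis unfolding empty by simp
  qed
  interpret heat_process X \<mu> p \<alpha> \<beta> C2 T c C
    by (intro heat_process.intro density_process.intro right_process.intro density_process_axioms.intro
        heat_process_axioms.intro) (fact X(1) mu p constants volume(2) bounds fin)+
  from rate_tendsto[OF B, of x] show ?thesis
    unfolding \<gamma>_def \<delta>_def .
qed

end
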